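(* For every $\varepsilon>0$ there exists $c=c(\varepsilon)>0$ such that the following holds. If $p=p(n)$ satisfies $p\ge (1+\varepsilon)\log{n}/n$, then the binomial random graph $G\sim G(n,p)$ is with high probability $d$-rigid for $d=\lfloor c n p\rfloor$.
   Context: A $d$-dimensional framework is a pair $(G,\mathbf{p})$ with $G=(V,E)$ a finite simple graph and $\mathbf{p}:V\to\mathbb{R}^d$. It is rigid if every continuous motion of the vertices starting at $\mathbf{p}$ that preserves all edge lengths preserves the distances between all pairs of vertices. A map $\mathbf{p}:V\to\mathbb{R}^d$ is generic if its $d|V|$ coordinates are algebraically independent over $\mathbb{Q}$. A graph $G$ is $d$-rigid if $(G,\mathbf{p})$ is rigid for some (equivalently, every) generic $\mathbf{p}:V\to\mathbb{R}^d$. $G(n,p)$ is the random graph on $[n]=\{1,\dots,n\}$ in which each pair of vertices is an edge independently with probability $p$. An event holds with high probability if its probability tends to $1$ as $n\to\infty$. $\log$ is the natural logarithm. *)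

theory Defs
  imports "HOL-Probability.Probability" "HOL-Library.Poly_Mapping"
begin

text \<open>A graph is a pair of a vertex set and a set of edges, each edge being a two-element
  set of vertices.\<close>

type_synonym 'a graph = "'a set \<times> 'a set set"

definition vertex_pairs :: "'a set \<Rightarrow> 'a set set" where
  "vertex_pairs V = {e. e \<subseteq> V \<and> card e = 2}"

definition finite_simple_graph :: "'a graph \<Rightarrow> bool" where
  "finite_simple_graph G \<longleftrightarrow> finite (fst G) \<and> snd G \<subseteq> vertex_pairs (fst G)"

text \<open>Since the dimension varies with the number of vertices, the space of dimension \<open>d\<close> is
  \<^const>\<open>Euclidean_space\<close>: its points are the \<open>x :: nat \<Rightarrow> real\<close> with \<open>x i = 0\<close> for all
  \<open>i \<ge> d\<close>.\<close>

definition euclidean_dist :: "nat \<Rightarrow> (nat \<Rightarrow> real) \<Rightarrow> (nat \<Rightarrow> real) \<Rightarrow> real" where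
  "euclidean_dist d x y = L2_set (\<lambda>i. x i - y i) {..<d}"

definition framework :: "nat \<Rightarrow> 'a graph \<Rightarrow> ('a \<Rightarrow> nat \<Rightarrow> real) \<Rightarrow> bool" where
  "framework d G \<pp> \<longleftrightarrow>
     finite_simple_graph G \<and> (\<forall>v\<in>fst G. \<pp> v \<in> topspace (Euclidean_space d))"

definition continuous_motion ::
  "nat \<Rightarrow> 'a graph \<Rightarrow> ('a \<Rightarrow> nat \<Rightarrow> real) \<Rightarrow> (real \<Rightarrow> 'a \<Rightarrow> nat \<Rightarrow> real) \<Rightarrow> bool" where
  "continuous_motion d G \<pp> \<gamma> \<longleftrightarrow>
     (\<forall>v\<in>fst G. continuous_map (top_of_set {0..1}) (Euclidean_space d) (\<lambda>t. \<gamma> t v) \<and>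
                \<gamma> 0 v = \<pp> v)"

definition rigid :: "nat \<Rightarrow> 'a graph \<Rightarrow> ('a \<Rightarrow> nat \<Rightarrow> real) \<Rightarrow> bool" where
  "rigid d G \<pp> \<longleftrightarrow>
     (\<forall>\<gamma>. continuous_motion d G \<pp> \<gamma> \<and>
          (\<forall>t\<in>{0..1}. \<forall>u v. {u, v} \<in> snd G \<longrightarrow>
             euclidean_dist d (\<gamma> t u) (\<gamma> t v) = euclidean_dist d (\<pp> u) (\<pp> v)) \<longrightarrow>
          (\<forall>t\<in>{0..1}. \<forall>u\<in>fst G. \<forall>v\<in>fst G.
             euclidean_dist d (\<gamma> t u) (\<gamma> t v) = euclidean_dist d (\<pp> u) (\<pp> v)))"

text \<open>A polynomial over the rationals in variables indexed by \<open>'i\<close> is a finitely supported map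
  from monomials to coefficients, a monomial being a finitely supported map from variables
  to exponents.\<close>

definition eval_rat_poly ::
  "('i \<Rightarrow> real) \<Rightarrow> (('i \<Rightarrow>\<^sub>0 nat) \<Rightarrow>\<^sub>0 rat) \<Rightarrow> real" where
  "eval_rat_poly x P =
     (\<Sum>m\<in>Poly_Mapping.keys P. of_rat (Poly_Mapping.lookup P m) *
        (\<Prod>i\<in>Poly_Mapping.keys m. x i ^ Poly_Mapping.lookup m i))"

definition alg_independent_rat :: "'i set \<Rightarrow> ('i \<Rightarrow> real) \<Rightarrow> bool" where
  "alg_independent_rat I x \<longleftrightarrow>
     (\<forall>P. (\<forall>m\<in>Poly_Mapping.keys P. Poly_Mapping.keys m \<subseteq> I) \<and> eval_rat_poly x P = 0 \<longrightarrow> P = 0)"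

definition generic :: "nat \<Rightarrow> 'a set \<Rightarrow> ('a \<Rightarrow> nat \<Rightarrow> real) \<Rightarrow> bool" where
  "generic d V \<pp> \<longleftrightarrow> alg_independent_rat (V \<times> {..<d}) (\<lambda>(v, i). \<pp> v i)"

definition d_rigid :: "nat \<Rightarrow> 'a graph \<Rightarrow> bool" where
  "d_rigid d G \<longleftrightarrow> (\<exists>\<pp>. framework d G \<pp> \<and> generic d (fst G) \<pp> \<and> rigid d G \<pp>)"

text \<open>\<^const>\<open>Pi_pmf\<close> makes the indicators \<open>\<omega> e\<close> of the vertex pairs \<open>e\<close> independent; its
  argument \<^const>\<open>False\<close> is only the value of \<open>\<omega>\<close> outside the set of pairs.\<close>

definition binomial_random_graph :: "nat \<Rightarrow> real \<Rightarrow> nat graph pmf" where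
  "binomial_random_graph n p =
     map_pmf (\<lambda>\<omega>. ({1..n}, {e \<in> vertex_pairs {1..n}. \<omega> e}))
       (Pi_pmf (vertex_pairs {1..n}) False (\<lambda>_. bernoulli_pmf p))"

definition with_high_probability :: "(nat \<Rightarrow> 'b pmf) \<Rightarrow> (nat \<Rightarrow> 'b \<Rightarrow> bool) \<Rightarrow> bool" where
  "with_high_probability M A \<longleftrightarrow>
     (\<lambda>n. measure_pmf.prob (M n) {x. A n x}) \<longlonglongrightarrow> 1"

end

theory Submission
  imports Defs "Jordan_Normal_Form.Determinant" "HOL-Real_Asymp.Real_Asymp"
begin

text \<open>At a fixed generic \<open>p\<close>, an edge set is rigid iff its rows of the rigidity matrix span all
  rows. Let the defect \<open>f(X)\<close> be the number of further rows that \<open>X\<close> needs for this. A random pair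
  outside the closure of \<open>X\<close> lowers the defect, and \<open>f \<le> d n\<close> at the start, so that after half of the
  edges only a small fraction of the pairs is missing from the closure. On the large set \<open>U\<close> of vertices
  with few missing pairs, contracting well-chosen pairs of vertices squares the density of missing pairs, whence
  \<open>f = O(d\<^sup>2 \<delta>\<^sup>2)\<close> if \<open>\<delta>\<close> is that density. As long as \<open>f > 0\<close> a random pair therefore
  lowers \<open>f\<close> with probability at least of order \<open>\<surd>f / d\<close>, and Russo's formula applied to
  \<open>exp (2 \<surd>f)\<close> shows that the second half of the edges brings \<open>f\<close> down to 0 with high
  probability, with no logarithmic loss in \<open>d\<close>. The few vertices outside \<open>U\<close> are attached one at a time
  along \<open>d\<close> edges; this is where \<open>p \<ge> (1 + \<epsilon>) log n / n\<close> is needed.\<close>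

section \<open>Rational polynomials and generic points\<close>

text \<open>The density is squared because a merged pair of vertices stays missing only if both of
  its copies were missing. Merging \<open>2 * d\<close> pairs of vertices is enough: once they form
  a complete set, every vertex with \<open>d\<close> known neighbours there is attached for free, so
  only the O(d^2) pairs among them may have to be paid for. The square is what avoids a logarithm:
  defect k is lowered after an expected d / sqrt k random pairs, up to constants, and these waiting
  times sum to order d * sqrt (d * n), whereas a bound linear in the density would produce a
  harmonic sum. The potential exp (2 * sqrt f) is chosen because its relative drop, at least 1 / (2
  * sqrt f), cancels that rate. Degenerate positions enter only through lower bounds on ranks: a
  determinant that is nonzero at one position is nonzero at the generic one. The last vertices are
  attached along edges of the whole random graph rather than of a fresh batch, so that all of
  \<open>p\<close> counts towards the degrees. Spanning a large set and the absence of obstacles to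
  attachment are bounded separately for the same graph and joined by a union bound.\<close>

definition eval_mono :: "('i \<Rightarrow> real) \<Rightarrow> ('i \<Rightarrow>\<^sub>0 nat) \<Rightarrow> real" where
  "eval_mono x m = (\<Prod>i\<in>Poly_Mapping.keys m. x i ^ Poly_Mapping.lookup m i)"

lemma eval_mono_superset:
  assumes "finite S" "Poly_Mapping.keys m \<subseteq> S"
  shows "eval_mono x m = (\<Prod>i\<in>S. x i ^ Poly_Mapping.lookup m i)"
  unfolding eval_mono_def using assms
  by (intro prod.mono_neutral_left) (auto simp: in_keys_iff)

lemma eval_mono_add: "eval_mono x (m + m') = eval_mono x m * eval_mono x m'"
proof -
  let ?S = "Poly_Mapping.keys m \<union> Poly_Mapping.keys m'"
  have "eval_mono x (m + m') = (\<Prod>i\<in>?S. x i ^ Poly_Mapping.lookup (m + m') i)"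
    by (intro eval_mono_superset) (auto simp: Poly_Mapping.keys_add)
  also have "\<dots> = (\<Prod>i\<in>?S. x i ^ Poly_Mapping.lookup m i) * (\<Prod>i\<in>?S. x i ^ Poly_Mapping.lookup m' i)"
    by (simp add: lookup_add power_add prod.distrib)
  also have "\<dots> = eval_mono x m * eval_mono x m'"
    by (simp flip: eval_mono_superset)
  finally show ?thesis .
qed

lemma eval_mono_zero [simp]: "eval_mono x 0 = 1"
  by (simp add: eval_mono_def)

lemma eval_rat_poly_superset:
  assumes "finite S" "Poly_Mapping.keys P \<subseteq> S"
  shows "eval_rat_poly x P = (\<Sum>m\<in>S. of_rat (Poly_Mapping.lookup P m) * eval_mono x m)"
  unfolding eval_rat_poly_def eval_mono_def using assms
  by (intro sum.mono_neutral_left) (auto simp: in_keys_iff)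

lemma eval_rat_poly_add: "eval_rat_poly x (P + Q) = eval_rat_poly x P + eval_rat_poly x Q"
proof -
  let ?S = "Poly_Mapping.keys P \<union> Poly_Mapping.keys Q"
  have "eval_rat_poly x (P + Q) = (\<Sum>m\<in>?S. of_rat (Poly_Mapping.lookup (P + Q) m) * eval_mono x m)"
    by (intro eval_rat_poly_superset) (auto simp: Poly_Mapping.keys_add)
  also have "\<dots> = (\<Sum>m\<in>?S. of_rat (Poly_Mapping.lookup P m) * eval_mono x m)
      + (\<Sum>m\<in>?S. of_rat (Poly_Mapping.lookup Q m) * eval_mono x m)"
    by (simp add: lookup_add of_rat_add distrib_right sum.distrib)
  also have "\<dots> = eval_rat_poly x P + eval_rat_poly x Q"
    by (simp flip: eval_rat_poly_superset)
  finally show ?thesis .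
qed

lemma eval_rat_poly_single: "eval_rat_poly x (Poly_Mapping.single m c) = of_rat c * eval_mono x m"
  using eval_rat_poly_superset[of "{m}" "Poly_Mapping.single m c" x] by simp

lemma eval_rat_poly_zero [simp]: "eval_rat_poly x 0 = 0"
  by (simp add: eval_rat_poly_def)

lemma eval_rat_poly_sum: "eval_rat_poly x (sum P A) = (\<Sum>a\<in>A. eval_rat_poly x (P a))"
  by (induction A rule: infinite_finite_induct) (auto simp: eval_rat_poly_add)

text \<open>Polynomials are handled through the functions they induce, so that sums, products and
  determinants are covered by introduction rules and no determinant has to be written as a formal
  polynomial.\<close>

definition rat_poly_fun :: "'i set \<Rightarrow> (('i \<Rightarrow> real) \<Rightarrow> real) \<Rightarrow> bool" where
  "rat_poly_fun I f \<longleftrightarrow>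
     (\<exists>P. (\<forall>m\<in>Poly_Mapping.keys P. Poly_Mapping.keys m \<subseteq> I) \<and> (\<forall>x. eval_rat_poly x P = f x))"

lemma rat_poly_fun_monomial:
  "Poly_Mapping.keys m \<subseteq> I \<Longrightarrow> rat_poly_fun I (\<lambda>x. of_rat c * eval_mono x m)"
  unfolding rat_poly_fun_def
  by (rule exI[of _ "Poly_Mapping.single m c"]) (auto simp: eval_rat_poly_single)

lemma rat_poly_fun_const: "rat_poly_fun I (\<lambda>_. of_rat c)"
  using rat_poly_fun_monomial[of 0 I c] by simp

lemma rat_poly_fun_0 [intro]: "rat_poly_fun I (\<lambda>_. 0)"
  and rat_poly_fun_1 [intro]: "rat_poly_fun I (\<lambda>_. 1)"
  and rat_poly_fun_of_int [intro]: "rat_poly_fun I (\<lambda>_. of_int k)"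
  using rat_poly_fun_const[of I 0] rat_poly_fun_const[of I 1] rat_poly_fun_const[of I "of_int k"] by simp_all

lemma rat_poly_fun_var [intro]: "i \<in> I \<Longrightarrow> rat_poly_fun I (\<lambda>x. x i)"
  using rat_poly_fun_monomial[of "Poly_Mapping.single i 1" I 1] by (simp add: eval_mono_def)

lemma rat_poly_fun_add [intro]:
  assumes "rat_poly_fun I f" "rat_poly_fun I g" shows "rat_poly_fun I (\<lambda>x. f x + g x)"
proof -
  obtain P Q where P: "\<forall>m\<in>Poly_Mapping.keys P. Poly_Mapping.keys m \<subseteq> I" "\<forall>x. eval_rat_poly x P = f x"
    and Q: "\<forall>m\<in>Poly_Mapping.keys Q. Poly_Mapping.keys m \<subseteq> I" "\<forall>x. eval_rat_poly x Q = g x"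
    using assms unfolding rat_poly_fun_def by blast
  show ?thesis unfolding rat_poly_fun_def
    by (rule exI[of _ "P + Q"]) (use P Q keys_add[of P Q] in \<open>fastforce simp: eval_rat_poly_add\<close>)
qed

lemma rat_poly_fun_sum [intro]:
  "(\<And>a. a \<in> A \<Longrightarrow> rat_poly_fun I (f a)) \<Longrightarrow> rat_poly_fun I (\<lambda>x. \<Sum>a\<in>A. f a x)"
  by (induction A rule: infinite_finite_induct) auto

lemma rat_poly_fun_mult [intro]:
  assumes "rat_poly_fun I f" "rat_poly_fun I g" shows "rat_poly_fun I (\<lambda>x. f x * g x)"
proof -
  obtain P Q where P: "\<forall>m\<in>Poly_Mapping.keys P. Poly_Mapping.keys m \<subseteq> I" "\<forall>x. eval_rat_poly x P = f x"
    and Q: "\<forall>m\<in>Poly_Mapping.keys Q. Poly_Mapping.keys m \<subseteq> I" "\<forall>x. eval_rat_poly x Q = g x"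
    using assms unfolding rat_poly_fun_def by blast
  let ?c = "\<lambda>m m'. Poly_Mapping.lookup P m * Poly_Mapping.lookup Q m'"
  have "rat_poly_fun I (\<lambda>x. \<Sum>m\<in>Poly_Mapping.keys P. \<Sum>m'\<in>Poly_Mapping.keys Q. of_rat (?c m m') * eval_mono x (m + m'))"
    using P(1) Q(1) by (intro rat_poly_fun_sum rat_poly_fun_monomial) (meson keys_add Un_least order_trans)
  also have "(\<lambda>x. \<Sum>m\<in>Poly_Mapping.keys P. \<Sum>m'\<in>Poly_Mapping.keys Q. of_rat (?c m m') * eval_mono x (m + m'))
      = (\<lambda>x. f x * g x)"
  proof
    fix x
    have "f x = (\<Sum>m\<in>Poly_Mapping.keys P. of_rat (Poly_Mapping.lookup P m) * eval_mono x m)"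
      "g x = (\<Sum>m\<in>Poly_Mapping.keys Q. of_rat (Poly_Mapping.lookup Q m) * eval_mono x m)"
      using P(2) Q(2) eval_rat_poly_superset[OF finite_keys order_refl] by metis+
    then show "(\<Sum>m\<in>Poly_Mapping.keys P. \<Sum>m'\<in>Poly_Mapping.keys Q. of_rat (?c m m') * eval_mono x (m + m')) = f x * g x"
      by (simp only: sum_product) (simp add: eval_mono_add of_rat_mult mult_ac)
  qed
  finally show ?thesis .
qed

lemma rat_poly_fun_diff [intro]:
  assumes "rat_poly_fun I f" "rat_poly_fun I g" shows "rat_poly_fun I (\<lambda>x. f x - g x)"
  using rat_poly_fun_add[OF assms(1) rat_poly_fun_mult[OF rat_poly_fun_of_int[of I "-1"] assms(2)]] by simp

lemma rat_poly_fun_prod [intro]: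
  "(\<And>a. a \<in> A \<Longrightarrow> rat_poly_fun I (f a)) \<Longrightarrow> rat_poly_fun I (\<lambda>x. \<Prod>a\<in>A. f a x)"
  by (induction A rule: infinite_finite_induct) auto

lemma rat_poly_fun_det:
  assumes "\<And>i j. i < n \<Longrightarrow> j < n \<Longrightarrow> rat_poly_fun I (\<lambda>x. a x i j)"
  shows "rat_poly_fun I (\<lambda>x. Determinant.det (Matrix.mat n n (\<lambda>(i, j). a x i j)))"
proof -
  have "rat_poly_fun I (\<lambda>x. \<Sum>\<pi>\<in>{\<pi>. \<pi> permutes {0..<n}}. of_int (sign \<pi>) * (\<Prod>i = 0..<n. a x i (\<pi> i)))"
    by (intro rat_poly_fun_sum rat_poly_fun_mult rat_poly_fun_of_int rat_poly_fun_prod assms)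
      (auto simp: permutes_in_image)
  also have "(\<lambda>x. \<Sum>\<pi>\<in>{\<pi>. \<pi> permutes {0..<n}}. of_int (sign \<pi>) * (\<Prod>i = 0..<n. a x i (\<pi> i)))
      = (\<lambda>x. Determinant.det (Matrix.mat n n (\<lambda>(i, j). a x i j)))"
    by (auto simp: Determinant.det_def permutes_in_image intro!: ext sum.cong prod.cong)
  finally show ?thesis .
qed

text \<open>Transfer principle behind the uses of genericity: to see that a rational polynomial
  expression does not vanish at a generic point, it suffices to exhibit one special position
  \<open>y\<close>, however degenerate.\<close>

lemma alg_independent_rat_nonzero:
  assumes "alg_independent_rat I x" "rat_poly_fun I f" "f y \<noteq> 0"
  shows "f x \<noteq> 0"
proof
  assume "f x = 0"
  from assms(2) obtain P where P: "\<forall>m\<in>Poly_Mapping.keys P. Poly_Mapping.keys m \<subseteq> I" "\<forall>x. eval_rat_poly x P = f x"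
    unfolding rat_poly_fun_def by blast
  with \<open>f x = 0\<close> assms(1) have "P = 0" unfolding alg_independent_rat_def by metis
  then show False using P(2)[rule_format, of y] assms(3) by simp
qed

section \<open>Existence of generic points\<close>

lemma alg_independent_rat_monomials:
  assumes "alg_independent_rat I x" "finite M" "\<And>m. m \<in> M \<Longrightarrow> Poly_Mapping.keys m \<subseteq> I"
    and "(\<Sum>m\<in>M. of_rat (c m) * eval_mono x m) = 0" "m \<in> M"
  shows "c m = 0"
proof -
  let ?P = "\<Sum>m\<in>M. Poly_Mapping.single m (c m)"
  have lk: "Poly_Mapping.lookup ?P k = (if k \<in> M then c k else 0)" for k
    using assms(2) by (simp add: lookup_sum lookup_single when_def)
  have "\<forall>m\<in>Poly_Mapping.keys ?P. Poly_Mapping.keys m \<subseteq> I"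
    using assms(3) by (metis in_keys_iff lk)
  moreover have "eval_rat_poly x ?P = 0"
    by (simp add: eval_rat_poly_sum eval_rat_poly_single assms(4))
  ultimately have "?P = 0" using assms(1) unfolding alg_independent_rat_def by blast
  then show ?thesis using lk[of m] assms(5) by simp
qed

text \<open>As a polynomial in \<open>t\<close> alone, \<open>P\<close> has coefficients that are
  rational polynomials in the coordinates over \<open>I\<close>. At least one of them is a nonzero
  polynomial and hence does not vanish at \<open>x\<close>.\<close>

lemma finite_roots_last_variable:
  assumes x: "alg_independent_rat I x" and j: "j \<notin> I" and "P \<noteq> 0"
    and P: "\<forall>m\<in>Poly_Mapping.keys P. Poly_Mapping.keys m \<subseteq> insert j I"
  shows "finite {t. eval_rat_poly (x(j := t)) P = 0}"
proof -
  define r where "r m = Poly_Mapping.update j 0 m" for m :: "'a \<Rightarrow>\<^sub>0 nat"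
  let ?l = "\<lambda>m. Poly_Mapping.lookup m j"
  have kr: "Poly_Mapping.keys (r m) = Poly_Mapping.keys m - {j}" for m
    by (simp add: r_def keys_update)
  have em_r: "eval_mono (x(j := t)) m = eval_mono x (r m) * t ^ ?l m" for m t
  proof -
    have "eval_mono (x(j := t)) m = (\<Prod>i\<in>insert j (Poly_Mapping.keys m - {j}). (x(j := t)) i ^ Poly_Mapping.lookup m i)"
      by (intro eval_mono_superset) auto
    also have "\<dots> = t ^ ?l m * (\<Prod>i\<in>Poly_Mapping.keys m - {j}. x i ^ Poly_Mapping.lookup m i)"
      by (subst prod.insert) (auto intro!: prod.cong)
    also have "(\<Prod>i\<in>Poly_Mapping.keys m - {j}. x i ^ Poly_Mapping.lookup m i) = eval_mono x (r m)"
      unfolding eval_mono_def kr by (intro prod.cong) (auto simp: r_def lookup_update)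
    finally show ?thesis by (metis mult.commute)
  qed
  define q where "q = (\<Sum>m\<in>Poly_Mapping.keys P. Polynomial.monom (of_rat (Poly_Mapping.lookup P m) * eval_mono x (r m)) (?l m))"
  have poly_q: "poly q t = eval_rat_poly (x(j := t)) P" for t
    by (simp add: q_def poly_sum poly_monom eval_rat_poly_superset[OF finite_keys order_refl] em_r mult_ac del: fun_upd_apply)
  obtain m0 where m0: "m0 \<in> Poly_Mapping.keys P" using \<open>P \<noteq> 0\<close> by (metis keys_eq_empty all_not_in_conv)
  let ?K = "{m\<in>Poly_Mapping.keys P. ?l m = ?l m0}"
  have inj: "inj_on r ?K"
  proof (rule inj_onI)
    fix m m' assume "m \<in> ?K" "m' \<in> ?K" and e: "r m = r m'"
    then have "?l m = ?l m'" by simp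
    moreover have "Poly_Mapping.lookup m i = Poly_Mapping.lookup m' i" if "i \<noteq> j" for i
      using arg_cong[OF e, of "\<lambda>m. Poly_Mapping.lookup m i"] that by (simp add: r_def lookup_update)
    ultimately show "m = m'" by (metis poly_mapping_eqI)
  qed
  \<comment> \<open>\<open>?K\<close> collects the monomials that contribute to this power of
    \<open>t\<close>; deleting the variable \<open>j\<close> keeps them distinct, so they do not
    cancel.\<close>
  have "Polynomial.coeff q (?l m0) \<noteq> 0"
  proof
    assume "Polynomial.coeff q (?l m0) = 0"
    moreover have "Polynomial.coeff q (?l m0) = (\<Sum>m\<in>?K. of_rat (Poly_Mapping.lookup P m) * eval_mono x (r m))"
      by (auto simp: q_def coeff_sum sum.inter_filter intro!: sum.cong)
    moreover have "\<dots> = (\<Sum>m\<in>r ` ?K. of_rat (Poly_Mapping.lookup P (inv_into ?K r m)) * eval_mono x m)"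
      by (subst sum.reindex[OF inj]) (auto simp: inv_into_f_f[OF inj] intro!: sum.cong)
    ultimately have z: "(\<Sum>m\<in>r ` ?K. of_rat (Poly_Mapping.lookup P (inv_into ?K r m)) * eval_mono x m) = 0" by simp
    have "Poly_Mapping.keys m \<subseteq> I" if "m \<in> r ` ?K" for m
      using P that kr by blast
    from alg_independent_rat_monomials[OF x _ this z, of "r m0"] m0
    have "Poly_Mapping.lookup P (inv_into ?K r (r m0)) = 0" by simp
    moreover have "inv_into ?K r (r m0) = m0" by (rule inv_into_f_f[OF inj]) (use m0 in simp)
    ultimately show False using m0 by (metis in_keys_iff)
  qed
  then have "q \<noteq> 0" by auto
  then show ?thesis using poly_roots_finite[of q] by (simp add: poly_q)
qed

text \<open>A finitely supported map is determined by its graph over its keys, a finite set of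
  pairs.\<close>

lemma countable_poly_mapping:
  assumes "countable (UNIV :: 'k set)" "countable (UNIV :: 'v::zero set)"
  shows "countable (UNIV :: ('k \<Rightarrow>\<^sub>0 'v) set)"
proof -
  let ?g = "\<lambda>P :: 'k \<Rightarrow>\<^sub>0 'v. (\<lambda>k. (k, Poly_Mapping.lookup P k)) ` Poly_Mapping.keys P"
  have "countable {A :: ('k \<times> 'v) set. finite A \<and> A \<subseteq> UNIV}"
    using assms by (intro countable_Collect_finite_subset) (metis UNIV_Times_UNIV countable_SIGMA)
  then have "countable (range ?g)" by (rule countable_subset[rotated]) auto
  moreover have "inj ?g"
  proof (rule injI, rule poly_mapping_eqI)
    fix P Q :: "'k \<Rightarrow>\<^sub>0 'v" and k assume e: "?g P = ?g Q"
    have *: "(k, v) \<in> ?g P \<longleftrightarrow> v = Poly_Mapping.lookup P k \<and> v \<noteq> 0" for P :: "'k \<Rightarrow>\<^sub>0 'v" and v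
      by (auto simp: in_keys_iff)
    show "Poly_Mapping.lookup P k = Poly_Mapping.lookup Q k"
      using *[of "Poly_Mapping.lookup P k" P] *[of "Poly_Mapping.lookup Q k" P]
        *[of "Poly_Mapping.lookup P k" Q] *[of "Poly_Mapping.lookup Q k" Q] e by metis
  qed
  ultimately show ?thesis by (metis countable_image_inj_on)
qed

text \<open>Coordinates are chosen one after another: there are countably many polynomials, each
  forbids finitely many values of the new coordinate, and the reals are uncountable.\<close>

lemma alg_independent_rat_exists:
  fixes I :: "'i::countable set"
  assumes "finite I"
  shows "\<exists>x. alg_independent_rat I x"
  using assms
proof (induction I rule: finite_induct)
  case empty
  have "alg_independent_rat {} (\<lambda>_::'i. 0)"
    unfolding alg_independent_rat_def
  proof (intro allI impI)
    fix P :: "('i \<Rightarrow>\<^sub>0 nat) \<Rightarrow>\<^sub>0 rat"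
    assume P: "(\<forall>m\<in>Poly_Mapping.keys P. Poly_Mapping.keys m \<subseteq> {}) \<and> eval_rat_poly (\<lambda>_. 0) P = 0"
    then have "Poly_Mapping.keys P \<subseteq> {0}" by auto
    from eval_rat_poly_superset[OF _ this, of "\<lambda>_. 0"] P have "Poly_Mapping.lookup P 0 = 0" by simp
    then show "P = 0" using \<open>Poly_Mapping.keys P \<subseteq> {0}\<close>
      by (metis in_keys_iff keys_eq_empty subset_singletonD singletonI)
  qed
  then show ?case by blast
next
  case (insert j I)
  then obtain x where x: "alg_independent_rat I x" by blast
  let ?\<P> = "{P :: ('i \<Rightarrow>\<^sub>0 nat) \<Rightarrow>\<^sub>0 rat. P \<noteq> 0 \<and> (\<forall>m\<in>Poly_Mapping.keys P. Poly_Mapping.keys m \<subseteq> insert j I)}"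
  have "countable (UNIV :: (('i \<Rightarrow>\<^sub>0 nat) \<Rightarrow>\<^sub>0 rat) set)"
    by (intro countable_poly_mapping) auto
  then have "countable ?\<P>" by (rule countable_subset[rotated]) simp
  then have "countable (\<Union>P\<in>?\<P>. {t. eval_rat_poly (x(j := t)) P = 0})"
    using finite_roots_last_variable[OF x insert.hyps(2)]
    by (intro countable_UN) (auto intro: countable_finite)
  then have "(\<Union>P\<in>?\<P>. {t. eval_rat_poly (x(j := t)) P = 0}) \<noteq> UNIV"
    using uncountable_UNIV_real by (intro notI) (simp only:)
  then obtain t where "t \<notin> (\<Union>P\<in>?\<P>. {t. eval_rat_poly (x(j := t)) P = 0})"
    by blast
  then have "alg_independent_rat (insert j I) (x(j := t))"
    unfolding alg_independent_rat_def by blast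
  then show ?case by blast
qed

lemma generic_exists:
  fixes V :: "'a::countable set"
  assumes "finite V"
  shows "\<exists>p. generic d V p \<and> (\<forall>v. \<forall>i\<ge>d. p v i = 0)"
proof -
  obtain x where x: "alg_independent_rat (V \<times> {..<d}) x"
    using alg_independent_rat_exists[of "V \<times> {..<d}"] assms by auto
  \<comment> \<open>The value 0 beyond the dimension places the points in
    \<open>Euclidean_space d\<close>.\<close>
  define p where "p v i = (if i < d then x (v, i) else 0)" for v i
  have "eval_mono (\<lambda>(v, i). p v i) m = eval_mono x m" if "Poly_Mapping.keys m \<subseteq> V \<times> {..<d}" for m
    unfolding eval_mono_def using that by (intro prod.cong) (auto simp: p_def)
  then have "eval_rat_poly (\<lambda>(v, i). p v i) P = eval_rat_poly x P"
    if "\<forall>m\<in>Poly_Mapping.keys P. Poly_Mapping.keys m \<subseteq> V \<times> {..<d}" for P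
    using that by (simp add: eval_rat_poly_superset[OF finite_keys order_refl])
  then have "generic d V p" using x unfolding generic_def alg_independent_rat_def by metis
  then show ?thesis by (intro exI[of _ p]) (auto simp: p_def)
qed

section \<open>Independent rows of the rigidity matrix\<close>

text \<open>Gaussian elimination: an equation with a nonzero coefficient at \<open>k\<close>
  eliminates the unknown \<open>k\<close>, at the cost of one equation and one unknown.\<close>

lemma homogeneous_system_nonzero_solution:
  fixes a :: "'z \<Rightarrow> 'i \<Rightarrow> real"
  assumes "finite Z" "finite I" "card Z < card I"
  shows "\<exists>c. (\<exists>i\<in>I. c i \<noteq> 0) \<and> (\<forall>z\<in>Z. (\<Sum>i\<in>I. c i * a z i) = 0)"
  using assms
proof (induction Z arbitrary: I a rule: finite_induct)
  case empty
  then have "I \<noteq> {}" by auto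
  then show ?case by (intro exI[of _ "\<lambda>_. 1"]) auto
next
  case (insert z Z)
  show ?case
  proof (cases "\<forall>i\<in>I. a z i = 0")
    case True
    obtain c where "\<exists>i\<in>I. c i \<noteq> 0" "\<forall>y\<in>Z. (\<Sum>i\<in>I. c i * a y i) = 0"
      using insert.IH[of I a] insert.prems insert.hyps by auto
    with True show ?thesis by (intro exI[of _ c]) auto
  next
    case False
    then obtain k where k: "k \<in> I" "a z k \<noteq> 0" by blast
    let ?I = "I - {k}"
    let ?a = "\<lambda>y i. a y i - a y k * a z i / a z k"
    have "card Z < card ?I" using insert.prems insert.hyps k by simp
    then obtain c where c: "\<exists>i\<in>?I. c i \<noteq> 0" "\<forall>y\<in>Z. (\<Sum>i\<in>?I. c i * ?a y i) = 0"
      using insert.IH[of ?I ?a] insert.prems by auto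
    define s where "s = (\<Sum>i\<in>?I. c i * a z i) / a z k"
    define c' where "c' = c(k := - s)"
    have sum_c': "(\<Sum>i\<in>I. c' i * a y i) = (\<Sum>i\<in>?I. c i * a y i) - s * a y k" for y
      using insert.prems k by (subst sum.remove[of _ k]) (auto simp: c'_def intro!: sum.cong)
    have "(\<Sum>i\<in>I. c' i * a z i) = 0" using k by (simp add: sum_c' s_def)
    moreover have "(\<Sum>i\<in>I. c' i * a y i) = 0" if "y \<in> Z" for y
    proof -
      have "0 = (\<Sum>i\<in>?I. c i * ?a y i)" using c(2) that by simp
      also have "\<dots> = (\<Sum>i\<in>?I. c i * a y i) - (\<Sum>i\<in>?I. c i * a z i) * (a y k / a z k)"
        by (simp add: sum_subtractf right_diff_distrib sum_distrib_left sum_divide_distrib mult_ac)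
      finally show ?thesis by (simp add: sum_c' s_def)
    qed
    moreover have "\<exists>i\<in>I. c' i \<noteq> 0" using c(1) by (auto simp: c'_def)
    ultimately show ?thesis by blast
  qed
qed

lemma det_nonzero_right_inverse:
  fixes A :: "real Matrix.mat"
  assumes A: "A \<in> carrier_mat n n" and "Determinant.det A \<noteq> 0"
  obtains B where "\<And>i j. i < n \<Longrightarrow> j < n \<Longrightarrow> (\<Sum>k<n. A $$ (i, k) * B k j) = (if i = j then 1 else 0)"
    and "\<And>i j. i < n \<Longrightarrow> j < n \<Longrightarrow> (\<Sum>k<n. B i k * A $$ (k, j)) = (if i = j then 1 else 0)"
proof
  let ?D = "Determinant.det A" and ?B = "adj_mat A"
  note adj = adj_mat[OF A]
  fix i j assume ij: "i < n" "j < n"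
  have "(A * ?B) $$ (i, j) = (\<Sum>k<n. A $$ (i, k) * ?B $$ (k, j))"
    using A adj(1) ij by (simp add: scalar_prod_def lessThan_atLeast0)
  moreover have "(?B * A) $$ (i, j) = (\<Sum>k<n. ?B $$ (i, k) * A $$ (k, j))"
    using A adj(1) ij by (simp add: scalar_prod_def lessThan_atLeast0)
  ultimately have *: "(\<Sum>k<n. A $$ (i, k) * ?B $$ (k, j)) = ?D * (if i = j then 1 else 0)"
    "(\<Sum>k<n. ?B $$ (i, k) * A $$ (k, j)) = ?D * (if i = j then 1 else 0)"
    using adj ij by simp_all
  show "(\<Sum>k<n. A $$ (i, k) * (?B $$ (k, j) / ?D)) = (if i = j then 1 else 0)"
    using * assms(2) by (simp flip: sum_divide_distrib)
  show "(\<Sum>k<n. ?B $$ (i, k) / ?D * A $$ (k, j)) = (if i = j then 1 else 0)"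
    using * assms(2) by (simp flip: sum_divide_distrib)
qed

text \<open>For an edge \<open>e = {u, v}\<close> the symmetric double sum equals
  \<open>(q u - q v) \<bullet> (w u - w v)\<close>: it is the row of the rigidity matrix at \<open>q\<close> that belongs to \<open>e\<close>,
  applied to the velocities \<open>w\<close>.\<close>

definition rig :: "nat \<Rightarrow> ('a \<Rightarrow> nat \<Rightarrow> real) \<Rightarrow> 'a set \<Rightarrow> ('a \<Rightarrow> nat \<Rightarrow> real) \<Rightarrow> real" where
  "rig d q e w = (\<Sum>u\<in>e. \<Sum>v\<in>e. \<Sum>i<d. (q u i - q v i) * w u i)"

text \<open>For finite \<open>X\<close> this is the span of the rows of \<open>X\<close>, described
  by duality: a row lies in the span iff every velocity field annihilated by \<open>X\<close> is
  annihilated by it.\<close>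

definition rcl :: "nat \<Rightarrow> ('a \<Rightarrow> nat \<Rightarrow> real) \<Rightarrow> 'a set set \<Rightarrow> 'a set set" where
  "rcl d q X = {e. \<forall>w. (\<forall>f\<in>X. rig d q f w = 0) \<longrightarrow> rig d q e w = 0}"

definition rindep :: "nat \<Rightarrow> ('a \<Rightarrow> nat \<Rightarrow> real) \<Rightarrow> 'a set set \<Rightarrow> bool" where
  "rindep d q Z \<longleftrightarrow> (\<forall>e\<in>Z. e \<notin> rcl d q (Z - {e}))"

lemma rig_pair:
  "u \<noteq> v \<Longrightarrow> rig d q {u, v} w = (\<Sum>i<d. (q u i - q v i) * (w u i - w v i))"
  by (simp add: rig_def sum.distrib[symmetric] algebra_simps)

lemma rig_sum: "rig d q e (\<lambda>v i. \<Sum>j\<in>I. c j * w j v i) = (\<Sum>j\<in>I. c j * rig d q e (w j))"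
proof -
  have "(\<Sum>j\<in>I. c j * rig d q e (w j)) = (\<Sum>j\<in>I. \<Sum>u\<in>e. \<Sum>v\<in>e. \<Sum>i<d. (q u i - q v i) * (c j * w j u i))"
    by (simp add: rig_def sum_distrib_left mult_ac)
  also have "\<dots> = (\<Sum>u\<in>e. \<Sum>v\<in>e. \<Sum>i<d. \<Sum>j\<in>I. (q u i - q v i) * (c j * w j u i))"
    by (subst sum.swap, intro sum.cong refl, subst sum.swap, intro sum.cong refl, subst sum.swap, simp)
  also have "\<dots> = rig d q e (\<lambda>v i. \<Sum>j\<in>I. c j * w j v i)"
    by (simp add: rig_def sum_distrib_left)
  finally show ?thesis by simp
qed

lemma rig_add_scale: "rig d q e (\<lambda>v i. w v i + c * w' v i) = rig d q e w + c * rig d q e w'"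
  by (simp add: rig_def distrib_left sum.distrib sum_distrib_left mult_ac)

lemma rcl_superset: "X \<subseteq> rcl d q X"
  by (auto simp: rcl_def)

lemma rcl_mono: "X \<subseteq> Y \<Longrightarrow> rcl d q X \<subseteq> rcl d q Y"
  by (auto simp: rcl_def)

lemma rcl_subset_rcl: "X \<subseteq> rcl d q Y \<Longrightarrow> rcl d q X \<subseteq> rcl d q Y"
  unfolding rcl_def by blast

text \<open>Steinitz exchange: a suitable multiple of \<open>w0\<close> corrects \<open>w\<close> so
  that it respects \<open>y\<close>. The corrected motion then respects \<open>e\<close>, and as
  \<open>w0\<close> does not, the multiple is 0.\<close>

lemma rcl_exchange:
  assumes "e \<in> rcl d q (insert y Z)" "e \<notin> rcl d q Z"
  shows "y \<in> rcl d q (insert e Z)"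
proof -
  obtain w0 where w0: "\<forall>f\<in>Z. rig d q f w0 = 0" "rig d q e w0 \<noteq> 0"
    using assms(2) by (auto simp: rcl_def)
  then have y0: "rig d q y w0 \<noteq> 0" using assms(1) by (auto simp: rcl_def)
  show ?thesis unfolding rcl_def
  proof safe
    fix w assume w: "\<forall>f\<in>insert e Z. rig d q f w = 0"
    let ?c = "- rig d q y w / rig d q y w0"
    have "\<forall>f\<in>insert y Z. rig d q f (\<lambda>v i. w v i + ?c * w0 v i) = 0"
      using w w0 y0 unfolding rig_add_scale by auto
    then have "rig d q e (\<lambda>v i. w v i + ?c * w0 v i) = 0" using assms(1) unfolding rcl_def by blast
    then show "rig d q y w = 0" using w w0 y0 unfolding rig_add_scale by simp
  qed
qed

lemma rindep_insert:
  assumes "rindep d q Z" "e \<notin> rcl d q Z"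
  shows "rindep d q (insert e Z)"
  unfolding rindep_def
proof (intro ballI notI)
  fix f assume f: "f \<in> insert e Z" and *: "f \<in> rcl d q (insert e Z - {f})"
  have "e \<notin> Z" using assms(2) rcl_superset by blast
  show False
  proof (cases "f = e")
    case True
    then show False using * assms(2) \<open>e \<notin> Z\<close> by simp
  next
    case False
    with f have "f \<in> Z" by simp
    then have "f \<notin> rcl d q (Z - {f})" using assms(1) by (auto simp: rindep_def)
    moreover have "insert e Z - {f} = insert e (Z - {f})" using False by auto
    ultimately have "e \<in> rcl d q (insert f (Z - {f}))" using * rcl_exchange by metis
    then show False using assms(2) \<open>f \<in> Z\<close> by (simp add: insert_absorb)
  qed
qed

lemma rindep_basis_exists:
  assumes "finite X"
  shows "\<exists>Z\<subseteq>X. rindep d q Z \<and> X \<subseteq> rcl d q Z"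
  using assms
proof (induction X rule: finite_induct)
  case empty
  then show ?case by (auto simp: rindep_def)
next
  case (insert e X)
  then obtain Z where Z: "Z \<subseteq> X" "rindep d q Z" "X \<subseteq> rcl d q Z" by blast
  show ?case
  proof (cases "e \<in> rcl d q Z")
    case True
    with Z show ?thesis by (intro exI[of _ Z]) auto
  next
    case False
    have "insert e X \<subseteq> rcl d q (insert e Z)"
      using Z(3) rcl_mono[of Z "insert e Z" d q] rcl_superset[of "insert e Z" d q] by auto
    with rindep_insert[OF Z(2) False] Z(1) show ?thesis by (intro exI[of _ "insert e Z"]) auto
  qed
qed

text \<open>Dimension count: fewer rows than test motions would leave a nonzero combination of the
  motions that is annihilated by every row.\<close>

lemma card_le_if_test_motions:
  assumes "finite Z" "finite I"
    and "\<And>c. (\<And>z. z \<in> Z \<Longrightarrow> rig d q z (\<lambda>v i. \<Sum>j\<in>I. c j * w j v i) = 0) \<Longrightarrow> \<forall>j\<in>I. c j = 0"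
  shows "card I \<le> card Z"
proof (rule ccontr)
  assume "\<not> card I \<le> card Z"
  then obtain c where "\<exists>i\<in>I. c i \<noteq> 0" "\<forall>z\<in>Z. (\<Sum>i\<in>I. c i * rig d q z (w i)) = 0"
    using homogeneous_system_nonzero_solution[OF assms(1,2), of "\<lambda>z i. rig d q z (w i)"] by auto
  then show False using assms(3)[of c] by (auto simp: rig_sum)
qed

text \<open>A dual basis: the motion witnessing that \<open>e\<close> is outside the closure of the
  other rows is rescaled to take the value 1 at \<open>e\<close>.\<close>

lemma rindep_dual_motions:
  assumes "rindep d q Z"
  obtains w where "\<And>e f. e \<in> Z \<Longrightarrow> f \<in> Z \<Longrightarrow> rig d q f (w e) = (if e = f then 1 else 0)"
proof -
  have "\<exists>w. \<forall>f\<in>Z. rig d q f w = (if e = f then 1 else 0)" if "e \<in> Z" for e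
  proof -
    have "e \<notin> rcl d q (Z - {e})" using assms that by (auto simp: rindep_def)
    then obtain w where w: "\<forall>f\<in>Z-{e}. rig d q f w = 0" "rig d q e w \<noteq> 0"
      by (auto simp: rcl_def)
    have "rig d q f (\<lambda>v i. 0 + (1 / rig d q e w) * w v i) = (if e = f then 1 else 0)" if "f \<in> Z" for f
      using w that unfolding rig_add_scale by (auto simp: rig_def)
    then show ?thesis by blast
  qed
  then show ?thesis using that by metis
qed

text \<open>The dual motions of \<open>Z\<close> serve as test motions for \<open>Y\<close>: a
  combination that \<open>Y\<close> annihilates is annihilated by \<open>Z\<close>, whose rows read
  off the coefficients.\<close>

lemma rindep_card_le:
  assumes "rindep d q Z" "Z \<subseteq> rcl d q Y" "finite Z" "finite Y"
  shows "card Z \<le> card Y"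
proof -
  obtain w where w: "\<And>e f. e \<in> Z \<Longrightarrow> f \<in> Z \<Longrightarrow> rig d q f (w e) = (if e = f then 1 else 0)"
    using rindep_dual_motions[OF assms(1)] by metis
  show ?thesis
  proof (rule card_le_if_test_motions[OF assms(4,3)])
    fix c assume *: "\<And>z. z \<in> Y \<Longrightarrow> rig d q z (\<lambda>v i. \<Sum>j\<in>Z. c j * w j v i) = 0"
    show "\<forall>j\<in>Z. c j = 0"
    proof
      fix e assume e: "e \<in> Z"
      then have "0 = rig d q e (\<lambda>v i. \<Sum>j\<in>Z. c j * w j v i)" using * assms(2) by (auto simp: rcl_def)
      also have "\<dots> = (\<Sum>j\<in>Z. if j = e then c e else 0)"
        unfolding rig_sum using w e by (intro sum.cong) auto
      also have "\<dots> = c e" using e assms(3) by simp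
      finally show "c e = 0" by simp
    qed
  qed
qed

section \<open>Independence of rows as a polynomial condition\<close>

definition rig_row :: "('a \<Rightarrow> nat \<Rightarrow> real) \<Rightarrow> 'a set \<Rightarrow> 'a \<Rightarrow> nat \<Rightarrow> real" where
  "rig_row q e u i = (if u \<in> e then \<Sum>v\<in>e. q u i - q v i else 0)"

lemma rig_eq_row_product:
  assumes "finite S" "e \<subseteq> S"
  shows "rig d q e w = (\<Sum>u\<in>S. \<Sum>i<d. rig_row q e u i * w u i)"
proof -
  have "rig d q e w = (\<Sum>u\<in>e. \<Sum>i<d. rig_row q e u i * w u i)"
    unfolding rig_def rig_row_def by (subst sum.swap) (simp add: sum_distrib_right)
  also have "\<dots> = (\<Sum>u\<in>S. \<Sum>i<d. rig_row q e u i * w u i)"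
    using assms by (intro sum.mono_neutral_left) (auto simp: rig_row_def)
  finally show ?thesis .
qed

text \<open>The Gram determinant of the rows: \<open>rig_row\<close> is a row vector and at the same
  time a velocity field, so the entries are inner products of rows. Unlike a minor it requires no
  choice of columns, and it depends on the position only through distances.\<close>

definition gram_det :: "nat \<Rightarrow> nat \<Rightarrow> (nat \<Rightarrow> 'a set) \<Rightarrow> ('a \<Rightarrow> nat \<Rightarrow> real) \<Rightarrow> real" where
  "gram_det d k z q = Determinant.det (Matrix.mat k k (\<lambda>(i, j). rig d q (z i) (rig_row q (z j))))"

text \<open>A kernel vector of the Gram matrix gives a combination \<open>s\<close> of rows that is
  orthogonal to every row, hence to itself, so it is zero over the reals; the dual motions then make
  all coefficients zero. Conversely, the inverse matrix supplies dual motions.\<close>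

lemma rindep_iff_gram_det:
  assumes S: "finite S" "\<And>i. i < k \<Longrightarrow> z i \<subseteq> S" and inj: "inj_on z {..<k}"
  shows "rindep d q (z ` {..<k}) \<longleftrightarrow> gram_det d k z q \<noteq> 0"
proof
  let ?A = "Matrix.mat k k (\<lambda>(i, j). rig d q (z i) (rig_row q (z j)))"
  assume ind: "rindep d q (z ` {..<k})"
  obtain w where w: "\<And>e f. e \<in> z ` {..<k} \<Longrightarrow> f \<in> z ` {..<k} \<Longrightarrow> rig d q f (w e) = (if e = f then 1 else 0)"
    using rindep_dual_motions[OF ind] by metis
  show "gram_det d k z q \<noteq> 0"
  proof
    assume "gram_det d k z q = 0"
    then obtain c where c: "c \<in> carrier_vec k" "c \<noteq> 0\<^sub>v k" "?A *\<^sub>v c = 0\<^sub>v k"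
      using det_0_iff_vec_prod_zero[of ?A k] by (auto simp: gram_det_def)
    define s where "s u i = (\<Sum>j<k. c $ j * rig_row q (z j) u i)" for u i
    have rig_s: "rig d q (z i) s = 0" if "i < k" for i
    proof -
      have "0 = (?A *\<^sub>v c) $ i" using c that by simp
      also have "\<dots> = (\<Sum>j<k. c $ j * rig d q (z i) (rig_row q (z j)))"
        using c(1) that by (simp add: scalar_prod_def lessThan_atLeast0 mult.commute)
      also have "\<dots> = rig d q (z i) s" unfolding s_def by (rule rig_sum[symmetric])
      finally show ?thesis by simp
    qed
    have combine: "(\<Sum>j<k. c $ j * rig d q (z j) w) = (\<Sum>u\<in>S. \<Sum>i<d. s u i * w u i)" for w
    proof -
      have "(\<Sum>j<k. c $ j * rig d q (z j) w) = (\<Sum>j<k. \<Sum>u\<in>S. \<Sum>i<d. c $ j * rig_row q (z j) u i * w u i)"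
        using S by (intro sum.cong) (auto simp: rig_eq_row_product[OF S(1)] sum_distrib_left mult_ac)
      also have "\<dots> = (\<Sum>u\<in>S. \<Sum>i<d. \<Sum>j<k. c $ j * rig_row q (z j) u i * w u i)"
        by (rule trans[OF sum.swap], rule sum.cong[OF refl], rule sum.swap)
      finally show ?thesis by (simp add: s_def sum_distrib_right)
    qed
    have "(\<Sum>u\<in>S. \<Sum>i<d. s u i * s u i) = 0" using combine[of s] rig_s by simp
    then have s0: "s u i = 0" if "u \<in> S" "i < d" for u i
      using that S(1) by (simp add: sum_nonneg_eq_0_iff sum_nonneg)
    have "c $ j = 0" if j: "j < k" for j
    proof -
      have "0 = (\<Sum>i<k. c $ i * rig d q (z i) (w (z j)))" using combine[of "w (z j)"] s0 by simp
      also have "\<dots> = (\<Sum>i<k. if i = j then c $ i else 0)"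
        using w inj j by (intro sum.cong) (auto dest: inj_onD)
      finally show ?thesis using j by simp
    qed
    then have "c = 0\<^sub>v k" using c(1) by (intro eq_vecI) auto
    then show False using c(2) by blast
  qed
next
  let ?A = "Matrix.mat k k (\<lambda>(i, j). rig d q (z i) (rig_row q (z j)))"
  assume "gram_det d k z q \<noteq> 0"
  then have "Determinant.det ?A \<noteq> 0" by (simp add: gram_det_def)
  then obtain B where B: "\<And>i j. i < k \<Longrightarrow> j < k \<Longrightarrow> (\<Sum>l<k. ?A $$ (i, l) * B l j) = (if i = j then 1 else 0)"
    by (rule det_nonzero_right_inverse[OF mat_carrier]) (rule that)
  show "rindep d q (z ` {..<k})"
    unfolding rindep_def
  proof safe
    fix j assume j: "j < k" and *: "z j \<in> rcl d q (z ` {..<k} - {z j})"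
    define w where "w u i = (\<Sum>l<k. B l j * rig_row q (z l) u i)" for u i
    have w: "rig d q (z i) w = (if i = j then 1 else 0)" if "i < k" for i
      using B[of i j] that j unfolding w_def rig_sum by (simp add: mult.commute)
    then have "\<forall>f\<in>z ` {..<k} - {z j}. rig d q f w = 0" by (metis (no_types, lifting) DiffE imageE insertCI lessThan_iff)
    then have "rig d q (z j) w = 0" using * unfolding rcl_def by blast
    then show False using w j by simp
  qed
qed

text \<open>The Gram determinant is a rational polynomial in the coordinates, so its nonvanishing
  passes from \<open>q\<close> to \<open>p\<close>. The position \<open>q\<close> may be very
  degenerate; it is used with several vertices at one point.\<close>

lemma rindep_generic:
  assumes p: "generic d V p" and V: "finite V" and Z: "finite Z" "Z \<subseteq> Pow V" and q: "rindep d q Z"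
  shows "rindep d p Z"
proof -
  obtain z where z: "bij_betw z {..<card Z} Z"
    using ex_bij_betw_nat_finite[OF Z(1)] by (auto simp: atLeast0LessThan)
  let ?k = "card Z"
  have zV: "z i \<subseteq> V" if "i < ?k" for i
    using z Z(2) that by (auto simp: bij_betw_def)
  have im: "z ` {..<?k} = Z" and inj: "inj_on z {..<?k}"
    using z by (auto simp: bij_betw_def)
  note gram = rindep_iff_gram_det[OF V zV inj, unfolded im]
  have "rat_poly_fun (V \<times> {..<d}) (\<lambda>x. gram_det d ?k z (\<lambda>v i. x (v, i)))"
    unfolding gram_det_def
  proof (rule rat_poly_fun_det)
    fix i j assume ij: "i < ?k" "j < ?k"
    have row: "rat_poly_fun (V \<times> {..<d}) (\<lambda>x. rig_row (\<lambda>v i. x (v, i)) (z j) u l)" if "l < d" "u \<in> V" for l u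
      using zV[OF ij(2)] that
      by (cases "u \<in> z j") (auto simp: rig_row_def intro!: rat_poly_fun_sum rat_poly_fun_diff rat_poly_fun_var)
    show "rat_poly_fun (V \<times> {..<d}) (\<lambda>x. rig d (\<lambda>v i. x (v, i)) (z i) (rig_row (\<lambda>v i. x (v, i)) (z j)))"
      unfolding rig_def using zV[OF ij(1)]
      by (intro rat_poly_fun_sum rat_poly_fun_mult rat_poly_fun_diff rat_poly_fun_var row) auto
  qed
  moreover have "gram_det d ?k z (\<lambda>v i. (\<lambda>(v, i). q v i) (v, i)) \<noteq> 0" using q gram by simp
  ultimately have "gram_det d ?k z (\<lambda>v i. (\<lambda>(v, i). p v i) (v, i)) \<noteq> 0"
    using p unfolding generic_def by (rule alg_independent_rat_nonzero[rotated])
  then show ?thesis using gram by simp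
qed

text \<open>Both halves say that the \<open>d\<close> vectors from \<open>p v\<close> to the points
  of \<open>X\<close> form a basis: once through a dual basis \<open>y\<close>, once through
  coordinates \<open>\<mu>\<close>, which are the two forms in which it is applied.\<close>

definition general_position :: "nat \<Rightarrow> 'a set \<Rightarrow> ('a \<Rightarrow> nat \<Rightarrow> real) \<Rightarrow> bool" where
  "general_position d V p \<longleftrightarrow> (\<forall>v\<in>V. \<forall>X\<subseteq>V - {v}. card X = d \<longrightarrow>
     (\<exists>y. \<forall>x\<in>X. \<forall>x'\<in>X. (\<Sum>j<d. (p x j - p v j) * y x' j) = (if x = x' then 1 else 0)) \<and>
     (\<forall>b. \<exists>\<mu>. \<forall>j<d. b j = (\<Sum>x\<in>X. \<mu> x * (p x j - p v j))))"

lemma generic_general_position: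
  assumes p: "generic d V p" and V: "finite V"
  shows "general_position d V p"
  unfolding general_position_def
proof (intro ballI allI impI)
  fix v X assume v: "v \<in> V" and X: "X \<subseteq> V - {v}" and d: "card X = d"
  have "finite X" using X V by (rule_tac finite_subset) auto
  then obtain x where x: "bij_betw x {..<d} X"
    using ex_bij_betw_nat_finite d by (fastforce simp: atLeast0LessThan)
  then have xX: "x i \<in> X" if "i < d" for i using that by (auto simp: bij_betw_def)
  have inj: "x i = x j \<longleftrightarrow> i = j" if "i < d" "j < d" for i j
    using x that by (auto simp: bij_betw_def dest: inj_onD)
  define D where "D y = Determinant.det (Matrix.mat d d (\<lambda>(i, j). y (x i, j) - y (v, j)))" for y :: "'a \<times> nat \<Rightarrow> real"
  have "rat_poly_fun (V \<times> {..<d}) D"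
    unfolding D_def using xX X v by (intro rat_poly_fun_det rat_poly_fun_diff rat_poly_fun_var) auto
  \<comment> \<open>Special position: \<open>v\<close> at the origin and the points of
    \<open>X\<close> at the unit vectors, where the matrix is the identity.\<close>
  moreover have "D (\<lambda>(u, j). if u \<in> X \<and> u = x j then 1 else 0) \<noteq> 0"
  proof -
    have "Matrix.mat d d (\<lambda>(i, j). (\<lambda>(u, j). if u \<in> X \<and> u = x j then 1 else 0) (x i, j)
        - (\<lambda>(u, j). if u \<in> X \<and> u = x j then 1 else 0) (v, j)) = (1\<^sub>m d :: real Matrix.mat)"
      using xX inj X by (intro eq_matI) (auto simp: case_prod_beta)
    then show ?thesis unfolding D_def by simp
  qed
  ultimately have "D (\<lambda>(v, i). p v i) \<noteq> 0"
    using p unfolding generic_def by (rule alg_independent_rat_nonzero[rotated])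
  then have "Determinant.det (Matrix.mat d d (\<lambda>(i, j). p (x i) j - p v j)) \<noteq> 0" (is "Determinant.det ?A \<noteq> 0")
    by (simp add: D_def)
  then obtain B where B: "\<And>i j. i < d \<Longrightarrow> j < d \<Longrightarrow> (\<Sum>k<d. ?A $$ (i, k) * B k j) = (if i = j then 1 else 0)"
    and B': "\<And>i j. i < d \<Longrightarrow> j < d \<Longrightarrow> (\<Sum>k<d. B i k * ?A $$ (k, j)) = (if i = j then 1 else 0)"
    using det_nonzero_right_inverse[of ?A d] by auto
  define ix where "ix = the_inv_into {..<d} x"
  have ix: "ix (x i) = i" if "i < d" for i
    using x that by (auto simp: ix_def bij_betw_def the_inv_into_f_f)
  have ex_ix: "\<exists>i<d. u = x i" if "u \<in> X" for u
    using x that by (auto simp: bij_betw_def)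
  have "\<forall>u\<in>X. \<forall>u'\<in>X. (\<Sum>j<d. (p u j - p v j) * B j (ix u')) = (if u = u' then 1 else 0)"
  proof (intro ballI)
    fix u u' assume "u \<in> X" "u' \<in> X"
    then obtain i i' where "i < d" "u = x i" "i' < d" "u' = x i'" using ex_ix by metis
    then show "(\<Sum>j<d. (p u j - p v j) * B j (ix u')) = (if u = u' then 1 else 0)"
      using B[of i i'] inj by (simp add: ix)
  qed
  moreover have "\<exists>\<mu>. \<forall>j<d. b j = (\<Sum>u\<in>X. \<mu> u * (p u j - p v j))" for b
  proof (intro exI[of _ "\<lambda>u. \<Sum>i<d. b i * B i (ix u)"] allI impI)
    fix j assume j: "j < d"
    have "(\<Sum>u\<in>X. (\<Sum>i<d. b i * B i (ix u)) * (p u j - p v j)) = (\<Sum>k<d. (\<Sum>i<d. b i * B i k) * (p (x k) j - p v j))"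
      by (subst sum.reindex_bij_betw[OF x, symmetric]) (auto simp: ix intro!: sum.cong)
    also have "\<dots> = (\<Sum>i<d. b i * (\<Sum>k<d. B i k * (p (x k) j - p v j)))"
      by (simp add: sum_distrib_right sum_distrib_left mult.assoc) (rule sum.swap)
    also have "\<dots> = (\<Sum>i<d. if i = j then b j else 0)"
      using B'[OF _ j] j by (intro sum.cong) auto
    also have "\<dots> = b j" using j by simp
    finally show "b j = (\<Sum>u\<in>X. (\<Sum>i<d. b i * B i (ix u)) * (p u j - p v j))" by simp
  qed
  ultimately show "(\<exists>y. \<forall>x\<in>X. \<forall>x'\<in>X. (\<Sum>j<d. (p x j - p v j) * y x' j) = (if x = x' then 1 else 0)) \<and>
     (\<forall>b. \<exists>\<mu>. \<forall>j<d. b j = (\<Sum>x\<in>X. \<mu> x * (p x j - p v j)))" by (intro conjI exI[of _ "\<lambda>u j. B j (ix u)"]) auto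
qed

section \<open>From infinitesimal to continuous rigidity\<close>

definition sq_dist :: "nat \<Rightarrow> ('a \<Rightarrow> nat \<Rightarrow> real) \<Rightarrow> 'a \<Rightarrow> 'a \<Rightarrow> real" where
  "sq_dist d q u v = (\<Sum>i<d. (q u i - q v i)\<^sup>2)"

lemma euclidean_dist_eq_iff:
  "euclidean_dist d (q u) (q v) = euclidean_dist d (q' u') (q' v') \<longleftrightarrow> sq_dist d q u v = sq_dist d q' u' v'"
  by (simp add: euclidean_dist_def L2_set_def sq_dist_def)

text \<open>By polarisation, every entry of the Gram matrix is a combination of squared
  distances.\<close>

lemma gram_det_cong_sq_dist:
  assumes "\<And>i. i < k \<Longrightarrow> z i \<subseteq> V"
    and "\<And>u v. u \<in> V \<Longrightarrow> v \<in> V \<Longrightarrow> sq_dist d q u v = sq_dist d q' u v"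
  shows "gram_det d k z q = gram_det d k z q'"
proof -
  have gram: "rig d q e (rig_row q f)
      = (\<Sum>u\<in>e. \<Sum>v\<in>e. if u \<in> f then \<Sum>v'\<in>f. (sq_dist d q u v + sq_dist d q u v' - sq_dist d q v v') / 2 else 0)"
    for q :: "'a \<Rightarrow> nat \<Rightarrow> real" and e f
  proof -
    have ip: "(\<Sum>i<d. (q u i - q v i) * (q u i - q v' i)) = (sq_dist d q u v + sq_dist d q u v' - sq_dist d q v v') / 2"
      for u v v'
    proof -
      have "sq_dist d q u v + sq_dist d q u v' - sq_dist d q v v'
          = (\<Sum>i<d. (q u i - q v i)\<^sup>2 + (q u i - q v' i)\<^sup>2 - (q v i - q v' i)\<^sup>2)"
        by (simp add: sq_dist_def sum.distrib sum_subtractf)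
      also have "\<dots> = (\<Sum>i<d. 2 * ((q u i - q v i) * (q u i - q v' i)))"
        by (intro sum.cong refl) (simp add: power2_eq_square algebra_simps)
      finally show ?thesis by (simp flip: sum_distrib_left)
    qed
    have "(\<Sum>i<d. (q u i - q v i) * rig_row q f u i)
        = (if u \<in> f then \<Sum>v'\<in>f. (sq_dist d q u v + sq_dist d q u v' - sq_dist d q v v') / 2 else 0)" for u v
    proof (cases "u \<in> f")
      case True
      have "(\<Sum>i<d. (q u i - q v i) * rig_row q f u i) = (\<Sum>i<d. \<Sum>v'\<in>f. (q u i - q v i) * (q u i - q v' i))"
        using True by (simp add: rig_row_def sum_distrib_left)
      also have "\<dots> = (\<Sum>v'\<in>f. \<Sum>i<d. (q u i - q v i) * (q u i - q v' i))" by (rule sum.swap)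
      finally show ?thesis using True by (simp add: ip)
    qed (simp add: rig_row_def)
    then show ?thesis unfolding rig_def by simp
  qed
  have "rig d q (z i) (rig_row q (z j)) = rig d q' (z i) (rig_row q' (z j))" if "i < k" "j < k" for i j
    unfolding gram using assms(1)[OF that(1)] assms(1)[OF that(2)]
    by (intro sum.cong refl if_cong) (simp add: assms(2) subset_iff)
  then show ?thesis unfolding gram_det_def
    by (intro arg_cong[where f = Determinant.det] eq_matI) auto
qed

lemma continuous_on_gram_det:
  assumes "\<And>i. i < k \<Longrightarrow> z i \<subseteq> V"
    and "\<And>v i. v \<in> V \<Longrightarrow> i < d \<Longrightarrow> continuous_on T (\<lambda>t. m t v i)"
  shows "continuous_on T (\<lambda>t. gram_det d k z (m t))"
proof -
  have row: "continuous_on T (\<lambda>t. rig_row (m t) (z j) u l)" if "u \<in> V" "l < d" "j < k" for u l j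
    using assms(1)[OF that(3)] that
    by (cases "u \<in> z j") (auto simp: rig_row_def intro!: continuous_intros assms(2))
  have "continuous_on T (\<lambda>t. rig d (m t) (z i) (rig_row (m t) (z j)))" if "i < k" "j < k" for i j
    unfolding rig_def using assms(1)[OF that(1)] that by (intro continuous_intros assms(2) row) auto
  then have "continuous_on T (\<lambda>t. \<Sum>\<pi>\<in>{\<pi>. \<pi> permutes {0..<k}}. of_int (sign \<pi>) *
      (\<Prod>i = 0..<k. rig d (m t) (z i) (rig_row (m t) (z (\<pi> i)))))"
    by (intro continuous_intros) (auto simp: permutes_in_image)
  also have "(\<lambda>t. \<Sum>\<pi>\<in>{\<pi>. \<pi> permutes {0..<k}}. of_int (sign \<pi>) *
      (\<Prod>i = 0..<k. rig d (m t) (z i) (rig_row (m t) (z (\<pi> i))))) = (\<lambda>t. gram_det d k z (m t))"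
    by (auto simp: gram_det_def Determinant.det_def permutes_in_image intro!: ext sum.cong prod.cong)
  finally show ?thesis .
qed

text \<open>The identity (a + b) (a - b) = a^2 - b^2 for coordinate differences. It turns a finite
  displacement exactly into an infinitesimal motion of the midpoint.\<close>

lemma rig_midpoint:
  assumes "u \<noteq> v"
  shows "rig d (\<lambda>x i. (q x i + q' x i) / 2) {u, v} (\<lambda>x i. q x i - q' x i) = (sq_dist d q u v - sq_dist d q' u v) / 2"
proof -
  have "rig d (\<lambda>x i. (q x i + q' x i) / 2) {u, v} (\<lambda>x i. q x i - q' x i)
      = (\<Sum>i<d. ((q u i - q v i)\<^sup>2 - (q' u i - q' v i)\<^sup>2) / 2)"
    unfolding rig_pair[OF assms]
    by (intro sum.cong refl) (simp add: power2_eq_square field_simps)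
  also have "\<dots> = (sq_dist d q u v - sq_dist d q' u v) / 2"
    by (simp add: sq_dist_def sum_subtractf flip: sum_divide_distrib)
  finally show ?thesis .
qed

text \<open>No position has a rank above the generic one: a pair outside the closure at
  \<open>q\<close> would enlarge \<open>Z\<close> to an independent set at \<open>p\<close>, where
  \<open>Z\<close> already spans.\<close>

lemma rcl_complete_of_rindep:
  assumes p: "generic d V p" and V: "finite V" and Z: "Z \<subseteq> vertex_pairs V"
    and complete: "vertex_pairs V \<subseteq> rcl d p Z" and q: "rindep d q Z"
  shows "vertex_pairs V \<subseteq> rcl d q Z"
proof
  fix e assume e: "e \<in> vertex_pairs V"
  have fin: "finite (vertex_pairs V)" using V by (auto simp: vertex_pairs_def)
  then have "finite Z" using Z finite_subset by blast
  show "e \<in> rcl d q Z"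
  proof (rule ccontr)
    assume *: "e \<notin> rcl d q Z"
    have "rindep d p (insert e Z)"
      using e Z by (intro rindep_generic[OF p V _ _ rindep_insert[OF q *]]) (auto simp: \<open>finite Z\<close> vertex_pairs_def)
    then have "card (insert e Z) \<le> card Z"
      using e Z complete \<open>finite Z\<close> by (intro rindep_card_le[of d p]) auto
    moreover have "e \<notin> Z" using * rcl_superset by blast
    ultimately show False using \<open>finite Z\<close> by simp
  qed
qed

text \<open>The positions \<open>q t\<close> and \<open>q s\<close> have the same edge lengths iff their difference is an
  infinitesimal motion of their midpoint. Near \<open>s\<close> the midpoint has independent rows wherever \<open>q s\<close>
  does, and whether \<open>q s\<close> does is decided by its Gram determinant, so by distances alone.\<close>

lemma rigid_if_complete:
  assumes p: "generic d V p" and V: "finite V" and E: "E \<subseteq> vertex_pairs V"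
    and complete: "vertex_pairs V \<subseteq> rcl d p E"
  shows "rigid d (V, E) p"
  unfolding rigid_def fst_conv snd_conv euclidean_dist_eq_iff
proof (intro allI impI, elim conjE)
  fix \<gamma> assume \<gamma>: "continuous_motion d (V, E) p \<gamma>"
    and lengths: "\<forall>t\<in>{0..1}. \<forall>u v. {u, v} \<in> E \<longrightarrow> sq_dist d (\<gamma> t) u v = sq_dist d p u v"
  have cont: "continuous_on {0..1} (\<lambda>t. \<gamma> t v i)" if "v \<in> V" for v i
  proof -
    have "continuous_map (top_of_set {0..1}) (Euclidean_space d) (\<lambda>t. \<gamma> t v)"
      using \<gamma> that by (auto simp: continuous_motion_def)
    then show ?thesis
      by (simp add: Euclidean_space_def continuous_map_in_subtopology continuous_map_componentwise_UNIV)
  qed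
  have \<gamma>0: "\<gamma> 0 v = p v" if "v \<in> V" for v using \<gamma> that by (auto simp: continuous_motion_def)
  have "finite E" using E V finite_subset[of E "Pow V"] by (auto simp: vertex_pairs_def)
  then obtain Z where Z: "Z \<subseteq> E" "rindep d p Z" "E \<subseteq> rcl d p Z"
    using rindep_basis_exists by blast
  then have "finite Z" using \<open>finite E\<close> finite_subset by blast
  then obtain z where z: "bij_betw z {..<card Z} Z"
    using ex_bij_betw_nat_finite by (auto simp: atLeast0LessThan)
  let ?k = "card Z"
  have im: "z ` {..<?k} = Z" and inj: "inj_on z {..<?k}" using z by (auto simp: bij_betw_def)
  have zE: "z i \<in> E" if "i < ?k" for i using im Z(1) that by auto
  then have zV: "z i \<subseteq> V" if "i < ?k" for i using E that by (auto simp: vertex_pairs_def)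
  note gram = rindep_iff_gram_det[OF V zV inj, unfolded im]
  have completeZ: "vertex_pairs V \<subseteq> rcl d p Z"
    using complete rcl_subset_rcl[OF Z(3)] by blast
  \<comment> \<open>Motions are merely continuous, so instead of differentiating at 0 one shows that
    these times form an open and closed subset of the interval.\<close>
  define T where "T = {t \<in> {0..1}. \<forall>u\<in>V. \<forall>v\<in>V. sq_dist d (\<gamma> t) u v = sq_dist d p u v}"
  have "openin (top_of_set {0..1}) T"
    unfolding openin_subopen[of _ T]
  proof
    fix s assume s: "s \<in> T"
    let ?m = "\<lambda>t v i. (\<gamma> t v i + \<gamma> s v i) / 2"
    let ?O = "{0..1} \<inter> (\<lambda>t. gram_det d ?k z (?m t)) -` (- {0})"
    have "openin (top_of_set {0..1}) ?O"
      by (intro continuous_openin_preimage_gen continuous_on_gram_det[OF zV] continuous_intros cont) auto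
    moreover have "s \<in> ?O"
    proof -
      have "?m s = \<gamma> s" by auto
      moreover have "gram_det d ?k z (\<gamma> s) = gram_det d ?k z p"
        using s by (intro gram_det_cong_sq_dist[OF zV]) (auto simp: T_def)
      ultimately show ?thesis using s Z(2) gram by (simp add: T_def)
    qed
    moreover have "?O \<subseteq> T"
    proof
      fix t assume t: "t \<in> ?O"
      then have "rindep d (?m t) Z" using gram by simp
      from rcl_complete_of_rindep[OF p V _ completeZ this] Z(1) E
      have K: "vertex_pairs V \<subseteq> rcl d (?m t) Z" by blast
      have "rig d (?m t) e (\<lambda>v i. \<gamma> t v i - \<gamma> s v i) = 0" if "e \<in> E" for e
      proof -
        from that E have "card e = 2" by (auto simp: vertex_pairs_def)
        then obtain u v where e: "e = {u, v}" "u \<noteq> v" by (auto simp: card_2_iff)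
        have "sq_dist d (\<gamma> t) u v = sq_dist d (\<gamma> s) u v"
          using lengths that t s by (auto simp: e T_def)
        then show ?thesis unfolding e(1) using rig_midpoint[OF e(2), of d "\<gamma> t" "\<gamma> s"] by simp
      qed
      then have edges: "\<forall>e\<in>Z. rig d (?m t) e (\<lambda>v i. \<gamma> t v i - \<gamma> s v i) = 0" using Z(1) by blast
      have "sq_dist d (\<gamma> t) u v = sq_dist d p u v" if uv: "u \<in> V" "v \<in> V" for u v
      proof (cases "u = v")
        case False
        then have "{u, v} \<in> vertex_pairs V" using uv by (auto simp: vertex_pairs_def)
        with K edges have "rig d (?m t) {u, v} (\<lambda>v i. \<gamma> t v i - \<gamma> s v i) = 0"
          unfolding rcl_def by blast
        then have "sq_dist d (\<gamma> t) u v = sq_dist d (\<gamma> s) u v"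
          using rig_midpoint[OF False, of d "\<gamma> t" "\<gamma> s"] by simp
        then show ?thesis using s uv by (auto simp: T_def)
      qed (simp add: sq_dist_def)
      then show "t \<in> T" using t by (auto simp: T_def)
    qed
    ultimately show "\<exists>U. openin (top_of_set {0..1}) U \<and> s \<in> U \<and> U \<subseteq> T" by blast
  qed
  moreover have "closedin (top_of_set {0..1}) T"
  proof -
    let ?F = "\<lambda>t. \<Sum>u\<in>V. \<Sum>v\<in>V. (sq_dist d (\<gamma> t) u v - sq_dist d p u v)\<^sup>2"
    have "continuous_on {0..1} ?F"
      unfolding sq_dist_def by (intro continuous_intros cont)
    then have "closedin (top_of_set {0..1}) {t \<in> {0..1}. ?F t = 0}"
      by (rule continuous_closedin_preimage_constant)
    also have "{t \<in> {0..1}. ?F t = 0} = T"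
      using V by (auto simp: T_def sum_nonneg_eq_0_iff sum_nonneg)
    finally show ?thesis .
  qed
  moreover have "connected {0..1::real}" by simp
  moreover have "0 \<in> T" using \<gamma>0 by (auto simp: T_def sq_dist_def)
  ultimately have "T = {0..1}" by (metis connected_clopen empty_iff)
  then show "\<forall>t\<in>{0..1}. \<forall>u\<in>V. \<forall>v\<in>V. sq_dist d (\<gamma> t) u v = sq_dist d p u v"
    unfolding T_def by blast
qed

section \<open>Degrees of freedom, zero-extensions and contractions\<close>

lemma finite_vertex_pairs: "finite V \<Longrightarrow> finite (vertex_pairs V)"
  by (auto simp: vertex_pairs_def)

lemma vertex_pairs_mono: "U \<subseteq> V \<Longrightarrow> vertex_pairs U \<subseteq> vertex_pairs V"
  by (auto simp: vertex_pairs_def)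

lemma doubleton_in_vertex_pairs [simp]: "{u, v} \<in> vertex_pairs V \<longleftrightarrow> u \<in> V \<and> v \<in> V \<and> u \<noteq> v"
  by (auto simp: vertex_pairs_def card_2_iff doubleton_eq_iff)

lemma vertex_pairsE:
  assumes "e \<in> vertex_pairs V"
  obtains u v where "e = {u, v}" "u \<in> V" "v \<in> V" "u \<noteq> v"
  using assms by (auto simp: vertex_pairs_def card_2_iff)

text \<open>Expanding the products, every term contains the sum of \<open>\<kappa>\<close> or the
  sum of \<open>\<kappa> u * p u i\<close> as a factor.\<close>

lemma affine_dependence_stress:
  fixes \<kappa> :: "'a \<Rightarrow> real"
  assumes "(\<Sum>u\<in>S. \<kappa> u) = 0" "\<And>i. i < d \<Longrightarrow> (\<Sum>u\<in>S. \<kappa> u * p u i) = 0"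
  shows "(\<Sum>u\<in>S. \<Sum>u'\<in>S. \<kappa> u * \<kappa> u' * (\<Sum>i<d. (p u i - p u' i) * (w u i - w u' i))) = 0"
proof -
  have "(\<Sum>u\<in>S. \<Sum>u'\<in>S. \<kappa> u * \<kappa> u' * ((p u i - p u' i) * (w u i - w u' i))) = 0" if "i < d" for i
  proof -
    let ?a = "\<lambda>u. \<kappa> u * p u i" and ?b = "\<lambda>u. \<kappa> u * w u i" and ?ab = "\<lambda>u. \<kappa> u * p u i * w u i"
    have "(\<Sum>u\<in>S. \<Sum>u'\<in>S. \<kappa> u * \<kappa> u' * ((p u i - p u' i) * (w u i - w u' i)))
        = (\<Sum>u\<in>S. \<Sum>u'\<in>S. ?ab u * \<kappa> u' + \<kappa> u * ?ab u' - ?a u * ?b u' - ?b u * ?a u')"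
      by (intro sum.cong refl) (simp add: algebra_simps)
    also have "\<dots> = sum ?ab S * sum \<kappa> S + sum \<kappa> S * sum ?ab S - sum ?a S * sum ?b S - sum ?b S * sum ?a S"
      by (simp add: sum_subtractf sum.distrib sum_product)
    also have "\<dots> = 0" using assms that by simp
    finally show ?thesis .
  qed
  then have "(\<Sum>i<d. \<Sum>u\<in>S. \<Sum>u'\<in>S. \<kappa> u * \<kappa> u' * ((p u i - p u' i) * (w u i - w u' i))) = 0" by simp
  also have "(\<Sum>i<d. \<Sum>u\<in>S. \<Sum>u'\<in>S. \<kappa> u * \<kappa> u' * ((p u i - p u' i) * (w u i - w u' i)))
      = (\<Sum>u\<in>S. \<Sum>i<d. \<Sum>u'\<in>S. \<kappa> u * \<kappa> u' * ((p u i - p u' i) * (w u i - w u' i)))"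
    by (rule sum.swap)
  also have "\<dots> = (\<Sum>u\<in>S. \<Sum>u'\<in>S. \<Sum>i<d. \<kappa> u * \<kappa> u' * ((p u i - p u' i) * (w u i - w u' i)))"
    by (rule sum.cong[OF refl], rule sum.swap)
  finally show ?thesis by (simp add: sum_distrib_left)
qed

lemma rcl_union_mono: "X \<subseteq> X' \<Longrightarrow> Y \<subseteq> Y' \<Longrightarrow> rcl d p (X \<union> Y) \<subseteq> rcl d p (X' \<union> Y')"
  by (intro rcl_mono) blast

text \<open>When the elements of \<open>Y\<close> are added one by one, the element that brings
  \<open>e\<close> into the closure can be exchanged for \<open>e\<close>.\<close>

lemma rcl_exchange_set:
  assumes "finite Y" "e \<in> rcl d p (X \<union> Y)" "e \<notin> rcl d p X"
  shows "\<exists>y\<in>Y. y \<in> rcl d p (insert e (X \<union> (Y - {y})))"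
  using assms
proof (induction Y rule: finite_induct)
  case (insert y Y)
  show ?case
  proof (cases "e \<in> rcl d p (X \<union> Y)")
    case True
    then obtain y' where y': "y' \<in> Y" "y' \<in> rcl d p (insert e (X \<union> (Y - {y'})))"
      using insert by blast
    moreover have "rcl d p (insert e (X \<union> (Y - {y'}))) \<subseteq> rcl d p (insert e (X \<union> (insert y Y - {y'})))"
      by (intro rcl_mono) blast
    ultimately show ?thesis by blast
  next
    case False
    with insert.prems have "y \<in> rcl d p (insert e (X \<union> Y))"
      using rcl_exchange[of e d p y "X \<union> Y"] by simp
    moreover have "X \<union> (insert y Y - {y}) = X \<union> Y" using insert.hyps by auto
    ultimately show ?thesis by auto
  qed
qed simp

text \<open>The number of degrees of freedom that \<open>X\<close> leaves to the vertices in \<open>U\<close>.\<close>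

definition defect :: "nat \<Rightarrow> ('a \<Rightarrow> nat \<Rightarrow> real) \<Rightarrow> 'a set \<Rightarrow> 'a set set \<Rightarrow> nat" where
  "defect d p U X = (LEAST k. \<exists>Y. finite Y \<and> card Y = k \<and> vertex_pairs U \<subseteq> rcl d p (X \<union> Y))"

lemma defect_le:
  "finite Y \<Longrightarrow> vertex_pairs U \<subseteq> rcl d p (X \<union> Y) \<Longrightarrow> defect d p U X \<le> card Y"
  unfolding defect_def by (rule Least_le) blast

lemma defect_witness:
  assumes "finite U"
  obtains Y where "finite Y" "card Y = defect d p U X" "vertex_pairs U \<subseteq> rcl d p (X \<union> Y)"
proof -
  have "vertex_pairs U \<subseteq> rcl d p (X \<union> vertex_pairs U)"
    using rcl_superset[of "X \<union> vertex_pairs U" d p] by auto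
  then have "\<exists>k Y. finite Y \<and> card Y = k \<and> vertex_pairs U \<subseteq> rcl d p (X \<union> Y)"
    using assms finite_vertex_pairs by blast
  from LeastI_ex[OF this] show ?thesis using that unfolding defect_def by blast
qed

lemma defect_eq_0_iff:
  assumes "finite U"
  shows "defect d p U X = 0 \<longleftrightarrow> vertex_pairs U \<subseteq> rcl d p X"
proof
  assume 0: "defect d p U X = 0"
  obtain Y where "finite Y" "card Y = defect d p U X" "vertex_pairs U \<subseteq> rcl d p (X \<union> Y)"
    using defect_witness[OF assms, of d p X] by metis
  with 0 show "vertex_pairs U \<subseteq> rcl d p X" by simp
next
  assume "vertex_pairs U \<subseteq> rcl d p X"
  then show "defect d p U X = 0" using defect_le[of "{}" U d p X] by simp
qed

lemma defect_antimono:
  assumes "finite U" "X \<subseteq> X'"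
  shows "defect d p U X' \<le> defect d p U X"
proof -
  obtain Y where Y: "finite Y" "card Y = defect d p U X" "vertex_pairs U \<subseteq> rcl d p (X \<union> Y)"
    using defect_witness[OF assms(1), of d p X] by metis
  then show ?thesis using defect_le[of Y U d p X'] rcl_union_mono[OF assms(2) order_refl, of d p Y] by auto
qed

text \<open>The new row replaces a member of an optimal completion \<open>Y\<close>, which leaves a
  completion with one element less.\<close>

lemma defect_insert_less:
  assumes "finite U" "e \<in> vertex_pairs U" "e \<notin> rcl d p X"
  shows "defect d p U (insert e X) + 1 \<le> defect d p U X"
proof -
  obtain Y where Y: "finite Y" "card Y = defect d p U X" "vertex_pairs U \<subseteq> rcl d p (X \<union> Y)"
    using defect_witness[OF assms(1), of d p X] by metis
  then have "e \<in> rcl d p (X \<union> Y)" using assms(2) by blast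
  then obtain y where y: "y \<in> Y" "y \<in> rcl d p (insert e (X \<union> (Y - {y})))"
    using rcl_exchange_set[OF Y(1) _ assms(3)] by blast
  then have "X \<union> Y \<subseteq> rcl d p (insert e X \<union> (Y - {y}))"
    using rcl_superset[of "insert e X \<union> (Y - {y})" d p] by auto
  then have "vertex_pairs U \<subseteq> rcl d p (insert e X \<union> (Y - {y}))"
    using Y(3) rcl_subset_rcl by blast
  then have "defect d p U (insert e X) \<le> card (Y - {y})" using Y(1) by (intro defect_le) auto
  moreover have "card Y > 0" using Y(1) y(1) by (auto simp: card_gt_0_iff)
  ultimately show ?thesis using Y y(1) by simp
qed

section \<open>Rank arguments at a fixed generic position\<close>

locale generic_framework =
  fixes d :: nat and V :: "'a set" and p :: "'a \<Rightarrow> nat \<Rightarrow> real"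
  assumes finite_V: "finite V" and generic: "generic d V p"
begin

abbreviation cl :: "'a set set \<Rightarrow> 'a set set" where "cl \<equiv> rcl d p"

lemma position: "general_position d V p"
  by (rule generic_general_position[OF generic finite_V])

lemma position_dual:
  assumes "v \<in> V" "X \<subseteq> V - {v}" "card X = d"
  obtains y where "\<And>x x'. x \<in> X \<Longrightarrow> x' \<in> X \<Longrightarrow> (\<Sum>j<d. (p x j - p v j) * y x' j) = (if x = x' then 1 else 0)"
proof -
  have "\<exists>y. \<forall>x\<in>X. \<forall>x'\<in>X. (\<Sum>j<d. (p x j - p v j) * y x' j) = (if x = x' then 1 else 0)"
    using position assms unfolding general_position_def by blast
  then show ?thesis using that by blast
qed

lemma position_span:
  assumes "v \<in> V" "X \<subseteq> V - {v}" "card X = d"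
  obtains \<mu> where "\<And>j. j < d \<Longrightarrow> b j = (\<Sum>x\<in>X. \<mu> x * (p x j - p v j))"
proof -
  have "\<exists>\<mu>. \<forall>j<d. b j = (\<Sum>x\<in>X. \<mu> x * (p x j - p v j))"
    using position assms unfolding general_position_def by blast
  then show ?thesis using that by blast
qed

text \<open>\<open>d + 2\<close> points in general position have an affine dependence \<open>\<kappa>\<close> without zero
  coefficients at \<open>v\<close> and \<open>b\<close>, and \<open>\<kappa> u * \<kappa> u'\<close> is then a self-stress of the complete graph.\<close>

lemma complete_minus_edge:
  assumes v: "v \<in> V" "b \<in> V" "v \<noteq> b" and X: "X \<subseteq> V - {v, b}" "card X = d"
    and cl: "vertex_pairs X \<subseteq> cl Y" "\<And>x. x \<in> X \<Longrightarrow> {v, x} \<in> cl Y" "\<And>x. x \<in> X \<Longrightarrow> {b, x} \<in> cl Y"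
  shows "{v, b} \<in> cl Y"
  unfolding rcl_def
proof safe
  fix w assume w: "\<forall>f\<in>Y. rig d p f w = 0"
  have "finite X" using X(1) finite_V by (rule_tac finite_subset) auto
  define ip where "ip u u' = (\<Sum>i<d. (p u i - p u' i) * (w u i - w u' i))" for u u'
  have ip_rig: "ip u u' = 0" if "{u, u'} \<in> cl Y" "u \<noteq> u'" for u u'
  proof -
    have "rig d p {u, u'} w = 0" using that(1) w unfolding rcl_def by blast
    then show ?thesis by (simp add: ip_def rig_pair[OF that(2)])
  qed
  obtain \<mu> where \<mu>: "\<And>j. j < d \<Longrightarrow> p v j - p b j = (\<Sum>x\<in>X. \<mu> x * (p x j - p b j))"
    using position_span[of b X "\<lambda>j. p v j - p b j"] v X by auto
  \<comment> \<open>The expansion of \<open>p v - p b\<close> in the basis based at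
    \<open>b\<close>, rewritten as an affine dependence among all \<open>d + 2\<close>
    points.\<close>
  define \<kappa> where "\<kappa> u = (if u = v then 1 else if u = b then sum \<mu> X - 1 else - \<mu> u)" for u
  let ?S = "insert v (insert b X)"
  have notin: "v \<notin> X" "b \<notin> X" using X by auto
  have sum_S: "(\<Sum>u\<in>?S. \<kappa> u * g u) = g v + (sum \<mu> X - 1) * g b - (\<Sum>x\<in>X. \<mu> x * g x)" for g :: "'a \<Rightarrow> real"
  proof -
    have "(\<Sum>x\<in>X. \<kappa> x * g x) = - (\<Sum>x\<in>X. \<mu> x * g x)"
      unfolding sum_negf[symmetric] using notin by (intro sum.cong) (auto simp: \<kappa>_def)
    then show ?thesis using \<open>finite X\<close> notin v(3) by (simp add: \<kappa>_def)
  qed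
  have "(\<Sum>u\<in>?S. \<Sum>u'\<in>?S. \<kappa> u * \<kappa> u' * ip u u') = 0"
    unfolding ip_def
  proof (rule affine_dependence_stress)
    show "(\<Sum>u\<in>?S. \<kappa> u) = 0" using sum_S[of "\<lambda>_. 1"] by simp
    show "(\<Sum>u\<in>?S. \<kappa> u * p u i) = 0" if "i < d" for i
      unfolding sum_S using \<mu>[OF that] by (simp add: right_diff_distrib left_diff_distrib sum_subtractf sum_distrib_right)
  qed
  also have "(\<Sum>u\<in>?S. \<Sum>u'\<in>?S. \<kappa> u * \<kappa> u' * ip u u') = 2 * (\<kappa> v * \<kappa> b * ip v b)"
  proof -
    have sym: "ip u u' = ip u' u" for u u'
      unfolding ip_def by (intro sum.cong refl) (simp add: algebra_simps)
    have self: "ip u u = 0" for u by (simp add: ip_def)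
    have X0: "ip u x = 0" if "u \<in> ?S" "x \<in> X" for u x
    proof (cases "u = x")
      case False
      have "{u, x} \<in> vertex_pairs X \<or> u = v \<or> u = b" using that False by auto
      then have "{u, x} \<in> cl Y" using cl that(2) by blast
      then show ?thesis using ip_rig False by blast
    qed (simp add: self)
    have "(\<Sum>x\<in>X. \<kappa> u * \<kappa> x * ip u x) = 0" if "u \<in> ?S" for u
      using X0[OF that] by (intro sum.neutral) simp
    moreover have "(\<Sum>u\<in>X. \<Sum>u'\<in>?S. \<kappa> u * \<kappa> u' * ip u u') = 0"
      using X0 sym by (intro sum.neutral ballI) (metis mult_zero_right)
    ultimately show ?thesis using \<open>finite X\<close> notin v(3) self sym[of b v] by simp
  qed
  finally have "\<kappa> v * \<kappa> b * ip v b = 0" by simp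
  \<comment> \<open>Otherwise \<open>p v\<close> would be an affine combination of the points of
    \<open>X\<close>; the basis of differences at \<open>v\<close> then forces
    \<open>\<mu> = 0\<close> on \<open>X\<close>, although the coefficients sum to 1.\<close>
  moreover have "\<kappa> b \<noteq> 0"
  proof
    assume "\<kappa> b = 0"
    then have one: "sum \<mu> X = 1" using v(3) by (simp add: \<kappa>_def)
    obtain y where y: "\<And>x x'. x \<in> X \<Longrightarrow> x' \<in> X \<Longrightarrow> (\<Sum>j<d. (p x j - p v j) * y x' j) = (if x = x' then 1 else 0)"
      using position_dual[of v X] v X by auto
    have zero: "(\<Sum>x\<in>X. \<mu> x * (p x j - p v j)) = 0" if "j < d" for j
      using \<mu>[OF that] one by (simp add: right_diff_distrib sum_subtractf flip: sum_distrib_right)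
    have "\<mu> x' = 0" if x': "x' \<in> X" for x'
    proof -
      have "0 = (\<Sum>j<d. (\<Sum>x\<in>X. \<mu> x * (p x j - p v j)) * y x' j)" using zero by simp
      also have "\<dots> = (\<Sum>j<d. \<Sum>x\<in>X. \<mu> x * ((p x j - p v j) * y x' j))"
        by (simp add: sum_distrib_right mult.assoc)
      also have "\<dots> = (\<Sum>x\<in>X. \<Sum>j<d. \<mu> x * ((p x j - p v j) * y x' j))" by (rule sum.swap)
      also have "\<dots> = (\<Sum>x\<in>X. if x = x' then \<mu> x' else 0)"
        using y x' by (intro sum.cong refl) (auto simp flip: sum_distrib_left)
      also have "\<dots> = \<mu> x'" using x' \<open>finite X\<close> by simp
      finally show ?thesis by simp
    qed
    then show False using one by simp
  qed
  moreover have "\<kappa> v = 1" by (simp add: \<kappa>_def)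
  ultimately show "rig d p {v, b} w = 0" using v(3) by (simp add: ip_def rig_pair)
qed

text \<open>Together with \<open>d\<close> known neighbours of \<open>v\<close> in \<open>B\<close>,
  the vertices \<open>v\<close> and \<open>b\<close> span a complete graph on \<open>d + 2\<close>
  vertices lacking only the edge between \<open>v\<close> and \<open>b\<close>.\<close>

lemma zero_extension:
  assumes B: "B \<subseteq> V" "vertex_pairs B \<subseteq> cl Y" and v: "v \<in> V"
    and deg: "d \<le> card {x \<in> B. {v, x} \<in> cl Y}"
  shows "vertex_pairs (insert v B) \<subseteq> cl Y"
proof (cases "v \<in> B")
  case True
  then show ?thesis using B by (simp add: insert_absorb)
next
  case False
  obtain X where X: "X \<subseteq> {x \<in> B. {v, x} \<in> cl Y}" "card X = d"
    using obtain_subset_with_card_n[OF deg] by metis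
  have vb: "{v, b} \<in> cl Y" if "b \<in> B" for b
  proof (cases "b \<in> X")
    case True
    then show ?thesis using X by blast
  next
    case b: False
    show ?thesis
    proof (rule complete_minus_edge[of _ _ X])
      show "vertex_pairs X \<subseteq> cl Y" using X(1) B(2) vertex_pairs_mono[of X B] by auto
      show "{b, x} \<in> cl Y" if "x \<in> X" for x
      proof -
        have "{b, x} \<in> vertex_pairs B" using that X(1) b \<open>b \<in> B\<close> by auto
        then show ?thesis using B(2) by blast
      qed
    qed (use X B v that b False in auto)
  qed
  show ?thesis
  proof
    fix e assume "e \<in> vertex_pairs (insert v B)"
    then obtain x y where e: "e = {x, y}" "x \<in> insert v B" "y \<in> insert v B" "x \<noteq> y"
      by (elim vertex_pairsE)
    show "e \<in> cl Y"
    proof (cases "x = v \<or> y = v")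
      case True
      moreover have "{b, v} = {v, b}" for b by auto
      ultimately show ?thesis using e vb by (metis insertE)
    next
      case False
      with e have "e \<in> vertex_pairs B" by simp
      then show ?thesis using B(2) by blast
    qed
  qed
qed

lemma zero_extension_set:
  assumes B: "B \<subseteq> V" "vertex_pairs B \<subseteq> cl Y" and C: "C \<subseteq> V"
    and deg: "\<And>v. v \<in> C - B \<Longrightarrow> d \<le> card {x \<in> B. {v, x} \<in> cl Y}"
  shows "vertex_pairs (B \<union> C) \<subseteq> cl Y"
proof -
  have "finite C" using C finite_V finite_subset by blast
  from this C deg show ?thesis
  proof (induction C rule: finite_induct)
    case empty
    then show ?case using B by simp
  next
    case (insert v C)
    show ?case
    proof (cases "v \<in> B")
      case True
      then have "B \<union> insert v C = B \<union> C" by auto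
      then show ?thesis using insert by simp
    next
      case False
      have "finite (B \<union> C)" using B insert.prems finite_V finite_subset[of "B \<union> C" V] by auto
      then have "card {x \<in> B. {v, x} \<in> cl Y} \<le> card {x \<in> B \<union> C. {v, x} \<in> cl Y}"
        by (intro card_mono) auto
      moreover have "d \<le> card {x \<in> B. {v, x} \<in> cl Y}" using insert.prems False by simp
      ultimately have "vertex_pairs (insert v (B \<union> C)) \<subseteq> cl Y"
        using insert B by (intro zero_extension) auto
      then show ?thesis by simp
    qed
  qed
qed

text \<open>A complete graph on \<open>d\<close> vertices, with \<open>d\<close> edges from it to
  each further vertex, spans everything by zero-extensions.\<close>

lemma defect_empty_le:
  assumes "U \<subseteq> V" "d \<le> card U"
  shows "defect d p U {} \<le> d * card U"
proof -
  have "finite U" using assms(1) finite_V finite_subset by blast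
  obtain D where D: "D \<subseteq> U" "card D = d" using obtain_subset_with_card_n[OF assms(2)] by metis
  then have "finite D" using \<open>finite U\<close> finite_subset by blast
  let ?Y1 = "vertex_pairs D" and ?Y2 = "(\<lambda>(b, x). {b, x}) ` ((U - D) \<times> D)"
  have "vertex_pairs (D \<union> U) \<subseteq> cl (?Y1 \<union> ?Y2)"
  proof (rule zero_extension_set)
    show "vertex_pairs D \<subseteq> cl (?Y1 \<union> ?Y2)" using rcl_superset[of "?Y1 \<union> ?Y2" d p] by auto
    show "d \<le> card {x \<in> D. {v, x} \<in> cl (?Y1 \<union> ?Y2)}" if "v \<in> U - D" for v
    proof -
      have "{x \<in> D. {v, x} \<in> cl (?Y1 \<union> ?Y2)} = D" using rcl_superset[of "?Y1 \<union> ?Y2" d p] that by auto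
      then show ?thesis using D by simp
    qed
  qed (use D assms in auto)
  moreover have "D \<union> U = U" using D by auto
  ultimately have "defect d p U {} \<le> card (?Y1 \<union> ?Y2)"
    using \<open>finite U\<close> \<open>finite D\<close> finite_vertex_pairs by (intro defect_le) auto
  also have "\<dots> \<le> card ?Y1 + card ?Y2" by (rule card_Un_le)
  also have "card ?Y1 = d choose 2" using D \<open>finite D\<close> by (simp add: vertex_pairs_def n_subsets)
  also have "d choose 2 \<le> d * d"
    unfolding choose_two by (meson diff_le_self div_le_dividend le_trans mult_le_mono2)
  also have "card ?Y2 \<le> card ((U - D) \<times> D)" using \<open>finite U\<close> \<open>finite D\<close> by (intro card_image_le) auto
  also have "card ((U - D) \<times> D) = (card U - d) * d"
    using D \<open>finite D\<close> by (simp add: card_cartesian_product card_Diff_subset)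
  finally show ?thesis using assms(2) by (simp add: algebra_simps)
qed

text \<open>Vertices merged by \<open>\<pi>\<close> are placed at the same point, that is, the framework is specialised to
  \<open>p \<circ> \<pi>\<close>. There the \<open>d\<close> common neighbours of \<open>b\<close> and \<open>\<pi> b\<close> force them to move alike, so the rank is at
  least the rank on \<open>J\<close> plus \<open>d\<close> for every merged vertex; by genericity it does not drop at \<open>p\<close>.\<close>

lemma contraction:
  assumes U: "U \<subseteq> V" and J: "J \<subseteq> U" "d \<le> card J" and \<pi>: "\<pi> ` U \<subseteq> J" "\<And>j. j \<in> J \<Longrightarrow> \<pi> j = j"
    and H: "H \<subseteq> vertex_pairs U" and Y: "Y \<subseteq> vertex_pairs J"
    and X: "\<And>b. b \<in> U - J \<Longrightarrow> X b \<subseteq> U \<and> card (X b) = d \<and> inj_on \<pi> (X b) \<and> \<pi> b \<notin> \<pi> ` X b"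
    and XH: "\<And>b x. b \<in> U - J \<Longrightarrow> x \<in> X b \<Longrightarrow> {b, x} \<in> H \<and> {\<pi> b, x} \<in> H"
    and JY: "vertex_pairs J \<subseteq> cl ({e \<in> vertex_pairs J. \<exists>f\<in>H. e = \<pi> ` f} \<union> Y)" (is "_ \<subseteq> cl (?Hc \<union> Y)")
  shows "vertex_pairs U \<subseteq> cl (H \<union> Y)"
proof -
  have fin: "finite U" "finite J" using finite_V U J finite_subset by metis+
  have finE: "finite (?Hc \<union> Y)" "finite (H \<union> Y)"
    using fin finite_vertex_pairs[OF fin(1)] finite_vertex_pairs[OF fin(2)] H Y finite_subset by (auto intro: finite_subset)
  have YU: "Y \<subseteq> vertex_pairs U" using Y vertex_pairs_mono[OF J(1)] by blast
  define q where "q v = p (\<pi> v)" for v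
  \<comment> \<open>\<open>Z'\<close> is a basis of the contracted framework at the generic
    \<open>p\<close>, and \<open>Z\<close> one of the uncontracted framework at the degenerate
    \<open>q\<close>. The aim is that \<open>Z\<close> exceeds \<open>Z'\<close> by at least
    \<open>d\<close> rows per merged vertex.\<close>
  obtain Z' where Z': "Z' \<subseteq> ?Hc \<union> Y" "rindep d p Z'" "?Hc \<union> Y \<subseteq> cl Z'"
    using rindep_basis_exists[OF finE(1), of d p] by blast
  obtain Z where Z: "Z \<subseteq> H \<union> Y" "rindep d q Z" "H \<union> Y \<subseteq> rcl d q Z"
    using rindep_basis_exists[OF finE(2), of d q] by blast
  have finZ: "finite Z'" "finite Z" using Z'(1) Z(1) finE finite_subset by blast+
  have Z'J: "Z' \<subseteq> vertex_pairs J" using Z'(1) Y by auto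
  have lift: "\<exists>f\<in>H \<union> Y. \<pi> ` f = e" if "e \<in> Z'" for e
  proof (cases "e \<in> Y")
    case True
    then have "e \<subseteq> J" using Y by (auto simp: vertex_pairs_def)
    then have "\<pi> ` e = (\<lambda>x. x) ` e" by (intro image_cong) (auto simp: \<pi>(2))
    then show ?thesis using True by auto
  next
    case False
    then show ?thesis using that Z'(1) by blast
  qed
  have rig_lift: "rig d q f (\<lambda>v. w (\<pi> v)) = rig d p (\<pi> ` f) w"
    if f: "f \<in> vertex_pairs U" "\<pi> ` f \<in> vertex_pairs J" for f w
  proof -
    obtain a b where ab: "f = {a, b}" "a \<noteq> b" using f(1) by (elim vertex_pairsE)
    with f(2) have "\<pi> a \<noteq> \<pi> b" by auto
    then show ?thesis using ab by (simp add: rig_pair q_def)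
  qed
  obtain w where w: "\<And>e f. e \<in> Z' \<Longrightarrow> f \<in> Z' \<Longrightarrow> rig d p f (w e) = (if e = f then 1 else 0)"
    using rindep_dual_motions[OF Z'(2)] by metis
  have finX: "finite (X b)" if "b \<in> U - J" for b using X[OF that] fin(1) finite_subset by blast
  have "\<exists>y. \<forall>x\<in>X b. \<forall>x'\<in>X b. (\<Sum>j<d. (p (\<pi> x) j - p (\<pi> b) j) * y x' j) = (if x = x' then 1 else 0)"
    if b: "b \<in> U - J" for b
  proof -
    note Xb = X[OF b]
    have "\<pi> ` X b \<subseteq> V - {\<pi> b}" using Xb \<pi>(1) U J by blast
    moreover have "card (\<pi> ` X b) = d" using Xb by (simp add: card_image)
    moreover have "\<pi> b \<in> V" using b \<pi>(1) U J by blast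
    ultimately obtain y where y: "\<And>x x'. x \<in> \<pi> ` X b \<Longrightarrow> x' \<in> \<pi> ` X b \<Longrightarrow>
        (\<Sum>j<d. (p x j - p (\<pi> b) j) * y x' j) = (if x = x' then 1 else 0)"
      using position_dual[of "\<pi> b" "\<pi> ` X b"] by metis
    show ?thesis
    proof (intro exI[of _ "\<lambda>x'. y (\<pi> x')"] ballI)
      fix x x' assume x: "x \<in> X b" "x' \<in> X b"
      then have "\<pi> x = \<pi> x' \<longleftrightarrow> x = x'" using Xb by (auto dest: inj_onD)
      then show "(\<Sum>j<d. (p (\<pi> x) j - p (\<pi> b) j) * y (\<pi> x') j) = (if x = x' then 1 else 0)"
        using y[of "\<pi> x" "\<pi> x'"] x by simp
    qed
  qed
  then obtain y where y: "\<And>b x x'. b \<in> U - J \<Longrightarrow> x \<in> X b \<Longrightarrow> x' \<in> X b \<Longrightarrow>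
      (\<Sum>j<d. (p (\<pi> x) j - p (\<pi> b) j) * y b x' j) = (if x = x' then 1 else 0)"
    by metis
  \<comment> \<open>Index set of the test motions: lifted dual motions of \<open>Z'\<close>, in
    which merged vertices move together, and for each merged vertex \<open>b\<close> a set of
    \<open>d\<close> motions of \<open>b\<close> alone, dual to the directions towards
    \<open>X b\<close>.\<close>
  define I where "I = Z' <+> Sigma (U - J) X"
  have finS: "finite (Sigma (U - J) X)" using fin finX by (intro finite_SigmaI) auto
  then have finI: "finite I" using finZ by (simp add: I_def)
  have cardI: "card I = card Z' + d * card (U - J)"
  proof -
    have "card (Sigma (U - J) X) = (\<Sum>b\<in>U - J. card (X b))"
      using fin finX by (intro card_SigmaI) auto
    also have "\<dots> = (\<Sum>b\<in>U - J. d)" using X by (intro sum.cong) auto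
    finally show ?thesis
      using finZ fin finX by (subst I_def, subst card_Plus) (auto simp: mult.commute)
  qed
  define test where "test j = (case j of Inl e \<Rightarrow> (\<lambda>v. w e (\<pi> v))
      | Inr bx \<Rightarrow> (\<lambda>v i. if v = fst bx then y (fst bx) (snd bx) i else 0))" for j
  have "card I \<le> card Z"
  proof (rule card_le_if_test_motions[OF finZ(2) finI, of d q test])
    fix c assume c: "\<And>z. z \<in> Z \<Longrightarrow> rig d q z (\<lambda>v i. \<Sum>j\<in>I. c j * test j v i) = 0"
    define s where "s v i = (\<Sum>j\<in>I. c j * test j v i)" for v i
    have s0: "rig d q f s = 0" if "f \<in> H \<union> Y" for f
      using Z(3) that c unfolding s_def[abs_def] rcl_def by blast
    have s_split: "s v i = (\<Sum>e\<in>Z'. c (Inl e) * w e (\<pi> v) i) + (\<Sum>b\<in>U - J. \<Sum>x\<in>X b. c (Inr (b, x)) * (if v = b then y b x i else 0))" for v i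
    proof -
      have "s v i = (\<Sum>e\<in>Z'. c (Inl e) * w e (\<pi> v) i) + (\<Sum>bx\<in>Sigma (U - J) X. c (Inr bx) * test (Inr bx) v i)"
        unfolding s_def I_def using finZ(1) finS by (subst sum.Plus) (auto simp: test_def)
      then show ?thesis using fin finX by (simp add: sum.Sigma test_def case_prod_beta)
    qed
    have Inr0: "c (Inr (b, x)) = 0" if b: "b \<in> U - J" and x: "x \<in> X b" for b x
    proof -
      have \<pi>b: "\<pi> b \<in> J" "\<pi> (\<pi> b) = \<pi> b" using b \<pi> by auto
      have diff: "s b i - s (\<pi> b) i = (\<Sum>x'\<in>X b. c (Inr (b, x')) * y b x' i)" for i
      proof -
        have "(\<Sum>b'\<in>U - J. \<Sum>x\<in>X b'. c (Inr (b', x)) * (if b = b' then y b' x i else 0))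
            = (\<Sum>b'\<in>U - J. if b' = b then \<Sum>x\<in>X b. c (Inr (b, x)) * y b x i else 0)"
          by (intro sum.cong refl) auto
        also have "\<dots> = (\<Sum>x\<in>X b. c (Inr (b, x)) * y b x i)" using b fin by simp
        moreover have "(\<Sum>b'\<in>U - J. \<Sum>x\<in>X b'. c (Inr (b', x)) * (if \<pi> b = b' then y b' x i else 0)) = 0"
          using \<pi>b(1) by (intro sum.neutral ballI) auto
        ultimately show ?thesis unfolding s_split by (simp add: \<pi>b(2))
      qed
      have ne: "b \<noteq> x" "\<pi> b \<noteq> x"
        using XH[OF b x] H subsetD[OF H, of "{b, x}"] subsetD[OF H, of "{\<pi> b, x}"] by auto
      \<comment> \<open>At \<open>q\<close> the vertices \<open>b\<close> and \<open>\<pi> b\<close>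
        coincide, so in the difference of these two rows the velocity of \<open>x\<close> cancels
        and only that of \<open>b\<close> relative to \<open>\<pi> b\<close> remains.\<close>
      have "0 = rig d q {\<pi> b, x} s - rig d q {b, x} s" using s0 XH[OF b x] by simp
      also have "\<dots> = (\<Sum>i<d. (p (\<pi> x) i - p (\<pi> b) i) * (s b i - s (\<pi> b) i))"
        unfolding rig_pair[OF ne(1)] rig_pair[OF ne(2)] sum_subtractf[symmetric]
        by (intro sum.cong refl) (simp add: q_def \<pi>b(2) algebra_simps)
      also have "\<dots> = (\<Sum>i<d. \<Sum>x'\<in>X b. c (Inr (b, x')) * ((p (\<pi> x) i - p (\<pi> b) i) * y b x' i))"
        unfolding diff sum_distrib_left by (intro sum.cong refl) simp
      also have "\<dots> = (\<Sum>x'\<in>X b. \<Sum>i<d. c (Inr (b, x')) * ((p (\<pi> x) i - p (\<pi> b) i) * y b x' i))"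
        by (rule sum.swap)
      also have "\<dots> = (\<Sum>x'\<in>X b. if x' = x then c (Inr (b, x)) else 0)"
        using y[OF b x] by (intro sum.cong refl) (auto simp flip: sum_distrib_left)
      also have "\<dots> = c (Inr (b, x))" using x finX[OF b] by simp
      finally show ?thesis by simp
    qed
    have Inl0: "c (Inl e) = 0" if e: "e \<in> Z'" for e
    proof -
      obtain f where f: "f \<in> H \<union> Y" "\<pi> ` f = e" using lift[OF e] by blast
      have s_eq: "s = (\<lambda>v i. \<Sum>e\<in>Z'. c (Inl e) * w e (\<pi> v) i)"
        unfolding s_split[abs_def] using Inr0 by (auto intro!: ext sum.neutral)
      have "0 = rig d q f s" using s0 f by simp
      also have "\<dots> = (\<Sum>e'\<in>Z'. c (Inl e') * rig d q f (\<lambda>v. w e' (\<pi> v)))"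
        unfolding s_eq by (rule rig_sum)
      also have "\<dots> = (\<Sum>e'\<in>Z'. if e' = e then c (Inl e) else 0)"
      proof (intro sum.cong refl)
        fix e' assume "e' \<in> Z'"
        have "f \<in> vertex_pairs U" "\<pi> ` f \<in> vertex_pairs J"
          using f e Z'J H YU by auto
        then show "c (Inl e') * rig d q f (\<lambda>v. w e' (\<pi> v)) = (if e' = e then c (Inl e) else 0)"
          using w[OF \<open>e' \<in> Z'\<close> e] f(2) by (simp add: rig_lift)
      qed
      also have "\<dots> = c (Inl e)" using e finZ by simp
      finally show ?thesis by simp
    qed
    show "\<forall>j\<in>I. c j = 0" using Inr0 Inl0 by (auto simp: I_def)
  qed
  then have card_Z: "card Z' + d * card (U - J) \<le> card Z" by (simp add: cardI)
  have "vertex_pairs U \<subseteq> Pow V" using U by (auto simp: vertex_pairs_def)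
  then have "Z \<subseteq> Pow V" using Z(1) H YU by blast
  then have "rindep d p Z" by (rule rindep_generic[OF generic finite_V finZ(2) _ Z(2)])
  obtain D where D: "D \<subseteq> J" "card D = d" using obtain_subset_with_card_n[OF J(2)] by metis
  have finD: "finite D" using D fin finite_subset by blast
  \<comment> \<open>This set spans all pairs at \<open>p\<close> and has no more elements than
    \<open>Z\<close>. As \<open>Z\<close> is independent at \<open>p\<close>, it must span as
    well.\<close>
  define Y0 where "Y0 = Z' \<union> (\<lambda>(b, x). {b, x}) ` ((U - J) \<times> D)"
  have finY0: "finite Y0" using finZ fin finD by (simp add: Y0_def)
  have "card Y0 \<le> card Z' + card ((U - J) \<times> D)"
    unfolding Y0_def
    by (rule order_trans[OF card_Un_le add_left_mono[OF card_image_le]]) (use fin finD in simp)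
  then have "card Y0 \<le> card Z" using card_Z D by (simp add: card_cartesian_product mult.commute)
  have "vertex_pairs (J \<union> U) \<subseteq> cl Y0"
  proof (rule zero_extension_set)
    have "vertex_pairs J \<subseteq> cl Z'" using JY rcl_subset_rcl[OF Z'(3)] by blast
    also have "\<dots> \<subseteq> cl Y0" by (intro rcl_mono) (simp add: Y0_def)
    finally show "vertex_pairs J \<subseteq> cl Y0" .
    show "d \<le> card {x \<in> J. {v, x} \<in> cl Y0}" if "v \<in> U - J" for v
    proof -
      have "D \<subseteq> {x \<in> J. {v, x} \<in> cl Y0}" using D that rcl_superset[of Y0 d p] by (auto simp: Y0_def)
      then show ?thesis using D(2) fin card_mono[of "{x \<in> J. {v, x} \<in> cl Y0}" D] by simp
    qed
  qed (use U J in auto)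
  then have Y0: "vertex_pairs U \<subseteq> cl Y0" using J by (simp add: Un_absorb1)
  have "vertex_pairs U \<subseteq> cl Z"
  proof
    fix e assume e: "e \<in> vertex_pairs U"
    show "e \<in> cl Z"
    proof (rule ccontr)
      assume *: "e \<notin> cl Z"
      have "card (insert e Z) \<le> card Y0"
        using Z(1) H YU e Y0 finZ finY0
        by (intro rindep_card_le[OF rindep_insert[OF \<open>rindep d p Z\<close> *]]) auto
      moreover have "e \<notin> Z" using * rcl_superset by blast
      ultimately show False using \<open>card Y0 \<le> card Z\<close> finZ by simp
    qed
  qed
  then show ?thesis using rcl_mono[OF Z(1), of d p] by blast
qed

end

section \<open>Double counting and the choice of the merged pairs\<close>

lemma sum_card_swap:
  assumes "finite A" "finite B"
  shows "(\<Sum>a\<in>A. card {b \<in> B. R a b}) = (\<Sum>b\<in>B. card {a \<in> A. R a b})"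
proof -
  have "(\<Sum>a\<in>A. card {b \<in> B. R a b}) = (\<Sum>a\<in>A. \<Sum>b\<in>B. if R a b then 1 else 0)"
    using assms by (intro sum.cong refl) (simp add: sum.If_cases Int_def)
  also have "\<dots> = (\<Sum>b\<in>B. \<Sum>a\<in>A. if R a b then 1 else 0)" by (rule sum.swap)
  also have "\<dots> = (\<Sum>b\<in>B. card {a \<in> A. R a b})"
    using assms by (intro sum.cong refl) (simp add: sum.If_cases Int_def)
  finally show ?thesis .
qed

lemma exists_few_memberships:
  fixes s :: real
  assumes "finite L" "L \<noteq> {}" "finite I" "\<And>i. i \<in> I \<Longrightarrow> real (card {b \<in> L. R b i}) \<le> s"
  shows "\<exists>b\<in>L. real (card {i \<in> I. R b i}) * real (card L) \<le> real (card I) * s"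
proof (rule ccontr)
  assume "\<not> ?thesis"
  then have *: "real (card I) * s < real (card {i \<in> I. R b i}) * real (card L)" if "b \<in> L" for b
    using that by force
  have pos: "real (card L) > 0" using assms(1,2) by (simp add: card_gt_0_iff)
  have "(\<Sum>b\<in>L. real (card {i \<in> I. R b i})) = (\<Sum>i\<in>I. real (card {b \<in> L. R b i}))"
    using sum_card_swap[OF assms(1,3), of R] by (simp flip: of_nat_sum)
  also have "\<dots> \<le> (\<Sum>i\<in>I. s)" by (intro sum_mono assms(4))
  finally have "(\<Sum>b\<in>L. real (card {i \<in> I. R b i})) \<le> real (card I) * s" by simp
  then have "(\<Sum>b\<in>L. real (card {i \<in> I. R b i}) * real (card L)) \<le> (\<Sum>b\<in>L. real (card I) * s)"
    unfolding sum_distrib_right[symmetric] using pos by (simp add: mult.commute)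
  moreover have "(\<Sum>b\<in>L. real (card I) * s) < (\<Sum>b\<in>L. real (card {i \<in> I. R b i}) * real (card L))"
    using assms(1,2) * by (intro sum_strict_mono) auto
  ultimately show False by simp
qed

text \<open>Choosing \<open>a\<close> and then \<open>b\<close> by averaging makes the probability that two merged pairs have
  no edge between them the square of the density of \<open>M\<close>.\<close>

lemma exists_pairing_with_few_bad_pairs:
  fixes s t :: real
  assumes L: "finite L" and t: "t > 0" and s: "s \<ge> 0"
    and deg: "\<And>u. u \<in> L \<Longrightarrow> real (card {v \<in> L. {v, u} \<in> M}) \<le> s"
    and k: "2 * real k + t \<le> real (card L)"
  shows "\<exists>A \<beta>. A \<subseteq> L \<and> card A = k \<and> inj_on \<beta> A \<and> \<beta> ` A \<subseteq> L \<and> A \<inter> \<beta> ` A = {} \<and>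
    real (card {e \<in> vertex_pairs A. e \<in> M \<and> \<beta> ` e \<in> M}) \<le> (real k)\<^sup>2 / 2 * (s / t)\<^sup>2"
  using k
proof (induction k)
  case 0
  have [simp]: "vertex_pairs {} = {}" by (auto simp: vertex_pairs_def)
  show ?case by (intro exI[of _ "{}"]) auto
next
  case (Suc k)
  then obtain A \<beta> where A: "A \<subseteq> L" "card A = k" "inj_on \<beta> A" "\<beta> ` A \<subseteq> L" "A \<inter> \<beta> ` A = {}"
    and bad: "real (card {e \<in> vertex_pairs A. e \<in> M \<and> \<beta> ` e \<in> M}) \<le> (real k)\<^sup>2 / 2 * (s / t)\<^sup>2"
    by auto
  have finA: "finite A" using A(1) L finite_subset by blast
  define L1 where "L1 = L - (A \<union> \<beta> ` A)"
  have "card (A \<union> \<beta> ` A) \<le> 2 * k"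
    using card_Un_le[of A "\<beta> ` A"] A by (simp add: card_image)
  moreover have "card L - card (A \<union> \<beta> ` A) \<le> card L1"
    unfolding L1_def using finA by (intro diff_card_le_card_Diff) simp
  ultimately have "real (card L) \<le> real (card L1 + 2 * k)" by (intro of_nat_mono) linarith
  \<comment> \<open>The room for two more vertices in the hypothesis for \<open>Suc k\<close> leaves
    at least \<open>t\<close> candidates in the choice of \<open>a\<close> and again in that of
    \<open>b\<close>.\<close>
  then have card_L1: "t + 2 \<le> real (card L1)" using Suc.prems by simp
  have finL1: "finite L1" using L by (simp add: L1_def)
  have deg': "real (card {v \<in> L'. {v, u} \<in> M}) \<le> s" if "L' \<subseteq> L" "u \<in> L" for L' u
  proof -
    have "card {v \<in> L'. {v, u} \<in> M} \<le> card {v \<in> L. {v, u} \<in> M}"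
      using that L by (intro card_mono) auto
    then show ?thesis using deg[OF that(2)] by linarith
  qed
  have "L1 \<noteq> {}" "L1 \<subseteq> L" using card_L1 t by (force, simp add: L1_def)
  then have "\<exists>a\<in>L1. real (card {x \<in> A. {a, x} \<in> M}) * real (card L1) \<le> real (card A) * s"
    using finL1 finA A(1) by (intro exists_few_memberships deg') auto
  then obtain a where a: "a \<in> L1" "real (card {x \<in> A. {a, x} \<in> M}) * real (card L1) \<le> real k * s"
    using A(2) by auto
  let ?I = "{x \<in> A. {a, x} \<in> M}"
  define L2 where "L2 = L1 - {a}"
  have card_L2: "t + 1 \<le> real (card L2)" using card_L1 a(1) finL1 by (simp add: L2_def)
  have finL2: "finite L2" using finL1 by (simp add: L2_def)
  have "L2 \<noteq> {}" "L2 \<subseteq> L" using card_L2 t \<open>L1 \<subseteq> L\<close> by (force, auto simp: L2_def)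
  \<comment> \<open>The average for \<open>b\<close> is taken only over those \<open>x\<close> that
    \<open>a\<close> already misses. Thus the two factors \<open>s / t\<close> multiply.\<close>
  then have "\<exists>b\<in>L2. real (card {x \<in> ?I. {b, \<beta> x} \<in> M}) * real (card L2) \<le> real (card ?I) * s"
    using finL2 finA A(4) by (intro exists_few_memberships deg') auto
  then obtain b where b: "b \<in> L2" "real (card {x \<in> ?I. {b, \<beta> x} \<in> M}) * real (card L2) \<le> real (card ?I) * s"
    by auto
  have "real (card ?I) \<le> real k * s / t"
  proof -
    have "real (card ?I) * t \<le> real (card ?I) * real (card L1)"
      using card_L1 by (intro mult_left_mono) auto
    then show ?thesis using a(2) t by (simp add: pos_le_divide_eq)
  qed
  moreover have "real (card {x \<in> ?I. {b, \<beta> x} \<in> M}) \<le> real (card ?I) * s / t"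
  proof -
    have "real (card {x \<in> ?I. {b, \<beta> x} \<in> M}) * t \<le> real (card {x \<in> ?I. {b, \<beta> x} \<in> M}) * real (card L2)"
      using card_L2 by (intro mult_left_mono) auto
    then show ?thesis using b(2) t by (simp add: pos_le_divide_eq)
  qed
  moreover have "real (card ?I) * s / t \<le> real k * s / t * s / t"
    using calculation(1) s t by (intro divide_right_mono mult_right_mono) auto
  ultimately have new: "real (card {x \<in> ?I. {b, \<beta> x} \<in> M}) \<le> real k * (s / t)\<^sup>2"
    by (simp add: power2_eq_square)
  have ab: "a \<in> L" "b \<in> L" "a \<notin> A" "b \<notin> A" "a \<notin> \<beta> ` A" "b \<notin> \<beta> ` A" "a \<noteq> b"
    using a(1) b(1) by (auto simp: L1_def L2_def)
  define \<beta>' where "\<beta>' = \<beta>(a := b)"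
  have \<beta>': "\<beta>' a = b" "\<And>x. x \<in> A \<Longrightarrow> \<beta>' x = \<beta> x" using ab by (auto simp: \<beta>'_def)
  have im: "\<beta>' ` A = \<beta> ` A" using \<beta>' by (intro image_cong) auto
  let ?bad = "\<lambda>A \<beta>. {e \<in> vertex_pairs A. e \<in> M \<and> \<beta> ` e \<in> M}"
  have "?bad (insert a A) \<beta>' \<subseteq> ?bad A \<beta> \<union> (\<lambda>x. {a, x}) ` {x \<in> ?I. {b, \<beta> x} \<in> M}"
  proof
    fix e assume e: "e \<in> ?bad (insert a A) \<beta>'"
    then obtain x y where xy: "e = {x, y}" "x \<in> insert a A" "y \<in> insert a A" "x \<noteq> y"
      by (blast elim: vertex_pairsE)
    consider "x \<in> A" "y \<in> A" | "x = a" "y \<in> A" | "y = a" "x \<in> A" using xy by blast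
    then show "e \<in> ?bad A \<beta> \<union> (\<lambda>x. {a, x}) ` {x \<in> ?I. {b, \<beta> x} \<in> M}"
    proof cases
      case 1
      then show ?thesis using e xy \<beta>' by auto
    next
      case 2
      then show ?thesis using e xy \<beta>' by auto
    next
      case 3
      then have "e = {a, x}" using xy by auto
      then show ?thesis using e 3 \<beta>' by auto
    qed
  qed
  then have "card (?bad (insert a A) \<beta>') \<le> card (?bad A \<beta> \<union> (\<lambda>x. {a, x}) ` {x \<in> ?I. {b, \<beta> x} \<in> M})"
    using finA finite_vertex_pairs[OF finA] by (intro card_mono) auto
  also have "\<dots> \<le> card (?bad A \<beta>) + card {x \<in> ?I. {b, \<beta> x} \<in> M}"
    using finA by (intro order_trans[OF card_Un_le] add_left_mono card_image_le) auto
  finally have "real (card (?bad (insert a A) \<beta>')) \<le> (real k)\<^sup>2 / 2 * (s / t)\<^sup>2 + real k * (s / t)\<^sup>2"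
    using bad new by linarith
  also have "\<dots> = ((real k)\<^sup>2 / 2 + real k) * (s / t)\<^sup>2" by (simp add: algebra_simps)
  \<comment> \<open>The increments \<open>k\<close> sum to at most half a square.\<close>
  also have "\<dots> \<le> (real (Suc k))\<^sup>2 / 2 * (s / t)\<^sup>2"
    by (intro mult_right_mono) (simp_all add: power2_eq_square algebra_simps)
  finally have "real (card (?bad (insert a A) \<beta>')) \<le> (real (Suc k))\<^sup>2 / 2 * (s / t)\<^sup>2" .
  moreover have "inj_on \<beta>' (insert a A)"
  proof -
    have "inj_on \<beta>' A" using A(3) inj_on_cong[of A \<beta>' \<beta>] \<beta>'(2) by blast
    then show ?thesis using im ab \<beta>'(1) by simp
  qed
  moreover have "\<beta>' ` insert a A \<subseteq> L" using im \<beta>'(1) A(4) ab by simp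
  moreover have "insert a A \<inter> \<beta>' ` insert a A = {}" using im \<beta>'(1) A(5) ab by auto
  moreover have "card (insert a A) = Suc k" using A(2) finA ab by simp
  moreover have "insert a A \<subseteq> L" using A(1) ab by simp
  ultimately show ?case by blast
qed

lemma sum_card_incident:
  assumes "finite U" "M \<subseteq> vertex_pairs U"
  shows "(\<Sum>u\<in>U. card {e \<in> M. u \<in> e}) = 2 * card M"
proof -
  have finM: "finite M" using assms finite_vertex_pairs finite_subset by blast
  have "(\<Sum>u\<in>U. card {e \<in> M. u \<in> e}) = (\<Sum>e\<in>M. card {u \<in> U. u \<in> e})"
    by (rule sum_card_swap[OF assms(1) finM])
  also have "\<dots> = (\<Sum>e\<in>M. 2)"
  proof (intro sum.cong refl)
    fix e assume "e \<in> M"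
    then have "{u \<in> U. u \<in> e} = e" "card e = 2" using assms(2) by (auto simp: vertex_pairs_def)
    then show "card {u \<in> U. u \<in> e} = 2" by simp
  qed
  finally show ?thesis by simp
qed

lemma card_neighbours_le_incident:
  assumes "finite M"
  shows "card {v. {u, v} \<in> M} \<le> card {e \<in> M. u \<in> e}"
proof (rule card_inj_on_le)
  show "inj_on (\<lambda>v. {u, v}) {v. {u, v} \<in> M}" by (auto simp: inj_on_def doubleton_eq_iff)
qed (use assms in auto)

section \<open>The quadratic bound on the defect\<close>

context generic_framework
begin

text \<open>The defect is quadratic in the density of the missing pairs, hence it vanishes, being an integer,
  as soon as that density is a small multiple of \<open>1 / d\<close>.\<close>

lemma defect_le_missing_pairs:
  fixes X :: "'a set set" and U :: "'a set"
  defines "M \<equiv> vertex_pairs U - cl X"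
  assumes U: "U \<subseteq> V" and d: "1 \<le> d" "64 * d \<le> card U"
    and deg: "\<And>u. u \<in> U \<Longrightarrow> 16 * card {v \<in> U. {v, u} \<in> M} \<le> card U"
  shows "real (defect d p U X) \<le> 512 * (real d)\<^sup>2 * (real (card M))\<^sup>2 / real (card U) ^ 4"
proof -
  define N where "N = card U"
  define m where "m = card M"
  define miss where "miss u = {v \<in> U. {v, u} \<in> M}" for u
  note deg = deg[folded N_def miss_def]
  have finU: "finite U" using U finite_V finite_subset by blast
  have finM: "finite M" using finU finite_vertex_pairs by (auto simp: M_def)
  have N: "N > 0" using d by (simp add: N_def)
  have fin_miss: "finite (miss u)" for u using finU by (simp add: miss_def)
  have sum_miss: "(\<Sum>u\<in>U. card (miss u)) \<le> 2 * m"
  proof -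
    have "card (miss u) \<le> card {e \<in> M. u \<in> e}" for u
    proof -
      have "{v. {u, v} \<in> M} \<subseteq> U" by (auto simp: M_def)
      then have "miss u = {v. {u, v} \<in> M}" by (auto simp: miss_def insert_commute)
      then show ?thesis using card_neighbours_le_incident[OF finM, of u] by simp
    qed
    then have "(\<Sum>u\<in>U. card (miss u)) \<le> (\<Sum>u\<in>U. card {e \<in> M. u \<in> e})" by (intro sum_mono)
    then show ?thesis using sum_card_incident[OF finU, of M] by (auto simp: M_def m_def)
  qed
  \<comment> \<open>Markov's inequality: the average number of missing neighbours is at most
    \<open>2 * m / N\<close>, so at least half of \<open>U\<close> stays within twice that.\<close>
  define L where "L = {u \<in> U. N * card (miss u) \<le> 4 * m}"
  have L: "N \<le> 2 * card L"
  proof (cases "m = 0")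
    case True
    then have "M = {}" using finM by (simp add: m_def)
    then have "L = U" by (simp add: L_def miss_def)
    then show ?thesis by (simp add: N_def)
  next
    case False
    have "card (U - L) * (4 * m) = (\<Sum>u\<in>U - L. 4 * m)" by simp
    also have "\<dots> \<le> (\<Sum>u\<in>U - L. N * card (miss u))" by (intro sum_mono) (auto simp: L_def)
    also have "\<dots> \<le> (\<Sum>u\<in>U. N * card (miss u))" using finU by (intro sum_mono2) auto
    also have "\<dots> \<le> N * (2 * m)" using sum_miss by (simp flip: sum_distrib_left)
    finally have "2 * card (U - L) \<le> N" using False by simp
    moreover have "card (U - L) = N - card L" "card L \<le> N"
      using finU card_mono[of U L] by (auto simp: N_def L_def card_Diff_subset)
    ultimately show ?thesis by linarith
  qed
  have finL: "finite L" using finU by (simp add: L_def)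
  \<comment> \<open>The choice \<open>t = N / 4\<close> is possible since \<open>L\<close> has at
    least \<open>N / 2\<close> members and \<open>64 * d \<le> N\<close>.\<close>
  have "\<exists>A \<beta>. A \<subseteq> L \<and> card A = 2 * d \<and> inj_on \<beta> A \<and> \<beta> ` A \<subseteq> L \<and> A \<inter> \<beta> ` A = {} \<and>
    real (card {e \<in> vertex_pairs A. e \<in> M \<and> \<beta> ` e \<in> M}) \<le> (real (2 * d))\<^sup>2 / 2 * ((4 * m / N) / (N / 4))\<^sup>2"
  proof (rule exists_pairing_with_few_bad_pairs[OF finL])
    show "real (card {v \<in> L. {v, u} \<in> M}) \<le> 4 * m / N" if "u \<in> L" for u
    proof -
      have "card {v \<in> L. {v, u} \<in> M} \<le> card (miss u)"
        using finU by (intro card_mono) (auto simp: miss_def L_def)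
      then have "N * card {v \<in> L. {v, u} \<in> M} \<le> 4 * m"
        using that by (auto simp: L_def intro: order_trans[OF mult_le_mono2])
      then have "real N * real (card {v \<in> L. {v, u} \<in> M}) \<le> 4 * real m"
        by (metis of_nat_le_iff of_nat_mult of_nat_numeral)
      then show ?thesis using N by (simp add: field_simps)
    qed
    have "8 * real d \<le> real (card L)"
    proof -
      have "16 * (4 * d) \<le> N" using d by (simp add: N_def)
      then show ?thesis using L by linarith
    qed
    moreover have "64 * d \<le> N" using d by (simp add: N_def)
    then have "64 * real d \<le> real N" by linarith
    moreover have "real N \<le> 2 * real (card L)" using L by linarith
    ultimately show "2 * real (2 * d) + real N / 4 \<le> real (card L)" by simp
  qed (use N in auto)
  then obtain A \<beta> where A: "A \<subseteq> L" "card A = 2 * d" "inj_on \<beta> A" "\<beta> ` A \<subseteq> L" "A \<inter> \<beta> ` A = {}"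
    and bad: "real (card {e \<in> vertex_pairs A. e \<in> M \<and> \<beta> ` e \<in> M}) \<le> (real (2 * d))\<^sup>2 / 2 * ((4 * m / N) / (N / 4))\<^sup>2"
    by blast
  have AU: "A \<subseteq> U" "\<beta> ` A \<subseteq> U" using A by (auto simp: L_def)
  have finA: "finite A" using AU finU finite_subset by blast
  let ?B = "\<beta> ` A"
  define J where "J = U - ?B"
  \<comment> \<open>The only pairs that are added by hand: any other pair inside \<open>A\<close> is
    present itself or through its copy in \<open>?B\<close>.\<close>
  define Y where "Y = {e \<in> vertex_pairs A. e \<in> M \<and> \<beta> ` e \<in> M}"
  define H where "H = vertex_pairs U \<inter> cl X"
  define \<pi> where "\<pi> v = (if v \<in> ?B then inv_into A \<beta> v else v)" for v
  have \<pi>\<beta>: "\<pi> (\<beta> x) = x" if "x \<in> A" for x using that A(3) by (simp add: \<pi>_def)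
  have \<pi>J: "\<pi> j = j" if "j \<in> J" for j using that by (simp add: \<pi>_def J_def)
  have AJ: "A \<subseteq> J" using AU A(5) by (auto simp: J_def)
  have finJ: "finite J" using finU by (simp add: J_def)
  have cardJ: "card J + 2 * d = N"
    using A finA AU finU card_mono[OF finU AU(2)] by (simp add: J_def N_def card_Diff_subset card_image)
  have "64 * d \<le> N" using d by (simp add: N_def)
  have YJ: "Y \<subseteq> vertex_pairs J" using vertex_pairs_mono[OF AJ] by (auto simp: Y_def)
  have notM: "{u, v} \<in> H" if "u \<in> U" "v \<in> U" "u \<noteq> v" "{u, v} \<notin> M" for u v
    using that by (auto simp: H_def M_def)
  \<comment> \<open>Common neighbours of the two merged vertices: excluding \<open>4 * d\<close>
    vertices and at most \<open>N / 16\<close> missing neighbours of each still leaves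
    \<open>d\<close>.\<close>
  have "\<exists>Xb. Xb \<subseteq> U - (A \<union> ?B) \<and> card Xb = d \<and> (\<forall>x\<in>Xb. {\<beta> a, x} \<in> H \<and> {a, x} \<in> H)"
    if a: "a \<in> A" for a
  proof -
    define C where "C = U - (A \<union> ?B) - miss a - miss (\<beta> a)"
    have aU: "a \<in> U" "\<beta> a \<in> U" using a AU by auto
    have "finite C" using finU by (simp add: C_def)
    have "card U \<le> card (C \<union> (A \<union> ?B) \<union> miss a \<union> miss (\<beta> a))"
      using finU finA fin_miss by (intro card_mono) (auto simp: C_def)
    also have "\<dots> \<le> card C + (card A + card ?B) + card (miss a) + card (miss (\<beta> a))"
      by (meson add_mono card_Un_le order_refl order_trans)
    finally have "N \<le> card C + 4 * d + card (miss a) + card (miss (\<beta> a))"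
      using A(2,3) by (simp add: N_def card_image)
    then have "d \<le> card C" using deg[OF aU(1)] deg[OF aU(2)] \<open>64 * d \<le> N\<close> by linarith
    then obtain Xb where Xb: "Xb \<subseteq> C" "card Xb = d" using obtain_subset_with_card_n by metis
    have "{\<beta> a, x} \<in> H \<and> {a, x} \<in> H" if "x \<in> C" for x
      using that a aU notM by (auto simp: C_def miss_def insert_commute)
    then have "\<forall>x\<in>Xb. {\<beta> a, x} \<in> H \<and> {a, x} \<in> H" using Xb(1) by blast
    moreover have "Xb \<subseteq> U - (A \<union> ?B)" using Xb(1) by (auto simp: C_def)
    ultimately show ?thesis using Xb(2) by blast
  qed
  then obtain Xf where Xf: "\<And>a. a \<in> A \<Longrightarrow> Xf a \<subseteq> U - (A \<union> ?B) \<and> card (Xf a) = d \<and> (\<forall>x\<in>Xf a. {\<beta> a, x} \<in> H \<and> {a, x} \<in> H)"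
    by metis
  let ?Hc = "{e \<in> vertex_pairs J. \<exists>f\<in>H. e = \<pi> ` f}"
  have JH: "e \<in> cl (?Hc \<union> Y)" if e: "e \<in> vertex_pairs J" "e \<notin> M" for e
  proof -
    have "e \<in> H" using e vertex_pairs_mono[of J U] by (auto simp: H_def M_def J_def)
    moreover have "\<pi> ` e = (\<lambda>x. x) ` e"
      using e(1) \<pi>J by (intro image_cong refl) (auto simp: vertex_pairs_def)
    ultimately have "e \<in> ?Hc" using e(1) by auto
    then show ?thesis using rcl_superset[of "?Hc \<union> Y" d p] by blast
  qed
  have KA: "vertex_pairs A \<subseteq> cl (?Hc \<union> Y)"
  proof
    fix e assume e: "e \<in> vertex_pairs A"
    then have eJ: "e \<in> vertex_pairs J" using vertex_pairs_mono[OF AJ] by blast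
    show "e \<in> cl (?Hc \<union> Y)"
    proof (cases "e \<in> M \<and> \<beta> ` e \<notin> M")
      case True
      obtain x y where xy: "e = {x, y}" "x \<in> A" "y \<in> A" "x \<noteq> y" using e by (elim vertex_pairsE)
      then have "\<beta> x \<noteq> \<beta> y" using A(3) by (auto dest: inj_onD)
      then have "\<beta> ` e \<in> H" using notM[of "\<beta> x" "\<beta> y"] True xy AU by auto
      moreover have "\<pi> ` (\<beta> ` e) = e" using xy \<pi>\<beta> by auto
      ultimately have "e \<in> ?Hc" using eJ by (metis (mono_tags, lifting) mem_Collect_eq)
      then show ?thesis using rcl_superset[of "?Hc \<union> Y" d p] by blast
    next
      case False
      then have "e \<notin> M \<or> e \<in> Y" using e by (auto simp: Y_def)
      then show ?thesis using JH[OF eJ] rcl_superset[of "?Hc \<union> Y" d p] by blast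
    qed
  qed
  \<comment> \<open>Here the size \<open>2 * d\<close> of \<open>A\<close> pays off: a vertex
    missing at most \<open>d\<close> members of \<open>A\<close> retains \<open>d\<close> neighbours
    there.\<close>
  define Good where "Good = {v \<in> J. card {x \<in> A. {v, x} \<in> M} \<le> d}"
  have KG: "vertex_pairs (A \<union> Good) \<subseteq> cl (?Hc \<union> Y)"
  proof (rule zero_extension_set[OF _ KA])
    show "d \<le> card {x \<in> A. {v, x} \<in> cl (?Hc \<union> Y)}" if v: "v \<in> Good - A" for v
    proof -
      have "A - {x \<in> A. {v, x} \<in> M} \<subseteq> {x \<in> A. {v, x} \<in> cl (?Hc \<union> Y)}"
        using v AJ by (auto simp: Good_def intro!: JH)
      then have "card (A - {x \<in> A. {v, x} \<in> M}) \<le> card {x \<in> A. {v, x} \<in> cl (?Hc \<union> Y)}"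
        using finA by (intro card_mono) auto
      moreover have "card A - card {x \<in> A. {v, x} \<in> M} \<le> card (A - {x \<in> A. {v, x} \<in> M})"
        using finA by (intro diff_card_le_card_Diff) auto
      moreover have "card {x \<in> A. {v, x} \<in> M} \<le> d" using v by (simp add: Good_def)
      ultimately show ?thesis using A(2) by linarith
    qed
  qed (use AU U in \<open>auto simp: Good_def J_def\<close>)
  define Bad where "Bad = J - (A \<union> Good)"
  have finBad: "finite Bad" using finJ by (simp add: Bad_def)
  \<comment> \<open>Each bad vertex misses more than \<open>d\<close> members of \<open>A\<close>,
    while each of the \<open>2 * d\<close> members is missed by at most \<open>N / 16\<close>
    vertices. So at most \<open>N / 8\<close> are bad, few enough to be attached to
    \<open>A \<union> Good\<close>.\<close>
  have "16 * (d * card Bad) \<le> 2 * (d * N)"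
  proof -
    have "d * card Bad = (\<Sum>v\<in>Bad. d)" by simp
    also have "\<dots> \<le> (\<Sum>v\<in>Bad. card {x \<in> A. {v, x} \<in> M})"
      by (intro sum_mono) (auto simp: Bad_def Good_def)
    also have "\<dots> = (\<Sum>x\<in>A. card {v \<in> Bad. {v, x} \<in> M})"
      by (rule sum_card_swap[OF finBad finA])
    also have "\<dots> \<le> (\<Sum>x\<in>A. card (miss x))"
      using finU by (intro sum_mono card_mono) (auto simp: miss_def Bad_def J_def)
    finally have "16 * (d * card Bad) \<le> (\<Sum>x\<in>A. 16 * card (miss x))" by (simp flip: sum_distrib_left)
    also have "\<dots> \<le> (\<Sum>x\<in>A. N)" using AU by (intro sum_mono deg) auto
    finally show ?thesis using A(2) by simp
  qed
  then have Bad: "8 * card Bad \<le> N" using d by simp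
  have KJ: "vertex_pairs ((A \<union> Good) \<union> J) \<subseteq> cl (?Hc \<union> Y)"
  proof (rule zero_extension_set[OF _ KG])
    show "d \<le> card {x \<in> A \<union> Good. {v, x} \<in> cl (?Hc \<union> Y)}" if v: "v \<in> J - (A \<union> Good)" for v
    proof -
      let ?W = "{x \<in> A \<union> Good. {v, x} \<in> cl (?Hc \<union> Y)}"
      have fin: "finite (A \<union> Good)" using finA finJ by (simp add: Good_def)
      have "A \<union> Good \<subseteq> ?W \<union> miss v"
      proof
        fix x assume x: "x \<in> A \<union> Good"
        then have "x \<in> J" "x \<noteq> v" using AJ v by (auto simp: Good_def)
        then show "x \<in> ?W \<union> miss v"
          using x v JH[of "{v, x}"] by (auto simp: miss_def J_def insert_commute)
      qed
      then have "card (A \<union> Good) \<le> card (?W \<union> miss v)" using fin fin_miss by (intro card_mono) auto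
      also have "\<dots> \<le> card ?W + card (miss v)" by (rule card_Un_le)
      finally have "card (A \<union> Good) \<le> card ?W + card (miss v)" .
      moreover have "card J \<le> card (A \<union> Good) + card Bad"
      proof -
        have "card J \<le> card ((A \<union> Good) \<union> Bad)" using fin finBad by (intro card_mono) (auto simp: Bad_def)
        then show ?thesis using card_Un_le order_trans by blast
      qed
      moreover have "16 * card (miss v) \<le> N" using v deg by (simp add: J_def)
      ultimately show ?thesis using cardJ Bad \<open>64 * d \<le> N\<close> by linarith
    qed
  qed (use AU U in \<open>auto simp: Good_def J_def\<close>)
  have "(A \<union> Good) \<union> J = J" using AJ by (auto simp: Good_def)
  with KJ have KJ: "vertex_pairs J \<subseteq> cl (?Hc \<union> Y)" by simp
  have "vertex_pairs U \<subseteq> cl (H \<union> Y)"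
  proof (rule contraction[OF U _ _ _ \<pi>J _ YJ _ _ KJ, where X = "\<lambda>b. Xf (\<pi> b)"])
    show "J \<subseteq> U" by (auto simp: J_def)
    show "d \<le> card J" using cardJ \<open>64 * d \<le> N\<close> by linarith
    show "H \<subseteq> vertex_pairs U" by (simp add: H_def)
    show "\<pi> ` U \<subseteq> J"
    proof
      fix v assume "v \<in> \<pi> ` U"
      then obtain u where u: "u \<in> U" "v = \<pi> u" by blast
      show "v \<in> J"
      proof (cases "u \<in> ?B")
        case True
        then show ?thesis using u \<pi>\<beta> AJ by auto
      next
        case False
        then show ?thesis using u by (simp add: \<pi>_def J_def)
      qed
    qed
    fix b assume "b \<in> U - J"
    then obtain a where a: "a \<in> A" "b = \<beta> a" by (auto simp: J_def)
    then have b: "\<pi> b = a" using \<pi>\<beta> by simp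
    note Xa = Xf[OF a(1)]
    have id: "\<pi> x = x" if "x \<in> Xf a" for x using Xa that by (auto simp: \<pi>_def)
    have "\<pi> ` Xf a = Xf a" using id by force
    moreover have "inj_on \<pi> (Xf a)" using id by (simp add: inj_on_def)
    ultimately show "Xf (\<pi> b) \<subseteq> U \<and> card (Xf (\<pi> b)) = d \<and> inj_on \<pi> (Xf (\<pi> b)) \<and> \<pi> b \<notin> \<pi> ` Xf (\<pi> b)"
      using Xa a(1) unfolding b by auto
    show "{b, x} \<in> H \<and> {\<pi> b, x} \<in> H" if "x \<in> Xf (\<pi> b)" for x
      using Xa that a(2) unfolding b by auto
  qed
  also have "cl (H \<union> Y) \<subseteq> cl (X \<union> Y)"
  proof (rule rcl_subset_rcl)
    have "H \<subseteq> cl X" by (simp add: H_def)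
    also have "\<dots> \<subseteq> cl (X \<union> Y)" by (rule rcl_mono) simp
    finally show "H \<union> Y \<subseteq> cl (X \<union> Y)" using rcl_superset[of "X \<union> Y" d p] by auto
  qed
  finally have "defect d p U X \<le> card Y"
    using finA finite_vertex_pairs[OF finA] by (intro defect_le) (auto simp: Y_def)
  then have "real (defect d p U X) \<le> (real (2 * d))\<^sup>2 / 2 * ((4 * m / N) / (N / 4))\<^sup>2"
    using bad unfolding Y_def by linarith
  also have "\<dots> = 512 * (real d)\<^sup>2 * (real m)\<^sup>2 / real N ^ 4"
    using N by (simp add: field_simps power2_eq_square power4_eq_xxxx)
  finally show ?thesis by (simp add: N_def m_def)
qed

end

section \<open>Random subsets\<close>

text \<open>The expectation over a \<open>p\<close>-random subset, as an explicit finite sum: a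
  polynomial in \<open>p\<close>, which can be differentiated.\<close>

definition subset_exp :: "'e set \<Rightarrow> real \<Rightarrow> ('e set \<Rightarrow> real) \<Rightarrow> real" where
  "subset_exp S p f = (\<Sum>X\<in>Pow S. p ^ card X * (1 - p) ^ card (S - X) * f X)"

lemma subset_exp_empty [simp]: "subset_exp {} p f = f {}"
  by (simp add: subset_exp_def)

text \<open>Conditioning on whether \<open>e\<close> is chosen; this drives the inductions on the
  ground set below.\<close>

lemma subset_exp_insert:
  assumes S: "finite S" "e \<notin> S"
  shows "subset_exp (insert e S) p f = p * subset_exp S p (\<lambda>X. f (insert e X)) + (1 - p) * subset_exp S p f"
proof -
  let ?g = "\<lambda>X. p ^ card X * (1 - p) ^ card (insert e S - X) * f X"
  have fin: "finite X" if "X \<subseteq> S" for X using that S(1) finite_subset by blast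
  have "subset_exp (insert e S) p f = sum ?g (Pow S) + sum ?g (insert e ` Pow S)"
    unfolding subset_exp_def Pow_insert using S by (intro sum.union_disjoint) auto
  also have "sum ?g (Pow S) = (1 - p) * subset_exp S p f"
    unfolding subset_exp_def sum_distrib_left
  proof (intro sum.cong refl)
    fix X assume "X \<in> Pow S"
    then have "insert e S - X = insert e (S - X)" "e \<notin> S - X" using S by auto
    then show "?g X = (1 - p) * (p ^ card X * (1 - p) ^ card (S - X) * f X)" using S(1) by simp
  qed
  also have "sum ?g (insert e ` Pow S) = (\<Sum>X\<in>Pow S. ?g (insert e X))"
    using S by (intro sum.reindex_cong[of "insert e"]) (auto simp: inj_on_def)
  also have "\<dots> = p * subset_exp S p (\<lambda>X. f (insert e X))"
    unfolding subset_exp_def sum_distrib_left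
  proof (intro sum.cong refl)
    fix X assume "X \<in> Pow S"
    then have "insert e S - insert e X = S - X" "e \<notin> X" "finite X" using S fin by auto
    then show "?g (insert e X) = p * (p ^ card X * (1 - p) ^ card (S - X) * f (insert e X))" by simp
  qed
  finally show ?thesis by simp
qed

lemma subset_exp_cong:
  "(\<And>X. X \<subseteq> S \<Longrightarrow> f X = g X) \<Longrightarrow> subset_exp S p f = subset_exp S p g"
  unfolding subset_exp_def by (intro sum.cong) auto

lemma subset_exp_mono:
  assumes "0 \<le> p" "p \<le> 1" "\<And>X. X \<subseteq> S \<Longrightarrow> f X \<le> g X"
  shows "subset_exp S p f \<le> subset_exp S p g"
  unfolding subset_exp_def using assms by (intro sum_mono mult_left_mono) auto

lemma subset_exp_add: "subset_exp S p (\<lambda>X. f X + g X) = subset_exp S p f + subset_exp S p g"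
  by (simp add: subset_exp_def distrib_left sum.distrib)

lemma subset_exp_diff: "subset_exp S p (\<lambda>X. f X - g X) = subset_exp S p f - subset_exp S p g"
  by (simp add: subset_exp_def right_diff_distrib sum_subtractf)

lemma subset_exp_cmult: "subset_exp S p (\<lambda>X. c * f X) = c * subset_exp S p f"
  by (simp add: subset_exp_def sum_distrib_left mult_ac)

lemma subset_exp_sum: "subset_exp S p (\<lambda>X. \<Sum>i\<in>I. f i X) = (\<Sum>i\<in>I. subset_exp S p (f i))"
  unfolding subset_exp_def sum_distrib_left by (rule sum.swap)

lemma subset_exp_const: "finite S \<Longrightarrow> subset_exp S p (\<lambda>_. c) = c"
  by (induction S rule: finite_induct) (simp_all add: subset_exp_insert algebra_simps)

lemma subset_exp_0: "finite S \<Longrightarrow> subset_exp S 0 f = f {}"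
  by (induction S arbitrary: f rule: finite_induct) (simp_all add: subset_exp_insert)

text \<open>Conditioning on \<open>a\<close> and the product rule: differentiating the weights of
  the two cases gives the discrete derivative at \<open>a\<close>, and the induction hypothesis
  gives the others.\<close>

lemma russo_formula:
  assumes "finite S"
  shows "((\<lambda>p. subset_exp S p f) has_real_derivative
    subset_exp S p (\<lambda>X. \<Sum>e\<in>S. f (insert e X) - f (X - {e}))) (at p)"
  using assms
proof (induction S arbitrary: f rule: finite_induct)
  case (insert a S)
  let ?D = "\<lambda>f. subset_exp S p (\<lambda>X. \<Sum>e\<in>S. f (insert e X) - f (X - {e}))"
  let ?E1 = "\<lambda>p. subset_exp S p (\<lambda>X. f (insert a X))" and ?E0 = "\<lambda>p. subset_exp S p f"
  have "((\<lambda>p. p * ?E1 p + (1 - p) * ?E0 p) has_real_derivative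
      (1 * ?E1 p + ?D (\<lambda>X. f (insert a X)) * p) + ((0 - 1) * ?E0 p + ?D f * (1 - p))) (at p)"
    by (intro derivative_intros DERIV_mult' insert.IH)
  moreover have "(1 * ?E1 p + ?D (\<lambda>X. f (insert a X)) * p) + ((0 - 1) * ?E0 p + ?D f * (1 - p)) =
      subset_exp (insert a S) p (\<lambda>X. \<Sum>e\<in>insert a S. f (insert e X) - f (X - {e}))"
  proof -
    have 1: "(\<Sum>e\<in>insert a S. f (insert e (insert a X)) - f (insert a X - {e}))
        = (f (insert a X) - f X) + (\<Sum>e\<in>S. f (insert a (insert e X)) - f (insert a (X - {e})))" if "X \<subseteq> S" for X
    proof -
      have "a \<notin> X" using that insert.hyps by blast
      then have "insert a X - {a} = X" by simp
      moreover have "insert a X - {e} = insert a (X - {e})" if "e \<in> S" for e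
        using that insert.hyps by auto
      ultimately show ?thesis using insert.hyps
        by (simp add: insert_commute[of _ a] cong: sum.cong)
    qed
    have 0: "(\<Sum>e\<in>insert a S. f (insert e X) - f (X - {e}))
        = (f (insert a X) - f X) + (\<Sum>e\<in>S. f (insert e X) - f (X - {e}))" if "X \<subseteq> S" for X
    proof -
      have "a \<notin> X" using that insert.hyps by blast
      then show ?thesis using insert.hyps by simp
    qed
    have D1: "subset_exp S p (\<lambda>X. \<Sum>e\<in>insert a S. f (insert e (insert a X)) - f (insert a X - {e}))
        = ?E1 p - ?E0 p + ?D (\<lambda>X. f (insert a X))"
      unfolding subset_exp_add[symmetric] subset_exp_diff[symmetric] by (rule subset_exp_cong) (rule 1)
    have D0: "subset_exp S p (\<lambda>X. \<Sum>e\<in>insert a S. f (insert e X) - f (X - {e}))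
        = ?E1 p - ?E0 p + ?D f"
      unfolding subset_exp_add[symmetric] subset_exp_diff[symmetric] by (rule subset_exp_cong) (rule 0)
    show ?thesis
      unfolding subset_exp_insert[OF insert.hyps] D1 D0 by (simp add: algebra_simps)
  qed
  ultimately show ?case by (simp add: subset_exp_insert[OF insert.hyps])
qed simp

text \<open>A Gronwall argument: by Russo's formula the derivative is at most
  \<open>- \<kappa>\<close> times the expectation, so the expectation times
  \<open>exp (\<kappa> * t)\<close> does not increase. It replaces exposing the random edges one at
  a time.\<close>

lemma subset_exp_le_exp:
  assumes S: "finite S" and anti: "\<And>X Y. X \<subseteq> Y \<Longrightarrow> Y \<subseteq> S \<Longrightarrow> f Y \<le> f X"
    and step: "\<And>X. X \<subseteq> S \<Longrightarrow> \<kappa> * f X \<le> (\<Sum>e\<in>S. f X - f (insert e X))"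
    and p: "0 \<le> p" "p \<le> 1"
  shows "subset_exp S p f \<le> exp (- \<kappa> * p) * f {}"
proof -
  let ?D = "\<lambda>t. subset_exp S t (\<lambda>X. \<Sum>e\<in>S. f (insert e X) - f (X - {e}))"
  have D: "?D t \<le> - \<kappa> * subset_exp S t f" if t: "0 \<le> t" "t \<le> p" for t
  proof -
    have "?D t \<le> subset_exp S t (\<lambda>X. - \<kappa> * f X)"
    proof (rule subset_exp_mono)
      fix X assume X: "X \<subseteq> S"
      have "(\<Sum>e\<in>S. f (insert e X) - f (X - {e})) \<le> (\<Sum>e\<in>S. f (insert e X) - f X)"
        using X by (intro sum_mono diff_left_mono anti) auto
      also have "\<dots> = - (\<Sum>e\<in>S. f X - f (insert e X))" by (simp flip: sum_negf)
      also have "\<dots> \<le> - \<kappa> * f X" using step[OF X] by simp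
      finally show "(\<Sum>e\<in>S. f (insert e X) - f (X - {e})) \<le> - \<kappa> * f X" .
    qed (use t p in auto)
    then show ?thesis unfolding subset_exp_cmult .
  qed
  have "subset_exp S p f * exp (\<kappa> * p) \<le> subset_exp S 0 f * exp (\<kappa> * 0)"
  proof (rule DERIV_nonpos_imp_nonincreasing[OF p(1)])
    fix t assume t: "0 \<le> t" "t \<le> p"
    have "((\<lambda>t. exp (\<kappa> * t)) has_real_derivative exp (\<kappa> * t) * \<kappa>) (at t)"
      by (auto intro!: derivative_eq_intros)
    then have d: "((\<lambda>t. subset_exp S t f * exp (\<kappa> * t)) has_real_derivative
        subset_exp S t f * (exp (\<kappa> * t) * \<kappa>) + ?D t * exp (\<kappa> * t)) (at t)"
      by (intro DERIV_mult' russo_formula[OF S])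
    have eq: "subset_exp S t f * (exp (\<kappa> * t) * \<kappa>) + ?D t * exp (\<kappa> * t)
        = (?D t + \<kappa> * subset_exp S t f) * exp (\<kappa> * t)" by (simp add: algebra_simps)
    have "(?D t + \<kappa> * subset_exp S t f) * exp (\<kappa> * t) \<le> 0" using D[OF t] by (intro mult_nonpos_nonneg) auto
    with d[unfolded eq] show "\<exists>y. ((\<lambda>t. subset_exp S t f * exp (\<kappa> * t)) has_real_derivative y) (at t) \<and> y \<le> 0"
      by blast
  qed
  then show ?thesis using S by (simp add: subset_exp_0 exp_minus field_simps)
qed

text \<open>The union of independent random subsets with densities \<open>p1\<close> and
  \<open>p2\<close> has density \<open>p1 + p2 - p1 * p2\<close>, and a larger density only lowers
  the expectation of a decreasing \<open>f\<close>. Induction replaces the coupling.\<close>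

lemma subset_exp_two_rounds:
  assumes "finite S" and "\<And>X Y. X \<subseteq> Y \<Longrightarrow> Y \<subseteq> S \<Longrightarrow> f Y \<le> f X"
    and p: "0 \<le> p1" "p1 \<le> 1" "0 \<le> p2" "p2 \<le> 1" "p \<le> 1" "p1 + p2 - p1 * p2 \<le> p"
  shows "subset_exp S p f \<le> subset_exp S p1 (\<lambda>X. subset_exp S p2 (\<lambda>Y. f (X \<union> Y)))"
  using assms(1,2)
proof (induction S arbitrary: f rule: finite_induct)
  case (insert a S)
  have p0: "0 \<le> p"
  proof -
    have "p1 * p2 \<le> p1" using p by (simp add: mult_left_le)
    then show ?thesis using p by linarith
  qed
  let ?f1 = "\<lambda>X. f (insert a X)"
  let ?B = "\<lambda>f. subset_exp S p1 (\<lambda>X. subset_exp S p2 (\<lambda>Y. f (X \<union> Y)))"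
  have IH: "subset_exp S p f \<le> ?B f" "subset_exp S p ?f1 \<le> ?B ?f1"
    by (intro insert.IH insert.prems; auto)+
  have "subset_exp S p ?f1 \<le> subset_exp S p f"
    using p0 p by (intro subset_exp_mono insert.prems) auto
  then have "(p - (p1 + p2 - p1 * p2)) * subset_exp S p ?f1 \<le> (p - (p1 + p2 - p1 * p2)) * subset_exp S p f"
    using p by (intro mult_left_mono) auto
  then have "subset_exp (insert a S) p f
      \<le> (p1 + p2 - p1 * p2) * subset_exp S p ?f1 + (1 - (p1 + p2 - p1 * p2)) * subset_exp S p f"
    unfolding subset_exp_insert[OF insert.hyps] by (simp add: algebra_simps)
  also have "\<dots> \<le> (p1 + p2 - p1 * p2) * ?B ?f1 + (1 - (p1 + p2 - p1 * p2)) * ?B f"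
  proof (intro add_mono mult_left_mono IH)
    show "0 \<le> p1 + p2 - p1 * p2" using p mult_left_le[of p2 p1] by linarith
    have "0 \<le> (1 - p1) * (1 - p2)" using p by simp
    then show "0 \<le> 1 - (p1 + p2 - p1 * p2)" by (simp add: algebra_simps)
  qed
  also have "\<dots> = subset_exp (insert a S) p1 (\<lambda>X. subset_exp (insert a S) p2 (\<lambda>Y. f (X \<union> Y)))"
    unfolding subset_exp_insert[OF insert.hyps]
    by (simp only: Un_insert_left Un_insert_right insert_absorb2 subset_exp_add subset_exp_cmult)
      (simp add: algebra_simps)
  finally show ?case .
qed simp

text \<open>The probability generating function of a binomial variable, prepared for a Chernoff
  bound on the lower tail.\<close>

lemma subset_exp_power_card:
  assumes "finite S"
  shows "subset_exp S p (\<lambda>X. x ^ card (X \<inter> T)) = (1 - p + p * x) ^ card (S \<inter> T)"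
  using assms
proof (induction S rule: finite_induct)
  case (insert a S)
  show ?case
  proof (cases "a \<in> T")
    case True
    have "subset_exp S p (\<lambda>X. x ^ card (insert a X \<inter> T)) = subset_exp S p (\<lambda>X. x * x ^ card (X \<inter> T))"
    proof (rule subset_exp_cong)
      fix X assume "X \<subseteq> S"
      then have "a \<notin> X" "finite X" using insert.hyps finite_subset by auto
      then show "x ^ card (insert a X \<inter> T) = x * x ^ card (X \<inter> T)" using True by simp
    qed
    then show ?thesis using True insert
      by (simp add: subset_exp_insert subset_exp_cmult algebra_simps)
  next
    case False
    then show ?thesis using insert by (simp add: subset_exp_insert algebra_simps)
  qed
qed simp

lemma prob_random_subset:
  assumes S: "finite S" and p: "0 \<le> p" "p \<le> 1"
  shows "measure_pmf.prob (Pi_pmf S False (\<lambda>_. bernoulli_pmf p)) {\<omega>. P {e \<in> S. \<omega> e}}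
    = subset_exp S p (\<lambda>X. if P X then 1 else 0)"
proof -
  let ?M = "Pi_pmf S False (\<lambda>_. bernoulli_pmf p)"
  let ?N = "map_pmf (\<lambda>\<omega>. {e \<in> S. \<omega> e}) ?M"
  have pmf_N: "pmf ?N X = p ^ card X * (1 - p) ^ card (S - X)" if X: "X \<subseteq> S" for X
  proof -
    have "pmf ?N X = measure_pmf.prob ?M ({\<omega>. {e \<in> S. \<omega> e} = X} \<inter> set_pmf ?M)"
      by (simp add: pmf_map vimage_def measure_Int_set_pmf)
    also have "{\<omega>. {e \<in> S. \<omega> e} = X} \<inter> set_pmf ?M = {\<lambda>e. e \<in> X} \<inter> set_pmf ?M"
      using set_Pi_pmf_subset[OF S, of False "\<lambda>_. bernoulli_pmf p"] X by (auto intro!: ext)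
    also have "measure_pmf.prob ?M \<dots> = pmf ?M (\<lambda>e. e \<in> X)"
      by (simp add: measure_Int_set_pmf measure_pmf_single)
    also have "\<dots> = (\<Prod>e\<in>S. if e \<in> X then p else 1 - p)"
      using X S p by (subst pmf_Pi) (auto intro!: prod.cong)
    also have "\<dots> = p ^ card X * (1 - p) ^ card (S - X)"
      using S X by (simp add: prod.If_cases Int_absorb1 Diff_eq)
    finally show ?thesis .
  qed
  have "measure_pmf.prob ?M {\<omega>. P {e \<in> S. \<omega> e}} = measure_pmf.prob ?N {X. P X}"
    by (simp add: vimage_def)
  also have "\<dots> = measure_pmf.prob ?N ({X. P X} \<inter> Pow S)"
    by (rule measure_pmf.finite_measure_eq_AE) (auto simp: AE_measure_pmf_iff)
  also have "\<dots> = (\<Sum>X\<in>{X. P X} \<inter> Pow S. pmf ?N X)"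
    using S by (intro measure_measure_pmf_finite) auto
  also have "\<dots> = (\<Sum>X\<in>Pow S. if P X then pmf ?N X else 0)"
    using S by (simp add: sum.If_cases Int_commute)
  also have "\<dots> = subset_exp S p (\<lambda>X. if P X then 1 else 0)"
    unfolding subset_exp_def by (intro sum.cong refl) (auto simp: pmf_N)
  finally show ?thesis .
qed

section \<open>The random graph\<close>

lemma card_mult_le_sum:
  fixes h :: "'e \<Rightarrow> real"
  assumes "finite S" "T \<subseteq> S" "\<And>e. e \<in> S \<Longrightarrow> 0 \<le> h e" "\<And>e. e \<in> T \<Longrightarrow> c \<le> h e"
  shows "real (card T) * c \<le> sum h S"
proof -
  have "real (card T) * c = (\<Sum>e\<in>T. c)" by simp
  also have "\<dots> \<le> sum h T" by (intro sum_mono assms(4))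
  also have "\<dots> \<le> sum h S" using assms by (intro sum_mono2) auto
  finally show ?thesis .
qed

lemma exp_minus_le_linear:
  fixes y :: real
  assumes "0 \<le> y" "y \<le> 1"
  shows "exp (- y) \<le> 1 - y / 2"
proof -
  have "y * y \<le> y" using assms by (simp add: mult_left_le)
  then have "1 \<le> (1 - y / 2) * (1 + y)" by (simp add: algebra_simps)
  also have "\<dots> \<le> (1 - y / 2) * exp y" using assms by (intro mult_left_mono exp_ge_add_one_self) auto
  finally show ?thesis by (simp add: exp_minus field_simps)
qed

text \<open>The square root drops by at least 1 / (2 * sqrt k), so the exponent drops by at least y
  = 1 / sqrt k, and exp (- y) is at most 1 - y / 2 as y \<le> 1.\<close>

lemma exp_sqrt_decrease:
  assumes "1 \<le> k"
  shows "exp (2 * sqrt (real k - 1)) \<le> exp (2 * sqrt (real k)) * (1 - 1 / (2 * sqrt (real k)))"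
proof -
  have k: "1 \<le> sqrt (real k)" using assms by simp
  have "sqrt (real k - 1) \<le> sqrt (real k) - 1 / (2 * sqrt (real k))"
  proof (rule real_le_lsqrt)
    show "0 \<le> sqrt (real k) - 1 / (2 * sqrt (real k))"
    proof -
      have "1 / (2 * sqrt (real k)) \<le> 1" using k by (subst divide_le_eq_1) linarith
      then show ?thesis using k by linarith
    qed
    have "(sqrt (real k) - 1 / (2 * sqrt (real k)))\<^sup>2 = real k - 1 + (1 / (2 * sqrt (real k)))\<^sup>2"
      using k by (simp add: power2_diff field_simps)
    then show "real k - 1 \<le> (sqrt (real k) - 1 / (2 * sqrt (real k)))\<^sup>2" by simp
  qed
  then have "exp (2 * sqrt (real k - 1)) \<le> exp (2 * sqrt (real k) + - (1 / sqrt (real k)))"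
    by simp
  also have "\<dots> = exp (2 * sqrt (real k)) * exp (- (1 / sqrt (real k)))" by (rule exp_add)
  also have "\<dots> \<le> exp (2 * sqrt (real k)) * (1 - (1 / sqrt (real k)) / 2)"
    using k by (intro mult_left_mono exp_minus_le_linear) auto
  finally show ?thesis by (simp add: mult.commute)
qed

lemma sum_Pow_power_card:
  fixes y :: real
  assumes "finite V"
  shows "(\<Sum>W\<in>Pow V. y ^ card W) = (1 + y) ^ card V"
  using assms
proof (induction V rule: finite_induct)
  case (insert a V)
  have fin: "finite W" if "W \<subseteq> V" for W using that insert.hyps finite_subset by blast
  have "(\<Sum>W\<in>Pow (insert a V). y ^ card W) = (\<Sum>W\<in>Pow V. y ^ card W) + (\<Sum>W\<in>insert a ` Pow V. y ^ card W)"
    unfolding Pow_insert using insert.hyps by (intro sum.union_disjoint) auto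
  also have "(\<Sum>W\<in>insert a ` Pow V. y ^ card W) = (\<Sum>W\<in>Pow V. y ^ card (insert a W))"
    using insert.hyps by (intro sum.reindex_cong[of "insert a"]) (auto simp: inj_on_def)
  also have "\<dots> = (\<Sum>W\<in>Pow V. y * y ^ card W)"
  proof (intro sum.cong refl)
    fix W assume "W \<in> Pow V"
    then have "a \<notin> W" "finite W" using insert.hyps fin by auto
    then show "y ^ card (insert a W) = y * y ^ card W" by simp
  qed
  finally show ?case using insert by (simp add: algebra_simps flip: sum_distrib_left)
qed simp

section \<open>Growth of the closure in two phases\<close>

context generic_framework
begin

text \<open>While \<open>m\<close> pairs are missing, each of them lowers the defect by at least 1
  and so at least halves its exponential. The decay rate is \<open>m / 2\<close>, and the initial
  defect is at most \<open>d * card V\<close>.\<close>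

lemma prob_many_missing_pairs:
  assumes d: "d \<le> card V" and m: "0 \<le> m" and q: "0 \<le> q" "q \<le> 1"
  shows "subset_exp (vertex_pairs V) q (\<lambda>X. if m \<le> real (card (vertex_pairs V - cl X)) then 1 else 0)
    \<le> exp (real d * real (card V) - m * q / 2)"
proof -
  let ?S = "vertex_pairs V"
  have finS: "finite ?S" using finite_vertex_pairs[OF finite_V] .
  let ?bad = "\<lambda>X. m \<le> real (card (?S - cl X))"
  \<comment> \<open>The event of many missing pairs passes to subsets of the edge set, so cutting
    off by 0 keeps \<open>f\<close> decreasing.\<close>
  define f where "f X = (if ?bad X then exp (real (defect d p V X)) else 0)" for X
  have bad_anti: "?bad X" if "?bad Y" "X \<subseteq> Y" for X Y
  proof -
    have "card (?S - cl Y) \<le> card (?S - cl X)"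
      using finS rcl_mono[OF that(2), of d p] by (intro card_mono) auto
    then show ?thesis using that(1) by linarith
  qed
  have anti: "f Y \<le> f X" if "X \<subseteq> Y" for X Y
    using bad_anti[of Y X] that defect_antimono[OF finite_V that, of d p] by (auto simp: f_def)
  have "subset_exp ?S q (\<lambda>X. if ?bad X then 1 else 0) \<le> subset_exp ?S q f"
    using q by (intro subset_exp_mono) (auto simp: f_def)
  also have "\<dots> \<le> exp (- (m / 2) * q) * f {}"
  proof (rule subset_exp_le_exp[OF finS anti _ q])
    fix X assume "X \<subseteq> ?S"
    show "m / 2 * f X \<le> (\<Sum>e\<in>?S. f X - f (insert e X))"
    proof (cases "?bad X")
      case True
      have "m / 2 * f X \<le> real (card (?S - cl X)) * (f X / 2)"
        using True m mult_right_mono[OF True, of "f X / 2"] by (simp add: f_def)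
      also have "\<dots> \<le> (\<Sum>e\<in>?S. f X - f (insert e X))"
      proof (rule card_mult_le_sum[OF finS])
        show "0 \<le> f X - f (insert e X)" for e using anti[of X "insert e X"] by auto
        fix e assume e: "e \<in> ?S - cl X"
        then have "real (defect d p V (insert e X)) + 1 \<le> real (defect d p V X)"
          using defect_insert_less[OF finite_V, of e d p X] by simp
        then have "f (insert e X) \<le> exp (real (defect d p V X) + - 1)"
          by (simp add: f_def)
        also have "\<dots> = f X * exp (- 1)" using True unfolding exp_add by (simp add: f_def)
        also have "\<dots> \<le> f X * (1 - 1 / 2)"
          using exp_minus_le_linear[of 1] by (intro mult_left_mono) (auto simp: f_def)
        finally show "f X / 2 \<le> f X - f (insert e X)" by simp
      qed auto
      finally show ?thesis .
    next
      case False
      then have "f (insert e X) = 0" for e using bad_anti[of "insert e X" X] by (auto simp: f_def)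
      then show ?thesis using False by (simp add: f_def)
    qed
  qed
  also have "\<dots> \<le> exp (- (m / 2) * q) * exp (real d * real (card V))"
  proof (intro mult_left_mono)
    have "real (defect d p V {}) \<le> real (d * card V)"
      using defect_empty_le[OF order_refl d] by (rule of_nat_mono)
    then show "f {} \<le> exp (real d * real (card V))" by (auto simp: f_def)
  qed simp
  also have "\<dots> = exp (real d * real (card V) - m * q / 2)"
    by (simp flip: exp_add add: algebra_simps)
  finally show ?thesis .
qed

text \<open>At defect k there are at least N^2 * sqrt k / (23 * d) missing pairs, each lowering the
  potential by a proportion of at least 1 / (2 * sqrt k). The product is a rate independent of
  k.\<close>

lemma prob_incomplete_closure:
  assumes U: "U \<subseteq> V" and d: "1 \<le> d" "64 * d \<le> card U" and q: "0 \<le> q" "q \<le> 1"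
    and deg: "\<And>u. u \<in> U \<Longrightarrow> 16 * card {v \<in> U. {v, u} \<in> vertex_pairs U - cl X0} \<le> card U"
  shows "subset_exp (vertex_pairs V) q (\<lambda>X. if vertex_pairs U \<subseteq> cl (X0 \<union> X) then 0 else 1)
    \<le> exp (2 * sqrt (real d * real (card U)) - (real (card U))\<^sup>2 * q / (46 * real d))"
proof -
  let ?S = "vertex_pairs V"
  have finS: "finite ?S" using finite_vertex_pairs[OF finite_V] .
  have finU: "finite U" using U finite_V finite_subset by blast
  define N where "N = real (card U)"
  have N: "N > 0" using d by (simp add: N_def)
  define k where "k X = defect d p U (X0 \<union> X)" for X
  \<comment> \<open>At defect 0 the value 0 makes the decay condition trivial; at any other defect
    the value is at least 1, so the indicator of incompleteness is dominated.\<close>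
  define \<phi> where "\<phi> j = (if j = 0 then 0 else exp (2 * sqrt (real j)))" for j :: nat
  have \<phi>_mono: "\<phi> i \<le> \<phi> j" if "i \<le> j" for i j using that by (auto simp: \<phi>_def)
  have \<phi>_nonneg: "0 \<le> \<phi> j" for j by (simp add: \<phi>_def)
  have k_anti: "k Y \<le> k X" if "X \<subseteq> Y" for X Y
    unfolding k_def using that by (intro defect_antimono finU) auto
  have k0: "k X = 0 \<longleftrightarrow> vertex_pairs U \<subseteq> cl (X0 \<union> X)" for X
    unfolding k_def by (rule defect_eq_0_iff[OF finU])
  have "subset_exp ?S q (\<lambda>X. if vertex_pairs U \<subseteq> cl (X0 \<union> X) then 0 else 1) \<le> subset_exp ?S q (\<lambda>X. \<phi> (k X))"
    using q by (intro subset_exp_mono) (auto simp: \<phi>_def k0)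
  also have "\<dots> \<le> exp (- (N\<^sup>2 / (46 * real d)) * q) * \<phi> (k {})"
  proof (rule subset_exp_le_exp[OF finS _ _ q])
    show "\<phi> (k Y) \<le> \<phi> (k X)" if "X \<subseteq> Y" for X Y using \<phi>_mono k_anti that by blast
    fix X assume "X \<subseteq> ?S"
    show "N\<^sup>2 / (46 * real d) * \<phi> (k X) \<le> (\<Sum>e\<in>?S. \<phi> (k X) - \<phi> (k (insert e X)))"
    proof (cases "k X = 0")
      case True
      then have "k (insert e X) = 0" for e using k_anti[of X "insert e X"] by auto
      then show ?thesis using True by (simp add: \<phi>_def)
    next
      case False
      let ?T = "vertex_pairs U - cl (X0 \<union> X)"
      have "real (k X) \<le> 512 * (real d)\<^sup>2 * (real (card ?T))\<^sup>2 / N ^ 4"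
        unfolding k_def N_def
      proof (rule defect_le_missing_pairs[OF U d])
        fix u assume u: "u \<in> U"
        have "card {v \<in> U. {v, u} \<in> ?T} \<le> card {v \<in> U. {v, u} \<in> vertex_pairs U - cl X0}"
          using finU rcl_mono[of X0 "X0 \<union> X" d p] by (intro card_mono) auto
        then show "16 * card {v \<in> U. {v, u} \<in> ?T} \<le> card U" using deg[OF u] by linarith
      qed
      \<comment> \<open>The constant 512 is rounded up to the square of 23.\<close>
      also have "\<dots> \<le> 529 * (real d)\<^sup>2 * (real (card ?T))\<^sup>2 / N ^ 4"
        by (intro divide_right_mono mult_right_mono) auto
      also have "\<dots> = (23 * real d * real (card ?T) / N\<^sup>2)\<^sup>2"
        by (simp add: power_divide power_mult_distrib)
      finally have "sqrt (real (k X)) \<le> 23 * real d * real (card ?T) / N\<^sup>2"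
        by (intro real_le_lsqrt) auto
      then have T: "N\<^sup>2 / (46 * real d) \<le> real (card ?T) * (1 / (2 * sqrt (real (k X))))"
        using N d False by (simp add: field_simps)
      have "N\<^sup>2 / (46 * real d) * \<phi> (k X) \<le> real (card ?T) * (1 / (2 * sqrt (real (k X)))) * \<phi> (k X)"
        using T \<phi>_nonneg by (rule mult_right_mono)
      also have "\<dots> = real (card ?T) * (\<phi> (k X) * (1 / (2 * sqrt (real (k X)))))" by simp
      also have "\<dots> \<le> (\<Sum>e\<in>?S. \<phi> (k X) - \<phi> (k (insert e X)))"
      proof (rule card_mult_le_sum[OF finS])
        show "?T \<subseteq> ?S" using vertex_pairs_mono[OF U] by blast
        show "0 \<le> \<phi> (k X) - \<phi> (k (insert e X))" for e using \<phi>_mono[OF k_anti[of X "insert e X"]] by auto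
        fix e assume "e \<in> ?T"
        then have "k (insert e X) + 1 \<le> k X"
          using defect_insert_less[OF finU, of e d p "X0 \<union> X"] by (simp add: k_def)
        then have "\<phi> (k (insert e X)) \<le> \<phi> (k X - 1)" by (intro \<phi>_mono) simp
        also have "\<dots> \<le> exp (2 * sqrt (real (k X) - 1))" using False by (auto simp: \<phi>_def)
        also have "\<dots> \<le> \<phi> (k X) * (1 - 1 / (2 * sqrt (real (k X))))"
          using exp_sqrt_decrease[of "k X"] False by (simp add: \<phi>_def)
        finally show "\<phi> (k X) * (1 / (2 * sqrt (real (k X)))) \<le> \<phi> (k X) - \<phi> (k (insert e X))"
          by (simp add: algebra_simps)
      qed
      finally show ?thesis .
    qed
  qed
  also have "\<dots> \<le> exp (- (N\<^sup>2 / (46 * real d)) * q) * exp (2 * sqrt (real d * N))"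
  proof (intro mult_left_mono)
    have "k {} \<le> defect d p U {}" unfolding k_def by (rule defect_antimono[OF finU]) simp
    also have "\<dots> \<le> d * card U" by (rule defect_empty_le[OF U]) (use d in simp)
    finally have "real (k {}) \<le> real d * N" by (metis N_def of_nat_mono of_nat_mult)
    then show "\<phi> (k {}) \<le> exp (2 * sqrt (real d * N))" by (auto simp: \<phi>_def)
  qed simp
  also have "\<dots> = exp (2 * sqrt (real d * N) - N\<^sup>2 * q / (46 * real d))"
    by (simp flip: exp_add)
  finally show ?thesis by (simp add: N_def)
qed

end

text \<open>A set of vertices at which extending a complete subset of the closure one vertex at a time
  can get stuck.\<close>

definition stuck_set :: "nat \<Rightarrow> 'a set \<Rightarrow> 'a set set \<Rightarrow> 'a set \<Rightarrow> bool" where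
  "stuck_set d V X W \<longleftrightarrow> W \<noteq> {} \<and> W \<subseteq> V \<and> (\<forall>w\<in>W. card {x \<in> V - W. {w, x} \<in> X} < d)"

text \<open>A stuck \<open>W\<close> sends at most \<open>d * card W\<close> edges to its
  complement, which has at least \<open>(1 - \<gamma>) * n\<close> vertices. A Chernoff bound with
  parameter \<open>z\<close> gives probability at most \<open>y ^ card W\<close>, and the binomial
  theorem sums this over all nonempty \<open>W\<close>.\<close>

lemma prob_stuck_set:
  fixes V :: "'a set" and d :: nat and z \<gamma> r :: real
  assumes V: "finite V" and z: "0 < z" "z \<le> 1" and r: "0 \<le> r" "r \<le> 1"
  defines "n \<equiv> real (card V)"
  defines "y \<equiv> exp (real d * ln (1 / z) - r * (1 - z) * (1 - \<gamma>) * n)"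
  shows "subset_exp (vertex_pairs V) r (\<lambda>X. if \<exists>W. stuck_set d V X W \<and> real (card W) \<le> \<gamma> * n then 1 else 0)
    \<le> exp (n * y) - 1"
proof -
  let ?S = "vertex_pairs V"
  define \<W> where "\<W> = {W \<in> Pow V. W \<noteq> {} \<and> real (card W) \<le> \<gamma> * n}"
  have fin\<W>: "finite \<W>" using V by (simp add: \<W>_def)
  define T where "T W = (\<lambda>(w, x). {w, x}) ` (W \<times> (V - W))" for W :: "'a set"
  have TS: "T W \<subseteq> ?S" if "W \<subseteq> V" for W using that by (auto simp: T_def)
  have one: "subset_exp ?S r (\<lambda>X. if stuck_set d V X W then 1 else 0) \<le> y ^ card W" if W: "W \<in> \<W>" for W
  proof -
    have WV: "W \<subseteq> V" and Wn: "real (card W) \<le> \<gamma> * n" using W by (auto simp: \<W>_def)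
    have finW: "finite W" using WV V finite_subset by blast
    have card_T: "card (T W) = card W * card (V - W)"
    proof -
      have "inj_on (\<lambda>(w, x). {w, x}) (W \<times> (V - W))" by (auto simp: inj_on_def doubleton_eq_iff)
      then show ?thesis unfolding T_def by (simp add: card_image card_cartesian_product)
    qed
    have ind: "(if stuck_set d V X W then 1 else 0) \<le> (1 / z) ^ (d * card W) * z ^ card (X \<inter> T W)" if "X \<subseteq> ?S" for X
    proof (cases "stuck_set d V X W")
      case True
      let ?N = "\<lambda>w. {x \<in> V - W. {w, x} \<in> X}"
      have "X \<inter> T W \<subseteq> (\<Union>w\<in>W. (\<lambda>x. {w, x}) ` ?N w)" by (auto simp: T_def)
      then have "card (X \<inter> T W) \<le> card (\<Union>w\<in>W. (\<lambda>x. {w, x}) ` ?N w)"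
        using V finW by (intro card_mono) auto
      also have "\<dots> \<le> (\<Sum>w\<in>W. card ((\<lambda>x. {w, x}) ` ?N w))" using finW by (rule card_UN_le)
      also have "\<dots> \<le> (\<Sum>w\<in>W. d)"
      proof (rule sum_mono)
        fix w assume "w \<in> W"
        then have "card (?N w) < d" using True by (simp add: stuck_set_def)
        moreover have "card ((\<lambda>x. {w, x}) ` ?N w) \<le> card (?N w)" using V by (intro card_image_le) simp
        ultimately show "card ((\<lambda>x. {w, x}) ` ?N w) \<le> d" by linarith
      qed
      finally have "card (X \<inter> T W) \<le> d * card W" by (simp add: mult.commute)
      then have "z ^ (d * card W) \<le> z ^ card (X \<inter> T W)" using z by (intro power_decreasing) auto
      then have "(1 / z) ^ (d * card W) * z ^ (d * card W) \<le> (1 / z) ^ (d * card W) * z ^ card (X \<inter> T W)"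
        using z by (intro mult_left_mono) auto
      then show ?thesis using True z by (simp flip: power_mult_distrib)
    qed (use z in simp)
    have "subset_exp ?S r (\<lambda>X. if stuck_set d V X W then 1 else 0)
        \<le> subset_exp ?S r (\<lambda>X. (1 / z) ^ (d * card W) * z ^ card (X \<inter> T W))"
      using r ind by (intro subset_exp_mono) auto
    also have "\<dots> = (1 / z) ^ (d * card W) * (1 - r + r * z) ^ card (T W)"
      using TS[OF WV] by (simp add: subset_exp_cmult subset_exp_power_card finite_vertex_pairs[OF V] Int_absorb1)
    also have "\<dots> \<le> (1 / z) ^ (d * card W) * exp (- (r * (1 - z))) ^ card (T W)"
    proof (intro mult_left_mono power_mono)
      show "1 - r + r * z \<le> exp (- (r * (1 - z)))"
        using exp_ge_add_one_self[of "- (r * (1 - z))"] by (simp add: algebra_simps)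
      show "0 \<le> 1 - r + r * z" using r z by simp
    qed (use z in simp)
    also have "\<dots> = exp (real (d * card W) * ln (1 / z)) * exp (real (card (T W)) * (- (r * (1 - z))))"
      unfolding exp_of_nat_mult using z by simp
    also have "\<dots> = exp (real (d * card W) * ln (1 / z) - real (card (T W)) * (r * (1 - z)))"
      by (simp flip: exp_add)
    also have "\<dots> \<le> exp (real (card W) * (real d * ln (1 / z) - r * (1 - z) * (1 - \<gamma>) * n))"
    proof -
      have "real (card (V - W)) = n - real (card W)"
        using WV V finW by (simp add: n_def card_Diff_subset card_mono of_nat_diff)
      then have "(1 - \<gamma>) * n \<le> real (card (V - W))" using Wn by (simp add: algebra_simps)
      then have "real (card W) * (r * (1 - z)) * ((1 - \<gamma>) * n) \<le> real (card W) * (r * (1 - z)) * real (card (V - W))"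
        using r z by (intro mult_left_mono) auto
      then show ?thesis by (simp add: card_T algebra_simps)
    qed
    also have "\<dots> = y ^ card W" unfolding y_def by (rule exp_of_nat_mult)
    finally show ?thesis .
  qed
  have "subset_exp ?S r (\<lambda>X. if \<exists>W. stuck_set d V X W \<and> real (card W) \<le> \<gamma> * n then 1 else 0)
      \<le> subset_exp ?S r (\<lambda>X. \<Sum>W\<in>\<W>. if stuck_set d V X W then 1 else 0)"
  proof (rule subset_exp_mono[OF r])
    fix X
    show "(if \<exists>W. stuck_set d V X W \<and> real (card W) \<le> \<gamma> * n then 1 else 0) \<le> (\<Sum>W\<in>\<W>. if stuck_set d V X W then 1 else 0 :: real)"
    proof (cases "\<exists>W. stuck_set d V X W \<and> real (card W) \<le> \<gamma> * n")
      case True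
      then obtain W where W: "stuck_set d V X W" "real (card W) \<le> \<gamma> * n" by blast
      then have "W \<in> \<W>" by (auto simp: \<W>_def stuck_set_def)
      then have "(if stuck_set d V X W then 1 else 0) \<le> (\<Sum>W\<in>\<W>. if stuck_set d V X W then 1 else 0 :: real)"
        using fin\<W> by (intro member_le_sum) auto
      then show ?thesis using W(1) by (simp del: sum.If_cases)
    next
      case False
      then show ?thesis by (auto intro: sum_nonneg)
    qed
  qed
  also have "\<dots> = (\<Sum>W\<in>\<W>. subset_exp ?S r (\<lambda>X. if stuck_set d V X W then 1 else 0))"
    by (rule subset_exp_sum)
  also have "\<dots> \<le> (\<Sum>W\<in>\<W>. y ^ card W)" by (intro sum_mono one)
  also have "\<dots> \<le> (\<Sum>W\<in>Pow V - {{}}. y ^ card W)"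
    using V by (intro sum_mono2) (auto simp: \<W>_def y_def)
  also have "\<dots> = (1 + y) ^ card V - 1"
    using V sum_Pow_power_card[OF V, of y] by (simp add: sum_diff1)
  also have "\<dots> \<le> exp y ^ card V - 1"
    by (intro diff_right_mono power_mono exp_ge_add_one_self) (simp add: y_def)
  also have "\<dots> = exp (n * y) - 1" by (simp add: n_def exp_of_nat_mult)
  finally show ?thesis .
qed

section \<open>From a large complete set to all vertices\<close>

context generic_framework
begin

text \<open>Two independent rounds of density \<open>r / 2\<close>: the first leaves few missing
  pairs and thereby determines a large set \<open>U\<close> of vertices with few missing neighbours;
  the second completes \<open>U\<close>.\<close>

lemma prob_no_large_complete_set:
  fixes r \<gamma> :: real
  defines "n \<equiv> real (card V)"
  assumes d: "1 \<le> d" "128 * d \<le> card V" and r: "0 \<le> r" "r \<le> 1" and \<gamma>: "0 < \<gamma>" "\<gamma> \<le> 1 / 2"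
  shows "subset_exp (vertex_pairs V) r
      (\<lambda>X. if \<exists>U\<subseteq>V. real (card (V - U)) \<le> \<gamma> * n \<and> vertex_pairs U \<subseteq> cl X then 0 else 1)
    \<le> exp (real d * n - \<gamma> * n\<^sup>2 * r / 256) + exp (2 * sqrt (real d * n) - n\<^sup>2 * r / (368 * real d))"
    (is "subset_exp ?S r (\<lambda>X. if ?large X then 0 else 1) \<le> ?e1 + ?e2")
proof -
  have finS: "finite ?S" using finite_vertex_pairs[OF finite_V] .
  have n: "n > 0" using d by (simp add: n_def)
  \<comment> \<open>With fewer than \<open>m\<close> missing pairs, at most
    \<open>\<gamma> * n\<close> vertices have more than \<open>n / 32\<close> missing
    neighbours.\<close>
  define m where "m = \<gamma> * n\<^sup>2 / 64"
  have inner: "subset_exp ?S (r / 2) (\<lambda>Y. if ?large (X \<union> Y) then 0 else 1)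
      \<le> (if m \<le> real (card (?S - cl X)) then 1 else 0) + ?e2" for X
  proof (cases "m \<le> real (card (?S - cl X))")
    case True
    have "subset_exp ?S (r / 2) (\<lambda>Y. if ?large (X \<union> Y) then 0 else 1) \<le> subset_exp ?S (r / 2) (\<lambda>_. 1)"
      using r by (intro subset_exp_mono) auto
    then show ?thesis using True by (simp add: subset_exp_const[OF finS] add_increasing2)
  next
    case False
    let ?M = "?S - cl X"
    define miss where "miss v = {u. {v, u} \<in> ?M}" for v
    \<comment> \<open>The factor is 32 rather than 16 because \<open>U\<close> is only known to
      contain half of the vertices.\<close>
    define U where "U = {v \<in> V. 32 * card (miss v) \<le> card V}"
    have UV: "U \<subseteq> V" by (auto simp: U_def)
    have finU: "finite U" using UV finite_V finite_subset by blast
    have fin_miss: "finite (miss v)" for v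
      using finite_V by (rule finite_subset[rotated]) (auto simp: miss_def)
    have "card (V - U) * card V = (\<Sum>v\<in>V - U. card V)" by simp
    also have "\<dots> \<le> (\<Sum>v\<in>V - U. 32 * card (miss v))" by (intro sum_mono) (auto simp: U_def)
    also have "\<dots> \<le> (\<Sum>v\<in>V. 32 * card (miss v))" using finite_V by (intro sum_mono2) auto
    also have "\<dots> \<le> (\<Sum>v\<in>V. 32 * card {e \<in> ?M. v \<in> e})"
      unfolding miss_def using finS by (intro sum_mono mult_le_mono2 card_neighbours_le_incident) auto
    also have "\<dots> = 64 * card ?M"
      using sum_card_incident[OF finite_V, of ?M] by (simp flip: sum_distrib_left)
    finally have "real (card (V - U) * card V) \<le> real (64 * card ?M)" by (rule of_nat_mono)
    then have "real (card (V - U)) * n \<le> 64 * real (card ?M)" by (simp add: n_def)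
    also have "\<dots> \<le> (\<gamma> * n) * n" using False by (simp add: m_def power2_eq_square)
    finally have VU: "real (card (V - U)) \<le> \<gamma> * n" using n by simp
    also have "\<dots> \<le> 1 / 2 * n" using \<gamma> n by (intro mult_right_mono) auto
    finally have half: "n \<le> 2 * real (card U)"
      using UV finite_V card_mono[OF finite_V UV] finU by (simp add: n_def card_Diff_subset of_nat_diff)
    then have half': "card V \<le> 2 * card U" by (simp add: n_def)
    have "subset_exp ?S (r / 2) (\<lambda>Y. if ?large (X \<union> Y) then 0 else 1)
        \<le> subset_exp ?S (r / 2) (\<lambda>Y. if vertex_pairs U \<subseteq> cl (X \<union> Y) then 0 else 1)"
      using r UV VU by (intro subset_exp_mono) auto
    also have "\<dots> \<le> exp (2 * sqrt (real d * real (card U)) - (real (card U))\<^sup>2 * (r / 2) / (46 * real d))"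
    proof (rule prob_incomplete_closure[OF UV d(1)])
      fix u assume u: "u \<in> U"
      have "card {v \<in> U. {v, u} \<in> vertex_pairs U - cl X} \<le> card (miss u)"
        using UV by (intro card_mono[OF fin_miss]) (auto simp: miss_def insert_commute)
      then show "16 * card {v \<in> U. {v, u} \<in> vertex_pairs U - cl X} \<le> card U"
        using u half' by (auto simp: U_def)
    qed (use d half' r in auto)
    \<comment> \<open>Half the density and at least half the vertices cost a factor 8, hence 368 = 8
      * 46.\<close>
    also have "\<dots> \<le> ?e2"
    proof -
      have "real (card U) \<le> n" using card_mono[OF finite_V UV] by (simp add: n_def)
      then have "2 * sqrt (real d * real (card U)) \<le> 2 * sqrt (real d * n)" by (simp add: mult_left_mono)
      moreover have "n\<^sup>2 * r / (368 * real d) \<le> (real (card U))\<^sup>2 * (r / 2) / (46 * real d)"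
      proof -
        have "n\<^sup>2 \<le> (2 * real (card U))\<^sup>2" using half n by (intro power_mono) auto
        then have "n\<^sup>2 * r \<le> (2 * real (card U))\<^sup>2 * r" using r by (intro mult_right_mono) auto
        then have "n\<^sup>2 * r / (368 * real d) \<le> (2 * real (card U))\<^sup>2 * r / (368 * real d)"
          by (intro divide_right_mono) auto
        also have "\<dots> = (real (card U))\<^sup>2 * (r / 2) / (46 * real d)"
          using d by (simp add: power2_eq_square field_simps)
        finally show ?thesis .
      qed
      ultimately show ?thesis by (subst exp_le_cancel_iff) linarith
    qed
    finally show ?thesis using False by simp
  qed
  have "r / 2 + r / 2 - r / 2 * (r / 2) \<le> r" using r by simp
  then have "subset_exp ?S r (\<lambda>X. if ?large X then 0 else 1)
      \<le> subset_exp ?S (r / 2) (\<lambda>X. subset_exp ?S (r / 2) (\<lambda>Y. if ?large (X \<union> Y) then 0 else 1))"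
  proof (intro subset_exp_two_rounds[OF finS])
    fix X Y :: "'a set set" assume "X \<subseteq> Y"
    then have "?large Y" if "?large X" using that rcl_mono[of X Y d p] by blast
    then show "(if ?large Y then 0 else 1) \<le> (if ?large X then 0 else (1::real))" by auto
  qed (use r in auto)
  also have "\<dots> \<le> subset_exp ?S (r / 2) (\<lambda>X. (if m \<le> real (card (?S - cl X)) then 1 else 0) + ?e2)"
    using r inner by (intro subset_exp_mono) auto
  also have "\<dots> = subset_exp ?S (r / 2) (\<lambda>X. if m \<le> real (card (?S - cl X)) then 1 else 0) + ?e2"
    by (simp only: subset_exp_add subset_exp_const[OF finS])
  also have "subset_exp ?S (r / 2) (\<lambda>X. if m \<le> real (card (?S - cl X)) then 1 else 0)
      \<le> exp (real d * real (card V) - m * (r / 2) / 2)"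
    using d r \<gamma> by (intro prob_many_missing_pairs) (auto simp: m_def)
  also have "real d * real (card V) - m * (r / 2) / 2 = real d * n - \<gamma> * n\<^sup>2 * r / 256"
    by (simp add: m_def n_def)
  finally show ?thesis by simp
qed

text \<open>The complement of a maximal complete \<open>U\<close> is not stuck, so if it were
  nonempty, some vertex in it would have \<open>d\<close> edges into \<open>U\<close>, and a
  zero-extension would contradict maximality.\<close>

lemma complete_if_no_stuck_set:
  assumes "\<exists>U\<subseteq>V. real (card (V - U)) \<le> b \<and> vertex_pairs U \<subseteq> cl X"
    and "\<nexists>W. stuck_set d V X W \<and> real (card W) \<le> b"
  shows "vertex_pairs V \<subseteq> cl X"
proof -
  let ?\<U> = "{U \<in> Pow V. real (card (V - U)) \<le> b \<and> vertex_pairs U \<subseteq> cl X}"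
  have "finite ?\<U>" "?\<U> \<noteq> {}" using finite_V assms(1) by auto
  then obtain U where U: "U \<in> ?\<U>" and max: "\<forall>U'\<in>?\<U>. U \<subseteq> U' \<longrightarrow> U = U'"
    using finite_has_maximal[of ?\<U>] by blast
  have "U = V"
  proof (rule ccontr)
    assume "U \<noteq> V"
    then have ne: "V - U \<noteq> {}" and VU: "V - (V - U) = U" using U by auto
    have "\<not> stuck_set d V X (V - U)" using assms(2) U by blast
    then have "\<exists>w\<in>V - U. \<not> card {x \<in> U. {w, x} \<in> X} < d"
      unfolding stuck_set_def VU using ne by blast
    then obtain w where w: "w \<in> V - U" "d \<le> card {x \<in> U. {w, x} \<in> X}" by auto
    have finU: "finite U" using U finite_V finite_subset by blast
    have "card {x \<in> U. {w, x} \<in> X} \<le> card {x \<in> U. {w, x} \<in> cl X}"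
      using finU rcl_superset[of X d p] by (intro card_mono) auto
    then have "vertex_pairs (insert w U) \<subseteq> cl X" using U w by (intro zero_extension) auto
    moreover have "card (V - insert w U) \<le> card (V - U)" using finite_V by (intro card_mono) auto
    ultimately have "insert w U \<in> ?\<U>" using U w by auto
    then show False using max w by blast
  qed
  then show ?thesis using U by blast
qed

end

section \<open>Assembly and choice of constants\<close>

lemma d_rigid_if_complete:
  assumes "generic_framework d V p" "\<And>v i. d \<le> i \<Longrightarrow> p v i = 0"
    and "E \<subseteq> vertex_pairs V" "vertex_pairs V \<subseteq> rcl d p E"
  shows "d_rigid d (V, E)"
proof -
  interpret generic_framework d V p by fact
  have "rigid d (V, E) p" by (rule rigid_if_complete[OF generic finite_V assms(3,4)])
  moreover have "framework d (V, E) p"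
    using assms(2,3) finite_V by (simp add: framework_def finite_simple_graph_def topspace_Euclidean_space)
  ultimately show ?thesis unfolding d_rigid_def using generic by auto
qed

text \<open>A generic position is fixed before the edges are drawn. Failure then means that there is
  no large complete set or that there is a small stuck set.\<close>

lemma prob_d_rigid_ge:
  fixes r \<gamma> z :: real
  assumes d: "1 \<le> d" "128 * d \<le> n" and r: "0 \<le> r" "r \<le> 1" and \<gamma>: "0 < \<gamma>" "\<gamma> \<le> 1 / 2" and z: "0 < z" "z \<le> 1"
  shows "1 - (exp (real d * real n - \<gamma> * (real n)\<^sup>2 * r / 256)
      + exp (2 * sqrt (real d * real n) - (real n)\<^sup>2 * r / (368 * real d))
      + (exp (real n * exp (real d * ln (1 / z) - r * (1 - z) * (1 - \<gamma>) * real n)) - 1))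
    \<le> measure_pmf.prob (binomial_random_graph n r) {G. d_rigid d G}"
proof -
  let ?V = "{1..n}"
  let ?S = "vertex_pairs ?V"
  obtain p where p: "generic d ?V p" "\<forall>v. \<forall>i\<ge>d. p v i = 0" using generic_exists[of ?V d] by auto
  interpret generic_framework d ?V p by standard (use p in auto)
  have finS: "finite ?S" by (simp add: finite_vertex_pairs)
  define large where "large X \<longleftrightarrow> (\<exists>U\<subseteq>?V. real (card (?V - U)) \<le> \<gamma> * real n \<and> vertex_pairs U \<subseteq> cl X)" for X
  define stuck where "stuck X \<longleftrightarrow> (\<exists>W. stuck_set d ?V X W \<and> real (card W) \<le> \<gamma> * real n)" for X
  let ?l = "subset_exp ?S r (\<lambda>X. if large X then 0 else 1)" and ?s = "subset_exp ?S r (\<lambda>X. if stuck X then 1 else 0)"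
  have "measure_pmf.prob (binomial_random_graph n r) {G. d_rigid d G}
      = subset_exp ?S r (\<lambda>X. if d_rigid d (?V, X) then 1 else 0)"
    using prob_random_subset[OF finS r, of "\<lambda>X. d_rigid d (?V, X)"]
    by (simp add: binomial_random_graph_def vimage_def)
  moreover have "subset_exp ?S r (\<lambda>_. 1) \<le> subset_exp ?S r (\<lambda>X. (if d_rigid d (?V, X) then 1 else 0)
      + ((if large X then 0 else 1) + (if stuck X then 1 else 0)))"
  proof (rule subset_exp_mono[OF r])
    fix X assume X: "X \<subseteq> ?S"
    have "d_rigid d (?V, X)" if "large X" "\<not> stuck X"
    proof (rule d_rigid_if_complete[OF generic_framework_axioms _ X])
      show "?S \<subseteq> cl X" using that unfolding large_def stuck_def by (rule complete_if_no_stuck_set)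
    qed (use p in auto)
    then show "1 \<le> (if d_rigid d (?V, X) then 1 else 0) + ((if large X then 0 else 1) + (if stuck X then 1 else (0::real)))"
      by auto
  qed
  then have "1 \<le> subset_exp ?S r (\<lambda>X. if d_rigid d (?V, X) then 1 else 0) + (?l + ?s)"
    by (simp only: subset_exp_add subset_exp_const[OF finS])
  moreover have "?l \<le> exp (real d * real n - \<gamma> * (real n)\<^sup>2 * r / 256)
      + exp (2 * sqrt (real d * real n) - (real n)\<^sup>2 * r / (368 * real d))"
    using prob_no_large_complete_set[OF d(1) _ r \<gamma>] d by (simp add: large_def)
  moreover have "?s \<le> exp (real n * exp (real d * ln (1 / z) - r * (1 - z) * (1 - \<gamma>) * real n)) - 1"
    using prob_stuck_set[of ?V z r d \<gamma>] z r by (simp add: stuck_def)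
  ultimately show ?thesis by linarith
qed

text \<open>A vertex has degree about \<open>n p\<close>; the factors \<open>1 - z\<close> and \<open>1 - \<gamma>\<close> and the number of
  dimensions \<open>d \<le> c n p\<close> cost only a small fraction of the slack \<open>\<epsilon>\<close> in the union bound over
  stuck sets.\<close>

lemma failure_bound:
  fixes \<epsilon> \<gamma> c r :: real
  assumes \<epsilon>: "0 < \<epsilon>" "\<epsilon> \<le> 1" and \<gamma>: "\<gamma> = \<epsilon> / 16"
    and c: "0 < c" "c * ln (1 / \<gamma>) \<le> \<epsilon> / 16" "c \<le> \<gamma> / 512" "c \<le> 1 / 1000"
    and r: "r \<le> 1" "(1 + \<epsilon>) * ln (real n) \<le> r * real n" and n: "2 \<le> n"
    and d: "1 \<le> d" "real d \<le> c * real n * r"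
  shows "exp (real d * real n - \<gamma> * (real n)\<^sup>2 * r / 256)
      + exp (2 * sqrt (real d * real n) - (real n)\<^sup>2 * r / (368 * real d))
      + (exp (real n * exp (real d * ln (1 / \<gamma>) - r * (1 - \<gamma>) * (1 - \<gamma>) * real n)) - 1)
    \<le> exp (- (\<gamma> / 512) * real n * ln (real n)) + exp (- real n) + (exp (exp (- (\<epsilon> / 2) * ln (real n))) - 1)"
proof -
  define x where "x = real n"
  define D where "D = real d"
  have x: "2 \<le> x" using n by (simp add: x_def)
  have ln: "0 < ln x" using x by simp
  have D: "1 \<le> D" "D \<le> c * x * r" using d by (auto simp: D_def x_def)
  have rx: "(1 + \<epsilon>) * ln x \<le> r * x" using r by (simp add: x_def)
  have "0 < (1 + \<epsilon>) * ln x" using \<epsilon> ln by simp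
  then have rx_pos: "0 < r * x" using rx by linarith
  then have r_pos: "0 < r" using x by (simp add: zero_less_mult_iff)
  have \<gamma>_pos: "0 < \<gamma>" "\<gamma> \<le> 1 / 16" using \<epsilon> \<gamma> by auto
  have lnx: "ln x \<le> r * x"
  proof -
    have "0 \<le> \<epsilon> * ln x" using \<epsilon> ln by simp
    then show ?thesis using rx by (simp add: algebra_simps)
  qed
  \<comment> \<open>The bound \<open>c \<le> \<gamma> / 512\<close> makes the positive term at most
    half of the negative one.\<close>
  have e1: "D * x - \<gamma> * x\<^sup>2 * r / 256 \<le> - (\<gamma> / 512) * x * ln x"
  proof -
    have "D * x \<le> (c * x * r) * x" using D x by (intro mult_right_mono) auto
    also have "\<dots> = c * (r * x * x)" by simp
    also have "\<dots> \<le> \<gamma> / 512 * (r * x * x)" using c(3) rx_pos x by (intro mult_right_mono) auto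
    finally have "D * x - \<gamma> * x\<^sup>2 * r / 256 \<le> - (\<gamma> / 512 * x * (r * x))"
      by (simp add: power2_eq_square algebra_simps)
    moreover have "\<gamma> / 512 * x * ln x \<le> \<gamma> / 512 * x * (r * x)"
      using lnx \<gamma>_pos x by (intro mult_left_mono) auto
    ultimately show ?thesis by linarith
  qed
  \<comment> \<open>Since \<open>D \<le> x * r / 1000\<close> and 736 \<le> 1000, the negative term
    is at least \<open>2 * x\<close>, while the square root contributes at most
    \<open>x\<close>.\<close>
  have e2: "2 * sqrt (D * x) - x\<^sup>2 * r / (368 * D) \<le> - x"
  proof -
    have "c * x * r \<le> 1 / 1000 * x * 1"
      using c r r_pos x by (intro mult_mono) auto
    then have "D \<le> x / 1000" using D(2) by simp
    then have "D * x \<le> (x / 1000) * x" using x by (intro mult_right_mono) auto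
    also have "\<dots> \<le> (x / 2)\<^sup>2" by (simp add: power2_eq_square)
    finally have "sqrt (D * x) \<le> x / 2" using x by (intro real_le_lsqrt) auto
    moreover have "2 * x \<le> x\<^sup>2 * r / (368 * D)"
    proof -
      have "D \<le> 1 / 1000 * (x * r)"
        using D(2) c(4) rx_pos mult_right_mono[OF c(4), of "x * r"] by (simp add: mult.commute mult.left_commute)
      then have "736 * D \<le> x * r" using D(1) by linarith
      then have "x * (736 * D) \<le> x * (x * r)" using x by (intro mult_left_mono) auto
      then show ?thesis using D(1) by (simp add: field_simps power2_eq_square)
    qed
    ultimately show ?thesis by linarith
  qed
  \<comment> \<open>The dimension costs \<open>\<epsilon> / 16\<close> and the factors
    \<open>1 - \<gamma>\<close> cost \<open>\<epsilon> / 8\<close> of \<open>r * x\<close>. What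
    remains is at least \<open>(1 + \<epsilon> / 2) * ln x\<close>, one \<open>ln x\<close> of which
    absorbs the factor \<open>x\<close>.\<close>
  have e3: "x * exp (D * ln (1 / \<gamma>) - r * (1 - \<gamma>) * (1 - \<gamma>) * x) \<le> exp (- (\<epsilon> / 2) * ln x)"
  proof -
    have L: "0 \<le> ln (1 / \<gamma>)" using \<gamma>_pos by simp
    have "D * ln (1 / \<gamma>) \<le> (c * x * r) * ln (1 / \<gamma>)" using D L by (intro mult_right_mono) auto
    also have "\<dots> = (c * ln (1 / \<gamma>)) * (r * x)" by simp
    also have "\<dots> \<le> \<epsilon> / 16 * (r * x)" using c(2) rx_pos by (intro mult_right_mono) auto
    finally have 1: "D * ln (1 / \<gamma>) \<le> \<epsilon> / 16 * (r * x)" .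
    have "(1 - \<epsilon> / 8) * (r * x) \<le> ((1 - \<gamma>) * (1 - \<gamma>)) * (r * x)"
      using rx_pos by (intro mult_right_mono) (auto simp: \<gamma> algebra_simps)
    then have 2: "(1 - \<epsilon> / 8) * (r * x) \<le> r * (1 - \<gamma>) * (1 - \<gamma>) * x" by (simp add: mult_ac)
    have "(1 - 3 * \<epsilon> / 16) * ((1 + \<epsilon>) * ln x) \<le> (1 - 3 * \<epsilon> / 16) * (r * x)"
      using rx \<epsilon> by (intro mult_left_mono) auto
    moreover have "(1 + \<epsilon> / 2) * ln x \<le> (1 - 3 * \<epsilon> / 16) * ((1 + \<epsilon>) * ln x)"
    proof -
      have "\<epsilon> * \<epsilon> \<le> \<epsilon>" using \<epsilon> by (simp add: mult_left_le)
      moreover have "(1 - 3 * \<epsilon> / 16) * (1 + \<epsilon>) = 1 + 13 / 16 * \<epsilon> - 3 / 16 * (\<epsilon> * \<epsilon>)"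
        by (simp add: field_simps)
      ultimately have "1 + \<epsilon> / 2 \<le> (1 - 3 * \<epsilon> / 16) * (1 + \<epsilon>)" using \<epsilon> by linarith
      then show ?thesis using ln by (simp add: mult_right_mono flip: mult.assoc)
    qed
    moreover have "(1 - 3 * \<epsilon> / 16) * (r * x) = (1 - \<epsilon> / 8) * (r * x) - \<epsilon> / 16 * (r * x)"
      by (simp add: algebra_simps)
    moreover have "(1 + \<epsilon> / 2) * ln x = ln x + \<epsilon> / 2 * ln x" by (simp add: algebra_simps)
    ultimately have "ln x + (D * ln (1 / \<gamma>) - r * (1 - \<gamma>) * (1 - \<gamma>) * x) \<le> - (\<epsilon> / 2) * ln x"
      using 1 2 by linarith
    then have "exp (ln x + (D * ln (1 / \<gamma>) - r * (1 - \<gamma>) * (1 - \<gamma>) * x)) \<le> exp (- (\<epsilon> / 2) * ln x)"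
      by simp
    then show ?thesis using x unfolding exp_add by simp
  qed
  show ?thesis
    unfolding x_def[symmetric] D_def[symmetric] using e1 e2 e3
    by (intro add_mono diff_right_mono) auto
qed

theorem theorem1p1:
  fixes \<epsilon> :: real
  assumes "\<epsilon> > 0"
  shows "\<exists>c::real. c > 0 \<and>
    (\<forall>p :: nat \<Rightarrow> real.
       (\<forall>n. 0 \<le> p n \<and> p n \<le> 1) \<longrightarrow>
       (\<forall>\<^sub>F n in sequentially. p n \<ge> (1 + \<epsilon>) * ln (real n) / real n) \<longrightarrow>
       with_high_probability (\<lambda>n. binomial_random_graph n (p n))
         (\<lambda>n G. d_rigid (nat \<lfloor>c * real n * p n\<rfloor>) G))"
proof -
  \<comment> \<open>The estimates are made for slack at most 1; a larger \<open>\<epsilon>\<close>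
    only strengthens the lower bound on \<open>p\<close>.\<close>
  define \<delta> where "\<delta> = min \<epsilon> 1"
  have \<delta>: "0 < \<delta>" "\<delta> \<le> 1" "\<delta> \<le> \<epsilon>" using assms by (auto simp: \<delta>_def)
  define \<gamma> where "\<gamma> = \<delta> / 16"
  have \<gamma>: "0 < \<gamma>" "\<gamma> \<le> 1 / 2" "\<gamma> \<le> 1" "\<gamma> < 1" using \<delta> by (auto simp: \<gamma>_def)
  have L: "0 < ln (1 / \<gamma>)" using \<gamma> by simp
  \<comment> \<open>The first bound serves the stuck sets, the second the phase with many missing
    pairs, the third the completing phase and the condition \<open>128 * d \<le> n\<close>.\<close>
  define c where "c = min (\<delta> / 16 / ln (1 / \<gamma>)) (min (\<gamma> / 512) (1 / 1000))"
  have "c \<le> \<delta> / 16 / ln (1 / \<gamma>)" by (simp add: c_def)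
  then have "c * ln (1 / \<gamma>) \<le> \<delta> / 16" by (rule pos_le_divide_eq[OF L, THEN iffD1])
  moreover have "0 < c" "c \<le> \<gamma> / 512" "c \<le> 1 / 1000"
    using \<delta>(1) \<gamma>(1) L by (auto simp: c_def)
  ultimately have c: "0 < c" "c * ln (1 / \<gamma>) \<le> \<delta> / 16" "c \<le> \<gamma> / 512" "c \<le> 1 / 1000" by auto
  let ?B = "\<lambda>n::nat. exp (- (\<gamma> / 512) * real n * ln (real n)) + exp (- real n) + (exp (exp (- (\<delta> / 2) * ln (real n))) - 1)"
  have B: "?B \<longlonglongrightarrow> 0" using \<gamma>(1) \<delta>(1) by real_asymp
  have "with_high_probability (\<lambda>n. binomial_random_graph n (p n)) (\<lambda>n G. d_rigid (nat \<lfloor>c * real n * p n\<rfloor>) G)"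
    if p: "\<And>n. 0 \<le> p n \<and> p n \<le> 1" and ev: "\<forall>\<^sub>F n in sequentially. p n \<ge> (1 + \<epsilon>) * ln (real n) / real n" for p :: "nat \<Rightarrow> real"
    unfolding with_high_probability_def
  proof (rule tendsto_sandwich)
    let ?P = "\<lambda>n. measure_pmf.prob (binomial_random_graph n (p n)) {G. d_rigid (nat \<lfloor>c * real n * p n\<rfloor>) G}"
    \<comment> \<open>This makes the dimension at least 1 for all large \<open>n\<close>.\<close>
    have "filterlim (\<lambda>n. c * ln (real n)) at_top sequentially" using c(1) by real_asymp
    then have "\<forall>\<^sub>F n in sequentially. 1 \<le> c * ln (real n)" by (simp add: filterlim_at_top)
    with ev eventually_ge_at_top[of 2] show "\<forall>\<^sub>F n in sequentially. 1 - ?B n \<le> ?P n"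
    proof eventually_elim
      case (elim n)
      let ?d = "nat \<lfloor>c * real n * p n\<rfloor>"
      have n: "0 < real n" and ln: "0 < ln (real n)" using elim(2) by auto
      have "(1 + \<epsilon>) * ln (real n) \<le> p n * real n"
        using elim(1) n by (simp add: pos_divide_le_eq)
      moreover have "(1 + \<delta>) * ln (real n) \<le> (1 + \<epsilon>) * ln (real n)"
        using \<delta> ln by (intro mult_right_mono) auto
      ultimately have pn: "(1 + \<delta>) * ln (real n) \<le> p n * real n" by linarith
      have "ln (real n) \<le> p n * real n"
      proof -
        have "0 \<le> \<delta> * ln (real n)" using \<delta> ln by simp
        then show ?thesis using pn by (simp add: algebra_simps)
      qed
      then have "c * ln (real n) \<le> c * (p n * real n)" using c(1) by (intro mult_left_mono) auto
      then have one: "1 \<le> c * real n * p n" using elim(3) by (simp add: mult_ac)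
      have d: "1 \<le> ?d" using one by (simp add: le_nat_iff)
      have d_le: "real ?d \<le> c * real n * p n" using one by simp
      also have "\<dots> \<le> 1 / 1000 * real n * 1"
        using c p[of n] by (intro mult_mono) auto
      finally have "128 * real ?d \<le> real n" using n by linarith
      then have "real (128 * ?d) \<le> real n" by simp
      then have d': "128 * ?d \<le> n" by (simp only: of_nat_le_iff)
      \<comment> \<open>The Chernoff parameter \<open>z\<close> is taken equal to
        \<open>\<gamma>\<close>.\<close>
      have "?P n \<ge> 1 - (exp (real ?d * real n - \<gamma> * (real n)\<^sup>2 * p n / 256)
          + exp (2 * sqrt (real ?d * real n) - (real n)\<^sup>2 * p n / (368 * real ?d))
          + (exp (real n * exp (real ?d * ln (1 / \<gamma>) - p n * (1 - \<gamma>) * (1 - \<gamma>) * real n)) - 1))"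
        using p[of n] by (intro prob_d_rigid_ge[OF d d' _ _ \<gamma>(1,2,1,3)]) auto
      then show ?case
        using failure_bound[OF \<delta>(1,2) \<gamma>_def c _ pn elim(2) d d_le] p[of n] by linarith
    qed
    show "\<forall>\<^sub>F n in sequentially. ?P n \<le> 1" by simp
    show "(\<lambda>n. 1 - ?B n) \<longlonglongrightarrow> 1" using tendsto_diff[OF tendsto_const[of 1] B] by simp
  qed simp
  then show ?thesis using c(1) by blast
qed

end
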